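(* Let $\lambda=\{\lambda_n\}_{n\ge1}$ be a nondecreasing sequence of integers with $1\le\lambda_n\le n$ for all $n\in\mathbb{N}$. (a) If $n=O(\lambda_n)$ as $n\to\infty$, then for every $f\in L^1([0,1))$, $$V_n^{(\lambda)}(f;x)\longrightarrow f(x)\qquad\text{for almost every }x\in[0,1).$$ (b) Let $\omega:[0,\infty)\to[0,\infty)$ be an Orlicz function (i.e. a continuous convex function on $[0,\infty)$ with $\omega(0)=0$, $\omega(u)>0$ for $u>0$, and $\omega(u)\to\infty$ as $u\to\infty$) such that $$\omega(t)=o\bigl(t\sqrt{\log t}\bigr)\qquad(t\to\infty).$$ If $\sup_{n\ge1} n/\lambda_n=\infty$, then there exists a function $f\in L_\omega([0,1))$ such that $$\limsup_{n\to\infty}|V_n^{(\lambda)}(f;x)|=\infty\qquad\text{for every }x\in[0,1).$$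
   Context: For $j\in\mathbb{N}_0$, the Rademacher functions are $r_j(x):=(-1)^{\lfloor 2^{j+1}x\rfloor}$ on $[0,1)$. For $n\in\mathbb{N}_0$ with binary expansion $n=\sum_{j\ge0}n_j2^j$, $n_j\in\{0,1\}$, the Walsh--Paley function is $w_n(x):=\prod_{j\ge0}r_j(x)^{n_j}$. For $f\in L^1([0,1))$, $\widehat f(n):=\int_0^1 f(x)w_n(x)\,dx$, and the Walsh partial sums are $S_n(f;x):=\sum_{k=0}^{n-1}\widehat f(k)w_k(x)$ for $n\in\mathbb{N}$ (with $S_0(f)=0$). The de la Vallée Poussin means are $$V_n^{(\lambda)}(f;x):=\frac{1}{\lambda_n+1}\sum_{k=n-\lambda_n}^{n}S_k(f;x),\qquad n\in\mathbb{N}.$$ For an Orlicz function $\omega$, the Orlicz class is $L_\omega([0,1)):=\{f\text{ measurable on }[0,1):\int_0^1\omega(|f(x)|)\,dx<\infty\}$. *)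

theory Defs
  imports "HOL-Analysis.Analysis" "HOL-Library.Landau_Symbols"
begin

definition rademacher :: "nat \<Rightarrow> real \<Rightarrow> real" where
  "rademacher j x = (-1) ^ nat \<lfloor>2 ^ (j + 1) * x\<rfloor>"

text \<open>Walsh--Paley functions: product of r_j^(n_j) over the binary digits n_j of n.
  Since n < 2^n, all binary digits of index >= n vanish.\<close>
definition walsh :: "nat \<Rightarrow> real \<Rightarrow> real" where
  "walsh n x = (\<Prod>j<n. rademacher j x ^ (n div 2 ^ j mod 2))"

definition walsh_coeff :: "(real \<Rightarrow> real) \<Rightarrow> nat \<Rightarrow> real" where
  "walsh_coeff f n = (LINT x:{0..<1}|lebesgue. f x * walsh n x)"

definition walsh_partial_sum :: "(real \<Rightarrow> real) \<Rightarrow> nat \<Rightarrow> real \<Rightarrow> real" where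
  "walsh_partial_sum f n x = (\<Sum>k<n. walsh_coeff f k * walsh k x)"

definition dlvp_mean :: "(nat \<Rightarrow> nat) \<Rightarrow> nat \<Rightarrow> (real \<Rightarrow> real) \<Rightarrow> real \<Rightarrow> real" where
  "dlvp_mean lam n f x =
     (1 / (real (lam n) + 1)) * (\<Sum>k\<in>{n - lam n..n}. walsh_partial_sum f k x)"

definition orlicz_function :: "(real \<Rightarrow> real) \<Rightarrow> bool" where
  "orlicz_function \<omega> \<longleftrightarrow>
     continuous_on {0..} \<omega> \<and> convex_on {0..} \<omega> \<and> \<omega> 0 = 0 \<and>
     (\<forall>u>0. \<omega> u > 0) \<and> filterlim \<omega> at_top at_top"

definition orlicz_class :: "(real \<Rightarrow> real) \<Rightarrow> (real \<Rightarrow> real) set" where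
  "orlicz_class \<omega> = {f. f \<in> borel_measurable (restrict_space lebesgue {0..<1}) \<and>
      (\<integral>\<^sup>+ x\<in>{0..<1}. ennreal (\<omega> \<bar>f x\<bar>) \<partial>lebesgue) < \<infinity>}"

end

theory Submission
  imports Defs
begin

text \<open>
  (a) Peeling off the leading binary digit of n bounds the n-th Fejer kernel by averages over dyadic
  intervals and over their translates in one binary digit. A stopping time argument shows that the
  corresponding maximal operator has weak type (1,1), so the Fejer means converge almost everywhere
  by density of Walsh polynomials; a de la Vallee Poussin mean is a difference quotient of sums of
  partial sums, which is stable under o(n) errors when n = O(lam n).

  (b) Write S n for the partial sums and T n u = w_n S n (w_n u); on a polynomial whose frequencies
  have leading digit t, T n is the identity or zero according to the digit t of n. Split the digits
  into J = 2^k blocks, each consisting of k + 1 class digits and a sign digit. For fixed x, let h be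
  the product over the blocks of the function that equals the sign digit on the class of x and 1
  elsewhere. Each sign digit can contribute a term of modulus at least 1/2 to T n h at x, and n can
  be chosen to keep only contributions of one sign, so that T n h at x is of order J. To serve all x
  one needs about J^2 factors; a Riesz product of mean 1 and height 2^(O(J^2)) in further high
  digits makes every product of these factors visible in some of its partial sums. So the height H
  gives partial sums of order sqrt (ln H) everywhere. Dilations of such functions are placed in
  frequency windows above the values of lam, where the means agree with partial sums.
\<close>

subsection \<open>Walsh functions\<close>

text \<open>A plain product of sign digits would not do: T n tests only its last digit, and nothing
  accumulates. A block factor differs from 1 only on one of 2 ^ (k + 1) classes, so each later block
  damps the contributions of earlier ones merely by 1 - 1 / 2 ^ (k + 1), and half of each survives
  all J blocks. But the good product then depends on x, while the function must not. The Riesz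
  product therefore holds the factors of all classes of all blocks, and x only selects the frequency
  window in which its own product is read off. These J * (2 ^ (k + 1) + 1) factors are at most 2, so
  the logarithm of the height is of order J ^ 2; this is the origin of sqrt (ln t).

  In (a), a translate can be heavy where the averages at the point itself show nothing. But outside
  the large set, a translate in digit k is heavy at level d only if it stops at some level t with d
  < t <= k, and the weights 2 ^ d / 2 ^ (k + 1) over these d and k add up to at most 1. So the
  excess is bounded in L1 norm even when summed over all levels.\<close>

lemma xor_less_power2:
  fixes a b :: nat
  assumes "a < 2 ^ M" "b < 2 ^ M"
  shows "xor a b < 2 ^ M"
proof -
  have "take_bit M (xor a b) = xor a b"
    using assms by (simp add: take_bit_nat_eq_self)
  then show ?thesis
    by (metis take_bit_nat_less_exp)
qed

text \<open>The highest digit at which \<open>xor n m\<close> differs from \<open>n\<close> is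
  \<open>t\<close>, so the value of that digit in \<open>n\<close> decides the comparison. This
  turns a truncation of frequencies at \<open>n\<close> into a test of one digit of
  \<open>n\<close>.\<close>

lemma xor_less_iff_bit:
  fixes n m :: nat
  assumes "2 ^ t \<le> m" "m < 2 ^ (t + 1)"
  shows "xor n m < n \<longleftrightarrow> bit n t"
proof -
  have m1: "m div 2 ^ t = 1"
    using assms by (intro div_nat_eqI) auto
  have "xor n m div 2 ^ t = xor (n div 2 ^ t) 1"
    using m1 by (simp only: drop_bit_eq_div[symmetric] drop_bit_xor)
  also have "\<dots> = (if odd (n div 2 ^ t) then n div 2 ^ t - 1 else n div 2 ^ t + 1)"
    by (auto simp: xor_Suc_0_eq)
  finally have x: "xor n m div 2 ^ t = (if odd (n div 2 ^ t) then n div 2 ^ t - 1 else n div 2 ^ t + 1)" .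
  show ?thesis
  proof (cases "odd (n div 2 ^ t)")
    case True
    then have "xor n m div 2 ^ t < n div 2 ^ t"
      using x by (auto elim: oddE)
    then have "xor n m < n"
      by (meson div_le_mono not_less)
    then show ?thesis using True by (simp add: bit_iff_odd)
  next
    case False
    then have "n div 2 ^ t < xor n m div 2 ^ t" using x by simp
    then have "n < xor n m"
      by (meson div_le_mono not_less)
    then show ?thesis using False by (simp add: bit_iff_odd)
  qed
qed

lemma xor_power2_eq_add:
  fixes m :: nat
  assumes "m < 2 ^ t"
  shows "xor (2 ^ t) m = 2 ^ t + m"
proof (rule disjunctive_add_eq_xor[symmetric])
  have "bit m n \<Longrightarrow> n < t" for n
    using assms by (metis bit_take_bit_iff take_bit_nat_eq_self)
  then show "and (2 ^ t) m = 0"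
    by (intro bit_eqI) (auto simp: bit_simps)
qed

lemma rademacher_cases: "rademacher j x = 1 \<or> rademacher j x = -1"
  unfolding rademacher_def by (metis neg_one_even_power neg_one_odd_power)

lemma rademacher_mult_self [simp]: "rademacher j x * rademacher j x = 1"
  using rademacher_cases[of j x] by auto

lemma abs_rademacher [simp]: "\<bar>rademacher j x\<bar> = 1"
  using rademacher_cases[of j x] by auto

lemma rademacher_scale: "rademacher j (2 ^ s * x) = rademacher (j + s) x"
  by (simp add: rademacher_def power_add algebra_simps)

text \<open>Digits beyond the leading one contribute factors 1, so the range can be any
  \<open>M\<close> with \<open>n < 2 ^ M\<close>; Walsh functions can then be multiplied over a
  common range.\<close>

lemma walsh_eq_prod:
  assumes "n < 2 ^ M"
  shows "walsh n x = (\<Prod>j<M. if bit n j then rademacher j x else 1)"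
proof -
  have eq: "rademacher j x ^ (n div 2 ^ j mod 2) = (if bit n j then rademacher j x else 1)" for j
    by (auto simp: bit_iff_odd odd_iff_mod_2_eq_one)
  have bd: "bit n j \<Longrightarrow> j < M" for j
    using assms by (metis bit_take_bit_iff take_bit_nat_eq_self)
  have bd': "bit n j \<Longrightarrow> j < n" for j
    by (metis bit_take_bit_iff take_bit_nat_eq_self less_exp)
  have "walsh n x = (\<Prod>j<n. if bit n j then rademacher j x else 1)"
    unfolding walsh_def eq ..
  also have "\<dots> = (\<Prod>j<max n M. if bit n j then rademacher j x else 1)"
    by (rule prod.mono_neutral_left) (auto dest: bd')
  also have "\<dots> = (\<Prod>j<M. if bit n j then rademacher j x else 1)"
    by (rule prod.mono_neutral_right) (auto dest: bd)
  finally show ?thesis .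
qed

lemma walsh_0 [simp]: "walsh 0 x = 1"
  by (simp add: walsh_def)

lemma walsh_xor: "walsh (xor a b) x = walsh a x * walsh b x"
proof -
  define M where "M = max a b"
  have a: "a < 2 ^ M" and b: "b < 2 ^ M"
    using less_exp[of a] less_exp[of b] power_increasing[of a M "2::nat"] power_increasing[of b M "2::nat"]
    by (simp_all add: M_def del: less_exp)
  show ?thesis
    unfolding walsh_eq_prod[OF a] walsh_eq_prod[OF b] walsh_eq_prod[OF xor_less_power2[OF a b]]
      prod.distrib[symmetric]
    by (rule prod.cong) (auto simp: bit_xor_iff)
qed

lemma walsh_mult_self [simp]: "walsh n x * walsh n x = 1"
  by (simp flip: walsh_xor)

lemma walsh_cases: "walsh n x = 1 \<or> walsh n x = -1"
  using walsh_mult_self[of n x] by (metis square_eq_1_iff)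

lemma abs_walsh [simp]: "\<bar>walsh n x\<bar> = 1"
  using walsh_cases[of n x] by auto

lemma walsh_power2: "walsh (2 ^ t) x = rademacher t x"
proof -
  have "walsh (2 ^ t) x = (\<Prod>j<t + 1. if bit (2 ^ t :: nat) j then rademacher j x else 1)"
    by (rule walsh_eq_prod) simp
  also have "\<dots> = rademacher t x"
    by (simp add: bit_simps)
  finally show ?thesis .
qed

lemma walsh_power2_add: "m < 2 ^ t \<Longrightarrow> walsh (2 ^ t + m) x = rademacher t x * walsh m x"
  by (simp flip: xor_power2_eq_add walsh_power2 add: walsh_xor)

text \<open>Dilation by \<open>2 ^ s\<close> shifts all digits of the frequency by \<open>s\<close>.
  Since \<open>rademacher\<close> is given by its formula on the whole line,
  \<open>2 ^ s * x\<close> need not be reduced modulo 1.\<close>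

lemma walsh_scale: "walsh k (2 ^ s * x) = walsh (k * 2 ^ s) x"
proof -
  have k: "k * 2 ^ s < 2 ^ (s + k)"
    by (simp add: power_add mult.commute)
  have "walsh k (2 ^ s * x) = (\<Prod>j<k. if bit k j then rademacher (j + s) x else 1)"
    by (subst walsh_eq_prod[OF less_exp]) (simp add: rademacher_scale cong: if_cong)
  also have "\<dots> = (\<Prod>j\<in>{s..<s+k}. if bit (k * 2 ^ s) j then rademacher j x else 1)"
    by (rule prod.reindex_bij_witness[of _ "\<lambda>j. j - s" "\<lambda>j. j + s"])
       (auto simp: bit_push_bit_iff simp flip: push_bit_eq_mult)
  also have "\<dots> = (\<Prod>j<s+k. if bit (k * 2 ^ s) j then rademacher j x else 1)"
    by (rule prod.mono_neutral_left) (auto simp: bit_push_bit_iff simp flip: push_bit_eq_mult)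
  also have "\<dots> = walsh (k * 2 ^ s) x"
    by (rule walsh_eq_prod[OF k, symmetric])
  finally show ?thesis .
qed

subsection \<open>Dyadic intervals\<close>

definition dyadic_index :: "nat \<Rightarrow> real \<Rightarrow> nat" where
  "dyadic_index M x = nat \<lfloor>2 ^ M * x\<rfloor>"

definition dyadic_cell :: "nat \<Rightarrow> nat \<Rightarrow> real set" where
  "dyadic_cell M X = {real X / 2 ^ M..<(real X + 1) / 2 ^ M}"

lemma dyadic_index_div:
  assumes "d \<le> M"
  shows "dyadic_index M x div 2 ^ d = dyadic_index (M - d) x"
proof -
  have "\<lfloor>2 ^ M * x\<rfloor> div 2 ^ d = \<lfloor>2 ^ M * x / 2 ^ d\<rfloor>"
    using floor_divide_real_eq_div[of "2 ^ d" "2 ^ M * x"] by simp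
  also have "2 ^ M * x / 2 ^ d = 2 ^ (M - d) * x"
    using assms by (simp add: power_diff)
  finally have eq: "\<lfloor>2 ^ M * x\<rfloor> div 2 ^ d = \<lfloor>2 ^ (M - d) * x\<rfloor>" .
  show ?thesis
  proof (cases "0 \<le> x")
    case True
    then show ?thesis
      by (simp add: dyadic_index_def nat_div_distrib nat_power_eq flip: eq)
  next
    case False
    then have "2 ^ n * x \<le> 0" for n
      by (simp add: mult_nonneg_nonpos)
    then have "dyadic_index n x = 0" for n
      unfolding dyadic_index_def using le_less_trans[OF _ zero_less_one, of "2 ^ n * x"]
      by (simp add: floor_le_iff)
    then show ?thesis by simp
  qed
qed

lemma dyadic_index_less: "x < 1 \<Longrightarrow> dyadic_index M x < 2 ^ M"
  unfolding dyadic_index_def by (simp add: nat_less_iff floor_less_iff)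

lemma dyadic_cell_iff:
  assumes "0 \<le> x"
  shows "x \<in> dyadic_cell M X \<longleftrightarrow> dyadic_index M x = X"
proof -
  have "x \<in> dyadic_cell M X \<longleftrightarrow> real X \<le> 2 ^ M * x \<and> 2 ^ M * x < real X + 1"
    unfolding dyadic_cell_def by (auto simp: field_simps)
  also have "\<dots> \<longleftrightarrow> \<lfloor>2 ^ M * x\<rfloor> = int X"
    by (simp add: floor_eq_iff)
  also have "\<dots> \<longleftrightarrow> dyadic_index M x = X"
    using assms unfolding dyadic_index_def by auto
  finally show ?thesis .
qed

lemma dyadic_index_of_nat [simp]: "dyadic_index M (real X / 2 ^ M) = X"
  by (simp add: dyadic_index_def)

lemma rademacher_dyadic_index:
  assumes "j < M"
  shows "rademacher j x = (-1) ^ (dyadic_index M x div 2 ^ (M - 1 - j))"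
  using assms by (subst dyadic_index_div) (auto simp: rademacher_def dyadic_index_def)

lemma walsh_dyadic_cong:
  assumes "k < 2 ^ M" "dyadic_index M x = dyadic_index M y"
  shows "walsh k x = walsh k y"
  unfolding walsh_eq_prod[OF assms(1)]
  by (rule prod.cong) (auto simp: rademacher_dyadic_index assms(2))

lemma walsh_dyadic_index:
  assumes "k < 2 ^ M"
  shows "walsh k x = walsh k (real (dyadic_index M x) / 2 ^ M)"
  by (rule walsh_dyadic_cong[OF assms]) simp

lemma dyadic_cell_sets [measurable]: "dyadic_cell M X \<in> sets lebesgue"
  by (simp add: dyadic_cell_def)

lemma dyadic_cell_subset:
  assumes "X < 2 ^ M"
  shows "dyadic_cell M X \<subseteq> {0..<1}"
proof -
  have "real X + 1 \<le> 2 ^ M"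
    using assms by (metis Suc_leI of_nat_Suc of_nat_le_iff of_nat_numeral of_nat_power add.commute)
  then have "(real X + 1) / 2 ^ M \<le> 1" by simp
  then show ?thesis unfolding dyadic_cell_def by (auto intro: order_trans)
qed

lemma indicator_unit_interval_eq_sum:
  fixes \<phi> :: "nat \<Rightarrow> real"
  shows "indicator {0..<1} x * \<phi> (dyadic_index M x) = (\<Sum>X<2^M. \<phi> X * indicator (dyadic_cell M X) x)"
proof (cases "x \<in> {0..<1}")
  case True
  have "(\<Sum>X<2^M. \<phi> X * indicator (dyadic_cell M X) x) = (\<Sum>X<2^M. if X = dyadic_index M x then \<phi> X else 0)"
    using True by (intro sum.cong) (auto simp: dyadic_cell_iff indicator_def)
  also have "\<dots> = \<phi> (dyadic_index M x)"
    using True by (simp add: dyadic_index_less)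
  finally show ?thesis using True by simp
next
  case False
  then have "x \<notin> dyadic_cell M X" if "X < 2 ^ M" for X
    using dyadic_cell_subset[OF that] by auto
  then show ?thesis using False by simp
qed

lemma set_integrable_dyadic_cell:
  fixes f :: "real \<Rightarrow> real"
  assumes "set_integrable lebesgue {0..<1} f" "X < 2 ^ M"
  shows "set_integrable lebesgue (dyadic_cell M X) f"
  by (rule set_integrable_subset[OF assms(1) _ dyadic_cell_subset[OF assms(2)]]) simp

text \<open>A function of the dyadic index is a finite combination of cell indicators. Thus Walsh
  coefficients of index below \<open>2 ^ M\<close> depend on \<open>f\<close> only through its
  integrals over the cells of rank \<open>M\<close>, which makes the maximal estimate a finite
  problem.\<close>

lemma
  fixes f :: "real \<Rightarrow> real" and \<phi> :: "nat \<Rightarrow> real"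
  assumes f: "set_integrable lebesgue {0..<1} f"
  shows set_integrable_mult_dyadic: "set_integrable lebesgue {0..<1} (\<lambda>x. f x * \<phi> (dyadic_index M x))"
    and set_integral_mult_dyadic: "(LINT x:{0..<1}|lebesgue. f x * \<phi> (dyadic_index M x)) =
           (\<Sum>X<2^M. \<phi> X * (LINT x:dyadic_cell M X|lebesgue. f x))"
proof -
  have eq: "indicator {0..<1} x *\<^sub>R (f x * \<phi> (dyadic_index M x)) =
    (\<Sum>X<2^M. \<phi> X * (indicator (dyadic_cell M X) x *\<^sub>R f x))" for x
  proof -
    have "indicator {0..<1} x *\<^sub>R (f x * \<phi> (dyadic_index M x)) =
        f x * (\<Sum>X<2^M. \<phi> X * indicator (dyadic_cell M X) x)"
      by (simp flip: indicator_unit_interval_eq_sum)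
    also have "\<dots> = (\<Sum>X<2^M. \<phi> X * (indicator (dyadic_cell M X) x *\<^sub>R f x))"
      unfolding sum_distrib_left by (rule sum.cong) auto
    finally show ?thesis .
  qed
  have i: "integrable lebesgue (\<lambda>x. \<phi> X * (indicator (dyadic_cell M X) x *\<^sub>R f x))" if "X \<in> {..<2^M}" for X
    using set_integrable_dyadic_cell[OF f, of X M] that
    unfolding set_integrable_def by (intro integrable_mult_right) auto
  show "set_integrable lebesgue {0..<1} (\<lambda>x. f x * \<phi> (dyadic_index M x))"
    unfolding set_integrable_def eq by (rule Bochner_Integration.integrable_sum[OF i])
  show "(LINT x:{0..<1}|lebesgue. f x * \<phi> (dyadic_index M x)) =
           (\<Sum>X<2^M. \<phi> X * (LINT x:dyadic_cell M X|lebesgue. f x))"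
    unfolding set_lebesgue_integral_def eq
    by (subst Bochner_Integration.integral_sum[OF i]) auto
qed

lemma measure_dyadic_cell [simp]: "measure lebesgue (dyadic_cell M X) = 1 / 2 ^ M"
proof -
  have "real X / 2 ^ M \<le> (real X + 1) / 2 ^ M"
    by (intro divide_right_mono) auto
  then show ?thesis
    by (simp add: dyadic_cell_def add_divide_distrib)
qed

lemma set_integrable_unit_const: "set_integrable lebesgue {0..<1::real} (\<lambda>x. c :: real)"
  unfolding set_integrable_def by (intro integrable_scaleR_left) simp

lemma set_integral_dyadic:
  fixes \<phi> :: "nat \<Rightarrow> real"
  shows
  "(LINT x:{0..<1}|lebesgue. \<phi> (dyadic_index M x)) = (\<Sum>X<2^M. \<phi> X) / 2 ^ M"
  using set_integral_mult_dyadic[OF set_integrable_unit_const[of 1], where \<phi> = \<phi> and M = M]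
  by (simp add: set_lebesgue_integral_def sum_divide_distrib)

lemma
  fixes f :: "real \<Rightarrow> real"
  assumes f: "set_integrable lebesgue {0..<1} f" and k: "k < 2 ^ M"
  shows set_integrable_mult_walsh': "set_integrable lebesgue {0..<1} (\<lambda>x. f x * walsh k x)"
    and walsh_coeff_dyadic: "walsh_coeff f k =
           (\<Sum>X<2^M. walsh k (real X / 2 ^ M) * (LINT x:dyadic_cell M X|lebesgue. f x))"
  using set_integrable_mult_dyadic[OF f, of "\<lambda>X. walsh k (real X / 2 ^ M)" M]
    set_integral_mult_dyadic[OF f, of "\<lambda>X. walsh k (real X / 2 ^ M)" M]
  by (simp_all add: walsh_coeff_def flip: walsh_dyadic_index[OF k])

lemma set_integrable_mult_walsh:
  fixes f :: "real \<Rightarrow> real"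
  assumes f: "set_integrable lebesgue {0..<1} f"
  shows "set_integrable lebesgue {0..<1} (\<lambda>x. f x * walsh k x)"
  by (rule set_integrable_mult_walsh'[OF f less_exp])

lemma set_integrable_walsh: "set_integrable lebesgue {0..<1} (walsh k)"
  using set_integrable_mult_walsh[OF set_integrable_unit_const[of 1]] by simp

lemma sum_lessThan_double: "(\<Sum>X<2 * n. f X) = (\<Sum>X<n. f (2 * X) + f (2 * X + 1))"
  for f :: "nat \<Rightarrow> real"
  by (induction n) (auto simp: numeral_2_eq_2 algebra_simps)

text \<open>The Rademacher factor of the leading digit \<open>t\<close> changes sign between the two
  halves of each cell of rank \<open>t\<close>, while the remaining product is constant there, so
  the cells of rank \<open>t + 1\<close> cancel in pairs.\<close>

lemma set_integral_walsh: "(LINT x:{0..<1}|lebesgue. walsh k x) = (if k = 0 then 1 else 0)"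
proof (cases "k = 0")
  case True
  have "walsh 0 = (\<lambda>x. 1)" by (rule ext) simp
  then show ?thesis using True set_integral_dyadic[of "\<lambda>_. 1" 0] by simp
next
  case False
  then obtain t where t: "2 ^ t \<le> k" "k < 2 ^ (t + 1)"
    using ex_power_ivl1[of 2 k] by auto
  define m where "m = k - 2 ^ t"
  have m: "m < 2 ^ t" "k = 2 ^ t + m" using t by (auto simp: m_def)
  let ?M = "t + 1"
  have w: "walsh k (real Y / 2 ^ ?M) = (-1) ^ Y * walsh m (real (Y div 2) / 2 ^ t)" for Y
  proof -
    have "walsh k (real Y / 2 ^ ?M) = rademacher t (real Y / 2 ^ ?M) * walsh m (real Y / 2 ^ ?M)"
      using m by (simp add: walsh_power2_add)
    also have "rademacher t (real Y / 2 ^ ?M) = (-1) ^ Y"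
      by (subst rademacher_dyadic_index[of _ ?M]) (auto simp del: power_Suc)
    also have "walsh m (real Y / 2 ^ ?M) = walsh m (real (Y div 2) / 2 ^ t)"
      using dyadic_index_div[of 1 ?M "real Y / 2 ^ ?M"]
      by (intro walsh_dyadic_cong[OF m(1)]) (simp del: power_Suc)
    finally show ?thesis .
  qed
  have "(LINT x:{0..<1}|lebesgue. walsh k x) =
      (LINT x:{0..<1}|lebesgue. walsh k (real (dyadic_index ?M x) / 2 ^ ?M))"
    by (subst walsh_dyadic_index[OF t(2)]) simp
  also have "\<dots> = (\<Sum>X<2 ^ ?M. walsh k (real X / 2 ^ ?M)) / 2 ^ ?M"
    by (rule set_integral_dyadic)
  also have "(\<Sum>X<2 ^ ?M. walsh k (real X / 2 ^ ?M)) = 0"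
    unfolding w by (simp add: sum_lessThan_double)
  finally show ?thesis using False by simp
qed

subsection \<open>Walsh polynomials\<close>

lemma walsh_coeff_add:
  assumes "set_integrable lebesgue {0..<1} f" "set_integrable lebesgue {0..<1} g"
  shows "walsh_coeff (\<lambda>x. f x + g x) k = walsh_coeff f k + walsh_coeff g k"
  using set_integral_add(2)[OF assms[THEN set_integrable_mult_walsh, of k]]
  by (simp add: walsh_coeff_def algebra_simps)

lemma walsh_coeff_cmult: "walsh_coeff (\<lambda>x. c * f x) k = c * walsh_coeff f k"
  by (simp add: walsh_coeff_def mult.assoc)

lemma walsh_partial_sum_add:
  assumes "set_integrable lebesgue {0..<1} f" "set_integrable lebesgue {0..<1} g"
  shows "walsh_partial_sum (\<lambda>x. f x + g x) n x = walsh_partial_sum f n x + walsh_partial_sum g n x"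
  by (simp add: walsh_partial_sum_def walsh_coeff_add[OF assms] algebra_simps sum.distrib)

lemma walsh_partial_sum_cmult: "walsh_partial_sum (\<lambda>x. c * f x) n x = c * walsh_partial_sum f n x"
  by (simp add: walsh_partial_sum_def walsh_coeff_cmult sum_distrib_left mult.assoc)

lemma walsh_coeff_walsh: "walsh_coeff (walsh j) k = (if j = k then 1 else 0)"
proof -
  have "xor j k = 0 \<longleftrightarrow> j = k"
    by (metis xor_self_eq xor.assoc xor.right_neutral)
  then show ?thesis
    by (simp add: walsh_coeff_def set_integral_walsh flip: walsh_xor)
qed

text \<open>The set \<open>I\<close> need only contain the frequencies, so it can be enlarged at
  will. The identity is required on the whole line, so that dilates \<open>F (2 ^ s * x)\<close> are
  again polynomials.\<close>

definition walsh_poly :: "nat set \<Rightarrow> (real \<Rightarrow> real) \<Rightarrow> bool" where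
  "walsh_poly I f \<longleftrightarrow> finite I \<and> (\<exists>a. f = (\<lambda>x. \<Sum>k\<in>I. a k * walsh k x))"

lemma walsh_polyE:
  assumes "walsh_poly I f"
  obtains a where "finite I" "f = (\<lambda>x. \<Sum>k\<in>I. a k * walsh k x)"
  using assms unfolding walsh_poly_def by auto

lemma
  assumes "finite I"
  shows set_integrable_walsh_sum: "set_integrable lebesgue {0..<1} (\<lambda>x. \<Sum>j\<in>I. a j * walsh j x)"
    and walsh_coeff_walsh_sum: "walsh_coeff (\<lambda>x. \<Sum>j\<in>I. a j * walsh j x) k = (if k \<in> I then a k else 0)"
  using assms
proof (induction I rule: finite_induct)
  case empty
  { case 1 show ?case by simp }
  { case 2 show ?case by (simp add: walsh_coeff_def) }
next
  case (insert i I)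
  have i: "set_integrable lebesgue {0..<1} (\<lambda>x. a i * walsh i x)"
    by (intro set_integrable_mult_right impI set_integrable_walsh)
  { case 1 show ?case using insert i by (simp add: set_integral_add(1)) }
  { case 2 show ?case using insert i
      by (auto simp: walsh_coeff_add walsh_coeff_cmult walsh_coeff_walsh) }
qed

lemma walsh_partial_sum_walsh_sum:
  assumes "finite I"
  shows "walsh_partial_sum (\<lambda>x. \<Sum>j\<in>I. a j * walsh j x) n x = (\<Sum>j\<in>I \<inter> {..<n}. a j * walsh j x)"
proof -
  have "walsh_partial_sum (\<lambda>x. \<Sum>j\<in>I. a j * walsh j x) n x =
      (\<Sum>k<n. if k \<in> I then a k * walsh k x else 0)"
    unfolding walsh_partial_sum_def walsh_coeff_walsh_sum[OF assms] by (rule sum.cong) auto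
  also have "\<dots> = (\<Sum>j\<in>{..<n} \<inter> I. a j * walsh j x)"
    by (rule sum.inter_restrict[symmetric]) simp
  finally show ?thesis by (simp add: Int_commute)
qed

lemma walsh_poly_integrable: "walsh_poly I f \<Longrightarrow> set_integrable lebesgue {0..<1} f"
  by (auto simp: walsh_poly_def set_integrable_walsh_sum)

lemma walsh_poly_mono:
  assumes "walsh_poly I f" "I \<subseteq> J" "finite J"
  shows "walsh_poly J f"
proof -
  from assms(1) obtain a where a: "finite I" "f = (\<lambda>x. \<Sum>k\<in>I. a k * walsh k x)"
    by (rule walsh_polyE)
  have "f = (\<lambda>x. \<Sum>k\<in>J. (if k \<in> I then a k else 0) * walsh k x)"
    unfolding a(2) by (intro ext sum.mono_neutral_cong_left) (use assms in auto)
  then show ?thesis using assms(3) unfolding walsh_poly_def by (intro conjI exI)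
qed

lemma walsh_poly_add:
  assumes "walsh_poly I f" "walsh_poly I g"
  shows "walsh_poly I (\<lambda>x. f x + g x)"
proof -
  from assms(1) obtain a where a: "finite I" "f = (\<lambda>x. \<Sum>k\<in>I. a k * walsh k x)"
    by (rule walsh_polyE)
  from assms(2) obtain b where b: "g = (\<lambda>x. \<Sum>k\<in>I. b k * walsh k x)"
    by (rule walsh_polyE)
  have "(\<lambda>x. f x + g x) = (\<lambda>x. \<Sum>k\<in>I. (a k + b k) * walsh k x)"
    unfolding a b by (simp add: sum.distrib algebra_simps)
  then show ?thesis using a(1) unfolding walsh_poly_def by (intro conjI exI)
qed

lemma walsh_poly_cmult:
  assumes "walsh_poly I f"
  shows "walsh_poly I (\<lambda>x. c * f x)"
proof -
  from assms(1) obtain a where a: "finite I" "f = (\<lambda>x. \<Sum>k\<in>I. a k * walsh k x)"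
    by (rule walsh_polyE)
  have "(\<lambda>x. c * f x) = (\<lambda>x. \<Sum>k\<in>I. (c * a k) * walsh k x)"
    unfolding a by (simp add: sum_distrib_left mult.assoc)
  then show ?thesis using a(1) unfolding walsh_poly_def by (intro conjI exI)
qed

lemma walsh_poly_diff:
  assumes "walsh_poly I f" "walsh_poly I g"
  shows "walsh_poly I (\<lambda>x. f x - g x)"
  using walsh_poly_add[OF assms(1) walsh_poly_cmult[OF assms(2), of "-1"]] by simp

lemma walsh_poly_sum:
  assumes "finite I" "\<And>i. i \<in> A \<Longrightarrow> walsh_poly I (f i)"
  shows "walsh_poly I (\<lambda>x. \<Sum>i\<in>A. f i x)"
proof (cases "finite A")
  case True
  then show ?thesis using assms(2)
  proof (induction A rule: finite_induct)
    case empty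
    show ?case using assms(1) by (auto simp: walsh_poly_def intro!: exI[of _ "\<lambda>_. 0"])
  qed (auto intro!: walsh_poly_add)
next
  case False
  then show ?thesis using assms(1) by (auto simp: walsh_poly_def intro!: exI[of _ "\<lambda>_. 0"])
qed

lemma walsh_poly_walsh:
  assumes "k \<in> I" "finite I"
  shows "walsh_poly I (walsh k)"
proof -
  have "walsh k = (\<lambda>x. \<Sum>j\<in>I. (if j = k then 1 else 0) * walsh j x)"
    using assms by (simp add: if_distrib[of "\<lambda>c. c * _"] cong: if_cong)
  then show ?thesis using assms(2) unfolding walsh_poly_def by (intro conjI exI)
qed

lemma walsh_poly_mult:
  assumes f: "walsh_poly I f" and g: "walsh_poly J g"
    and K: "finite K" "\<And>i j. i \<in> I \<Longrightarrow> j \<in> J \<Longrightarrow> xor i j \<in> K"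
  shows "walsh_poly K (\<lambda>x. f x * g x)"
proof -
  from f obtain a where a: "finite I" "f = (\<lambda>x. \<Sum>k\<in>I. a k * walsh k x)"
    by (rule walsh_polyE)
  from g obtain b where b: "finite J" "g = (\<lambda>x. \<Sum>k\<in>J. b k * walsh k x)"
    by (rule walsh_polyE)
  have "(\<lambda>x. f x * g x) = (\<lambda>x. \<Sum>i\<in>I. \<Sum>j\<in>J. (a i * b j) * walsh (xor i j) x)"
    unfolding a b by (simp add: sum_product walsh_xor algebra_simps)
  moreover have "walsh_poly K (\<lambda>x. \<Sum>i\<in>I. \<Sum>j\<in>J. (a i * b j) * walsh (xor i j) x)"
    using K by (intro walsh_poly_sum walsh_poly_cmult walsh_poly_walsh) auto
  ultimately show ?thesis by simp
qed

abbreviation walsh_poly_upto :: "nat \<Rightarrow> (real \<Rightarrow> real) \<Rightarrow> bool" where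
  "walsh_poly_upto M \<equiv> walsh_poly {..<2 ^ M}"

lemma walsh_poly_upto_mono: "walsh_poly_upto M f \<Longrightarrow> M \<le> N \<Longrightarrow> walsh_poly_upto N f"
  by (erule walsh_poly_mono) auto

lemma walsh_poly_upto_mult:
  "walsh_poly_upto M f \<Longrightarrow> walsh_poly_upto M g \<Longrightarrow> walsh_poly_upto M (\<lambda>x. f x * g x)"
  by (erule walsh_poly_mult) (auto simp: xor_less_power2)

lemma walsh_poly_upto_const: "walsh_poly_upto M (\<lambda>x. c)"
  using walsh_poly_cmult[OF walsh_poly_walsh[of 0 "{..<2 ^ M}"], of c] by simp

lemma walsh_poly_upto_rademacher: "j < M \<Longrightarrow> walsh_poly_upto M (rademacher j)"
  using walsh_poly_walsh[of "2 ^ j" "{..<2 ^ M}"] by (simp add: walsh_power2[abs_def])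

lemma walsh_poly_upto_prod:
  "(\<And>i. i \<in> A \<Longrightarrow> walsh_poly_upto M (f i)) \<Longrightarrow> walsh_poly_upto M (\<lambda>x. \<Prod>i\<in>A. f i x)"
  by (induction A rule: infinite_finite_induct)
     (auto intro: walsh_poly_upto_const walsh_poly_upto_mult)

lemma walsh_partial_sum_eq_self:
  assumes "walsh_poly I f" "I \<subseteq> {..<n}"
  shows "walsh_partial_sum f n x = f x"
proof -
  from assms(1) obtain a where a: "finite I" "f = (\<lambda>x. \<Sum>k\<in>I. a k * walsh k x)"
    by (rule walsh_polyE)
  show ?thesis using assms(2)
    unfolding a(2) walsh_partial_sum_walsh_sum[OF a(1)] by (simp add: Int_absorb2)
qed

lemma walsh_partial_sum_eq_0:
  assumes "walsh_poly I f" "I \<inter> {..<n} = {}"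
  shows "walsh_partial_sum f n x = 0"
proof -
  from assms(1) obtain a where a: "finite I" "f = (\<lambda>x. \<Sum>k\<in>I. a k * walsh k x)"
    by (rule walsh_polyE)
  show ?thesis using assms(2)
    unfolding a(2) walsh_partial_sum_walsh_sum[OF a(1)] by simp
qed

lemma walsh_poly_rademacher_mult:
  assumes "walsh_poly_upto t f"
  shows "walsh_poly {2 ^ t..<2 ^ (t + 1)} (\<lambda>x. rademacher t x * f x)"
proof -
  have "walsh_poly {2 ^ t} (rademacher t)"
    using walsh_poly_walsh[of "2 ^ t" "{2 ^ t}"] by (simp add: walsh_power2[abs_def])
  then show ?thesis
    using assms by (rule walsh_poly_mult) (auto simp: xor_power2_eq_add)
qed

text \<open>Multiplying by \<open>rademacher t\<close> moves the frequencies
  \<open>j < 2 ^ t\<close> to \<open>2 ^ t + j\<close> in the same order, so the truncation at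
  \<open>2 ^ t + k\<close> becomes the truncation at \<open>k\<close>.\<close>

lemma walsh_partial_sum_rademacher_mult:
  assumes "walsh_poly_upto t f" "k \<le> 2 ^ t"
  shows "walsh_partial_sum (\<lambda>x. rademacher t x * f x) (2 ^ t + k) x = rademacher t x * walsh_partial_sum f k x"
proof -
  from assms(1) obtain a where a: "f = (\<lambda>x. \<Sum>k<2^t. a k * walsh k x)"
    by (rule walsh_polyE)
  have sh: "(\<Sum>j\<in>{2 ^ t..<2 ^ t + m}. a (j - 2 ^ t) * walsh j x) = rademacher t x * (\<Sum>j<m. a j * walsh j x)"
    if "m \<le> 2 ^ t" for m x
  proof -
    have "(\<Sum>j\<in>{2 ^ t..<2 ^ t + m}. a (j - 2 ^ t) * walsh j x) = (\<Sum>j<m. a j * walsh (2 ^ t + j) x)"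
      by (rule sum.reindex_bij_witness[of _ "\<lambda>j. 2 ^ t + j" "\<lambda>j. j - 2 ^ t"]) auto
    also have "\<dots> = rademacher t x * (\<Sum>j<m. a j * walsh j x)"
      unfolding sum_distrib_left by (rule sum.cong) (use that in \<open>auto simp: walsh_power2_add\<close>)
    finally show ?thesis .
  qed
  have eq: "(\<lambda>x. rademacher t x * f x) = (\<lambda>x. \<Sum>j\<in>{2 ^ t..<2 ^ t + 2 ^ t}. a (j - 2 ^ t) * walsh j x)"
    unfolding a by (simp add: sh)
  have int: "{2 ^ t..<2 ^ t + 2 ^ t} \<inter> {..<2 ^ t + k} = {2 ^ t..<2 ^ t + k}" "{..<2 ^ t} \<inter> {..<k} = {..<k}"
    using assms(2) by auto
  have "walsh_partial_sum (\<lambda>x. rademacher t x * f x) (2 ^ t + k) x =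
      (\<Sum>j\<in>{2 ^ t..<2 ^ t + k}. a (j - 2 ^ t) * walsh j x)"
    unfolding eq by (subst walsh_partial_sum_walsh_sum) (simp_all add: int)
  then show ?thesis
    using assms(2) by (simp add: a walsh_partial_sum_walsh_sum sh int)
qed

subsection \<open>Conjugated partial sums\<close>

text \<open>The operator T n of the introduction.\<close>
definition conj_partial_sum :: "nat \<Rightarrow> (real \<Rightarrow> real) \<Rightarrow> real \<Rightarrow> real" where
  "conj_partial_sum n f x = walsh n x * walsh_partial_sum (\<lambda>y. walsh n y * f y) n x"

lemma conj_partial_sum_add:
  assumes "walsh_poly I f" "walsh_poly J g"
  shows "conj_partial_sum n (\<lambda>x. f x + g x) x = conj_partial_sum n f x + conj_partial_sum n g x"
  using walsh_partial_sum_add[OF assms[THEN walsh_poly_integrable, THEN set_integrable_mult_walsh, of n]]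
  by (simp add: conj_partial_sum_def algebra_simps)

lemma conj_partial_sum_cmult: "conj_partial_sum n (\<lambda>x. c * f x) x = c * conj_partial_sum n f x"
  using walsh_partial_sum_cmult[of c "\<lambda>y. walsh n y * f y" n x]
  by (simp add: conj_partial_sum_def algebra_simps)

lemma walsh_poly_walsh_mult:
  assumes "walsh_poly I f"
  shows "walsh_poly (xor n ` I) (\<lambda>x. walsh n x * f x)"
proof -
  have "finite I" using assms by (simp add: walsh_poly_def)
  then show ?thesis
    by (intro walsh_poly_mult[OF walsh_poly_walsh[of n "{n}"] assms]) auto
qed

lemma conj_partial_sum_const: "conj_partial_sum n (\<lambda>x. c) x = 0"
proof -
  have "walsh_poly {0} (\<lambda>x. c)"
    using walsh_poly_cmult[OF walsh_poly_walsh[of 0 "{0}"], of c] by simp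
  from walsh_poly_walsh_mult[OF this, of n] show ?thesis
    unfolding conj_partial_sum_def by (subst walsh_partial_sum_eq_0) auto
qed

text \<open>All frequencies \<open>m\<close> of the function have leading digit \<open>t\<close>, so
  all \<open>xor n m\<close> lie on the same side of \<open>n\<close>, and the truncation keeps
  everything or nothing.\<close>

lemma conj_partial_sum_rademacher:
  assumes "walsh_poly_upto t f"
  shows "conj_partial_sum n (\<lambda>x. f x * rademacher t x) x =
    (if bit n t then f x * rademacher t x else 0)"
proof -
  have u: "walsh_poly {2 ^ t..<2 ^ (t + 1)} (\<lambda>x. f x * rademacher t x)"
    using walsh_poly_rademacher_mult[OF assms] by (simp add: mult.commute)
  note v = walsh_poly_walsh_mult[OF u, of n]
  have x: "xor n m < n \<longleftrightarrow> bit n t" if "m \<in> {2 ^ t..<2 ^ (t + 1)}" for m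
    using that by (intro xor_less_iff_bit) auto
  show ?thesis
  proof (cases "bit n t")
    case True
    then have "xor n ` {2 ^ t..<2 ^ (t + 1)} \<subseteq> {..<n}"
      using x by auto
    from walsh_partial_sum_eq_self[OF v this, of x] True show ?thesis
      unfolding conj_partial_sum_def by (simp flip: mult.assoc)
  next
    case False
    then have "xor n ` {2 ^ t..<2 ^ (t + 1)} \<inter> {..<n} = {}"
      using x by auto
    then show ?thesis
      using False unfolding conj_partial_sum_def by (simp add: walsh_partial_sum_eq_0[OF v])
  qed
qed

text \<open>In each factor the Rademacher term raises the leading digit to one that \<open>n\<close>
  lacks and is annihilated; only the constant 1/2 survives. So localising to a set described by
  \<open>k\<close> digits absent from \<open>n\<close> costs exactly the factor
  \<open>2 ^ k\<close>.\<close>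

lemma conj_partial_sum_mult_bits:
  assumes u: "walsh_poly_upto s u" and n: "\<And>b. b < k \<Longrightarrow> \<not> bit n (s + b)"
  shows "conj_partial_sum n (\<lambda>y. u y * (\<Prod>b<k. (1 + \<sigma> b * rademacher (s + b) y) / 2)) x = conj_partial_sum n u x / 2 ^ k"
  using n
proof (induction k)
  case (Suc k)
  let ?v = "\<lambda>y. u y * (\<Prod>b<k. (1 + \<sigma> b * rademacher (s + b) y) / 2)"
  have v: "walsh_poly_upto (s + k) ?v"
    unfolding divide_inverse
    by (intro walsh_poly_upto_mult walsh_poly_upto_prod walsh_poly_add walsh_poly_upto_const
        walsh_poly_upto_rademacher walsh_poly_upto_mono[OF u]) auto
  have v': "walsh_poly_upto (s + Suc k) ?v"
    by (rule walsh_poly_upto_mono[OF v]) simp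
  have w: "walsh_poly_upto (s + Suc k) (\<lambda>y. (\<sigma> k / 2) * (?v y * rademacher (s + k) y))"
    by (intro walsh_poly_cmult walsh_poly_upto_mult v' walsh_poly_upto_rademacher) simp
  have "conj_partial_sum n (\<lambda>y. u y * (\<Prod>b<Suc k. (1 + \<sigma> b * rademacher (s + b) y) / 2)) x =
    conj_partial_sum n (\<lambda>y. (1 / 2) * ?v y + (\<sigma> k / 2) * (?v y * rademacher (s + k) y)) x"
    by (rule arg_cong[of _ _ "\<lambda>f. conj_partial_sum n f x"]) (auto simp: field_simps)
  also have "\<dots> = (1 / 2) * conj_partial_sum n ?v x +
      (\<sigma> k / 2) * conj_partial_sum n (\<lambda>y. ?v y * rademacher (s + k) y) x"
    by (subst conj_partial_sum_add[OF walsh_poly_cmult[OF v'] w]) (simp only: conj_partial_sum_cmult)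
  also have "conj_partial_sum n (\<lambda>y. ?v y * rademacher (s + k) y) x = 0"
    using Suc.prems[of k] by (simp add: conj_partial_sum_rademacher[OF v])
  also have "conj_partial_sum n ?v x = conj_partial_sum n u x / 2 ^ k"
    using Suc.prems by (intro Suc.IH) auto
  finally show ?case by simp
qed simp

subsection \<open>Encoding products of low-frequency factors by high frequencies\<close>

text \<open>In the expanded product, the Rademacher functions of indices \<open>M + b\<close> with
  \<open>b \<in> B\<close> are multiplied by \<open>\<phi>\<close> and the \<open>\<theta> b\<close>
  with \<open>b \<in> B\<close>. The frequencies of this term lie in the window of length
  \<open>2 ^ M\<close> starting at \<open>m\<close>, the sum of the \<open>2 ^ (M + b)\<close>,
  where no other term has frequencies; truncating inside the window isolates it up to the sign
  \<open>walsh m x\<close>. The factor \<open>\<phi>\<close> is carried for the induction: when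
  \<open>N \<in> B\<close>, it absorbs \<open>\<theta> N\<close>.\<close>

lemma ex_partial_sum_riesz_product:
  assumes \<theta>: "\<And>b. b < N \<Longrightarrow> walsh_poly_upto M (\<theta> b)"
    and "walsh_poly_upto M \<phi>" "B \<subseteq> {..<N}"
  shows "\<exists>m. m + 2 ^ M \<le> 2 ^ (M + N) \<and> (\<forall>n\<le>2 ^ M. \<forall>x.
    walsh_partial_sum (\<lambda>y. \<phi> y * (\<Prod>b<N. 1 + rademacher (M + b) y * \<theta> b y)) (m + n) x -
    walsh_partial_sum (\<lambda>y. \<phi> y * (\<Prod>b<N. 1 + rademacher (M + b) y * \<theta> b y)) m x =
    walsh m x * walsh_partial_sum (\<lambda>y. \<phi> y * (\<Prod>b\<in>B. \<theta> b y)) n x)"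
  using assms
proof (induction N arbitrary: \<phi> B)
  case 0
  then show ?case by (intro exI[of _ 0]) (simp add: walsh_partial_sum_def)
next
  case (Suc N)
  let ?t = "M + N"
  let ?F = "\<lambda>y. \<Prod>b<N. 1 + rademacher (M + b) y * \<theta> b y"
  let ?A = "\<lambda>y. \<phi> y * ?F y" and ?A' = "\<lambda>y. \<phi> y * \<theta> N y * ?F y"
  have up: "walsh_poly_upto ?t f" if "walsh_poly_upto M f" for f
    using that by (rule walsh_poly_upto_mono) simp
  have \<theta>N: "walsh_poly_upto M (\<theta> N)" and \<phi>: "walsh_poly_upto M \<phi>"
    using Suc.prems by auto
  have F: "walsh_poly_upto ?t ?F"
    by (intro walsh_poly_upto_prod walsh_poly_add walsh_poly_upto_const walsh_poly_upto_mult
        walsh_poly_upto_rademacher up Suc.prems(1)) auto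
  have A: "walsh_poly_upto ?t ?A" and A': "walsh_poly_upto ?t ?A'"
    by (intro walsh_poly_upto_mult F up[OF \<phi>] up[OF \<theta>N])+
  note rA' = walsh_poly_rademacher_mult[OF A']
  have S: "walsh_partial_sum (\<lambda>y. \<phi> y * (\<Prod>b<Suc N. 1 + rademacher (M + b) y * \<theta> b y)) k x =
      walsh_partial_sum ?A k x + walsh_partial_sum (\<lambda>y. rademacher ?t y * ?A' y) k x" for k x
    by (subst walsh_partial_sum_add[OF walsh_poly_integrable[OF A] walsh_poly_integrable[OF rA'], symmetric])
       (rule arg_cong[of _ _ "\<lambda>f. walsh_partial_sum f k x"], auto simp: algebra_simps)
  show ?case
  proof (cases "N \<in> B")
    case False
    then have "B \<subseteq> {..<N}" using Suc.prems(3) by (auto simp: less_Suc_eq)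
    from Suc.IH[OF _ \<phi> this] Suc.prems(1) obtain m where m: "m + 2 ^ M \<le> 2 ^ ?t"
      "\<And>n x. n \<le> 2 ^ M \<Longrightarrow> walsh_partial_sum ?A (m + n) x - walsh_partial_sum ?A m x =
        walsh m x * walsh_partial_sum (\<lambda>y. \<phi> y * (\<Prod>b\<in>B. \<theta> b y)) n x"
      by force
    have z: "walsh_partial_sum (\<lambda>y. rademacher ?t y * ?A' y) k x = 0" if "k \<le> 2 ^ ?t" for k x
      using that by (intro walsh_partial_sum_eq_0[OF rA']) auto
    show ?thesis
    proof (intro exI[of _ m] conjI allI impI)
      show "m + 2 ^ M \<le> 2 ^ (M + Suc N)" using m(1) by simp
      fix n :: nat and x :: real assume n: "n \<le> 2 ^ M"
      then show "walsh_partial_sum (\<lambda>y. \<phi> y * (\<Prod>b<Suc N. 1 + rademacher (M + b) y * \<theta> b y)) (m + n) x -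
        walsh_partial_sum (\<lambda>y. \<phi> y * (\<Prod>b<Suc N. 1 + rademacher (M + b) y * \<theta> b y)) m x =
        walsh m x * walsh_partial_sum (\<lambda>y. \<phi> y * (\<Prod>b\<in>B. \<theta> b y)) n x"
        unfolding S using m by (simp add: z)
    qed
  next
    case True
    define B' where "B' = B - {N}"
    have B': "B' \<subseteq> {..<N}" "B = insert N B'" "N \<notin> B'" "finite B'"
      using Suc.prems(3) True by (auto simp: B'_def less_Suc_eq finite_subset[of B "{..<Suc N}"])
    from Suc.IH[OF _ walsh_poly_upto_mult[OF \<phi> \<theta>N] B'(1)] Suc.prems(1) obtain m where m: "m + 2 ^ M \<le> 2 ^ ?t"
      "\<And>n x. n \<le> 2 ^ M \<Longrightarrow> walsh_partial_sum ?A' (m + n) x - walsh_partial_sum ?A' m x =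
        walsh m x * walsh_partial_sum (\<lambda>y. \<phi> y * \<theta> N y * (\<Prod>b\<in>B'. \<theta> b y)) n x"
      by force
    have 1: "walsh_partial_sum ?A (2 ^ ?t + k) x = ?A x" for k x
      by (rule walsh_partial_sum_eq_self[OF A]) auto
    have 2: "walsh_partial_sum (\<lambda>y. rademacher ?t y * ?A' y) (2 ^ ?t + k) x =
      rademacher ?t x * walsh_partial_sum ?A' k x" if "k \<le> 2 ^ ?t" for k x
      by (rule walsh_partial_sum_rademacher_mult[OF A' that])
    have m_less: "m < 2 ^ ?t"
      using m(1) by (metis add_leD1 le_neq_implies_less nat_less_le not_add_less1 zero_less_numeral
          zero_less_power add.right_neutral add_le_same_cancel1 not_less)
    show ?thesis
    proof (intro exI[of _ "2 ^ ?t + m"] conjI allI impI)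
      show "2 ^ ?t + m + 2 ^ M \<le> 2 ^ (M + Suc N)" using m(1) by simp
      fix n :: nat and x :: real assume n: "n \<le> 2 ^ M"
      have "walsh_partial_sum (\<lambda>y. \<phi> y * (\<Prod>b<Suc N. 1 + rademacher (M + b) y * \<theta> b y)) (2 ^ ?t + m + n) x -
        walsh_partial_sum (\<lambda>y. \<phi> y * (\<Prod>b<Suc N. 1 + rademacher (M + b) y * \<theta> b y)) (2 ^ ?t + m) x =
        rademacher ?t x * (walsh_partial_sum ?A' (m + n) x - walsh_partial_sum ?A' m x)"
        unfolding S add.assoc using m(1) n by (simp add: 1 2 right_diff_distrib)
      also have "\<dots> = walsh (2 ^ ?t + m) x * walsh_partial_sum (\<lambda>y. \<phi> y * (\<Prod>b\<in>B. \<theta> b y)) n x"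
        unfolding m(2)[OF n] walsh_power2_add[OF m_less] using B' by (simp add: mult.assoc)
      finally show "walsh_partial_sum (\<lambda>y. \<phi> y * (\<Prod>b<Suc N. 1 + rademacher (M + b) y * \<theta> b y)) (2 ^ ?t + m + n) x -
        walsh_partial_sum (\<lambda>y. \<phi> y * (\<Prod>b<Suc N. 1 + rademacher (M + b) y * \<theta> b y)) (2 ^ ?t + m) x =
        walsh (2 ^ ?t + m) x * walsh_partial_sum (\<lambda>y. \<phi> y * (\<Prod>b\<in>B. \<theta> b y)) n x" .
    qed
  qed
qed

text \<open>Each further factor adds only frequencies of at least \<open>2 ^ M\<close>, so the
  constant term stays 1. It is expressed by the partial sum of length 1 because this form passes
  directly to dilates.\<close>

lemma
  assumes \<theta>: "\<And>b. b < N \<Longrightarrow> walsh_poly_upto M (\<theta> b)"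
  shows walsh_poly_riesz_product: "walsh_poly_upto (M + N) (\<lambda>y. \<Prod>b<N. 1 + rademacher (M + b) y * \<theta> b y)"
    and walsh_coeff_riesz_product: "walsh_partial_sum (\<lambda>y. \<Prod>b<N. 1 + rademacher (M + b) y * \<theta> b y) 1 x = 1"
proof -
  have up: "walsh_poly_upto (M + N) f" if "walsh_poly_upto M f" for f N
    using that by (rule walsh_poly_upto_mono) simp
  have F: "walsh_poly_upto (M + K) (\<lambda>y. \<Prod>b<K. 1 + rademacher (M + b) y * \<theta> b y)" if "K \<le> N" for K
    by (intro walsh_poly_upto_prod walsh_poly_add walsh_poly_upto_const walsh_poly_upto_mult
        walsh_poly_upto_rademacher up \<theta>) (use that in auto)
  show "walsh_poly_upto (M + N) (\<lambda>y. \<Prod>b<N. 1 + rademacher (M + b) y * \<theta> b y)"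
    by (rule F) simp
  have "walsh_partial_sum (\<lambda>y. \<Prod>b<K. 1 + rademacher (M + b) y * \<theta> b y) 1 x = 1" if "K \<le> N" for K
    using that
  proof (induction K)
    case 0
    show ?case using walsh_partial_sum_eq_self[OF walsh_poly_upto_const[of 0 1], of 1 x] by simp
  next
    case (Suc K)
    let ?F = "\<lambda>y. \<Prod>b<K. 1 + rademacher (M + b) y * \<theta> b y"
    have FK: "walsh_poly_upto (M + K) ?F" using Suc.prems by (intro F) auto
    have r: "walsh_poly {2 ^ (M + K)..<2 ^ (M + K + 1)} (\<lambda>y. rademacher (M + K) y * (\<theta> K y * ?F y))"
      by (intro walsh_poly_rademacher_mult walsh_poly_upto_mult FK up \<theta>) (use Suc.prems in auto)
    have "walsh_partial_sum (\<lambda>y. \<Prod>b<Suc K. 1 + rademacher (M + b) y * \<theta> b y) 1 x =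
      walsh_partial_sum ?F 1 x + walsh_partial_sum (\<lambda>y. rademacher (M + K) y * (\<theta> K y * ?F y)) 1 x"
      by (subst walsh_partial_sum_add[OF walsh_poly_integrable[OF FK] walsh_poly_integrable[OF r], symmetric])
         (rule arg_cong[of _ _ "\<lambda>f. walsh_partial_sum f 1 x"], auto simp: algebra_simps)
    also have "walsh_partial_sum (\<lambda>y. rademacher (M + K) y * (\<theta> K y * ?F y)) 1 x = 0"
      by (rule walsh_partial_sum_eq_0[OF r]) auto
    finally show ?case using Suc by simp
  qed
  then show "walsh_partial_sum (\<lambda>y. \<Prod>b<N. 1 + rademacher (M + b) y * \<theta> b y) 1 x = 1" by simp
qed

subsection \<open>The block construction\<close>

text \<open>Block p consists of K class digits, starting at p * (K + 1), and one sign digit.\<close>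
definition block_sign :: "nat \<Rightarrow> nat \<Rightarrow> real \<Rightarrow> real" where
  "block_sign K p = rademacher (p * (K + 1) + K)"

text \<open>A class is coded by the set \<open>c\<close> of those class digits whose Rademacher
  function is -1, so that the \<open>2 ^ K\<close> classes can be counted as a power set.\<close>

definition class_ind :: "nat \<Rightarrow> nat \<Rightarrow> nat set \<Rightarrow> real \<Rightarrow> real" where
  "class_ind K p c y = (\<Prod>b<K. (1 + (if b \<in> c then -1 else 1) * rademacher (p * (K + 1) + b) y) / 2)"

definition class_of :: "nat \<Rightarrow> nat \<Rightarrow> real \<Rightarrow> nat set" where
  "class_of K p x = {b. b < K \<and> rademacher (p * (K + 1) + b) x = -1}"

definition block_factor :: "nat \<Rightarrow> nat \<Rightarrow> nat set \<Rightarrow> real \<Rightarrow> real" where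
  "block_factor K p c y = 1 - class_ind K p c y + class_ind K p c y * block_sign K p y"

lemma class_ind_cases: "class_ind K p c y = 0 \<or> class_ind K p c y = 1"
proof -
  have "(1 + (if b \<in> c then -1 else 1) * rademacher (p * (K + 1) + b) y) / 2 \<in> {0, 1}" for b
    using rademacher_cases[of "p * (K + 1) + b" y] by auto
  then have "(\<Prod>b<k. (1 + (if b \<in> c then -1 else 1) * rademacher (p * (K + 1) + b) y) / 2) \<in> {0, 1}" for k
    by (induction k) fastforce+
  then show ?thesis unfolding class_ind_def by blast
qed

lemma class_ind_class_of [simp]: "class_ind K p (class_of K p x) x = 1"
  unfolding class_ind_def
proof (rule prod.neutral, rule ballI)
  fix b assume "b \<in> {..<K}"
  then show "(1 + (if b \<in> class_of K p x then -1 else 1) * rademacher (p * (K + 1) + b) x) / 2 = 1"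
    using rademacher_cases[of "p * (K + 1) + b" x] by (auto simp: class_of_def)
qed

lemma abs_block_factor: "\<bar>block_factor K p c y\<bar> = 1"
  using class_ind_cases[of K p c y] by (auto simp: block_factor_def block_sign_def)

lemma walsh_poly_class_ind: "walsh_poly_upto (p * (K + 1) + K) (class_ind K p c)"
  unfolding class_ind_def[abs_def] divide_inverse
  by (intro walsh_poly_upto_mult walsh_poly_upto_prod walsh_poly_add walsh_poly_upto_const
      walsh_poly_upto_rademacher) auto

lemma walsh_poly_block_sign: "walsh_poly_upto (Suc p * (K + 1)) (block_sign K p)"
  unfolding block_sign_def by (rule walsh_poly_upto_rademacher) simp

lemma walsh_poly_block_factor: "walsh_poly_upto (Suc p * (K + 1)) (block_factor K p c)"
proof -
  have "walsh_poly_upto (Suc p * (K + 1)) (class_ind K p c)"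
    by (rule walsh_poly_upto_mono[OF walsh_poly_class_ind]) simp
  then show ?thesis
    unfolding block_factor_def[abs_def]
    by (intro walsh_poly_add walsh_poly_diff walsh_poly_upto_const walsh_poly_upto_mult
        walsh_poly_block_sign)
qed

lemma walsh_poly_prod_block_factor:
  "walsh_poly_upto (P * (K + 1)) (\<lambda>y. \<Prod>p<P. block_factor K p (c p) y)"
proof (rule walsh_poly_upto_prod)
  fix p assume "p \<in> {..<P}"
  then have "Suc p * (K + 1) \<le> P * (K + 1)" by (intro mult_le_mono1) auto
  then show "walsh_poly_upto (P * (K + 1)) (block_factor K p (c p))"
    by (rule walsh_poly_upto_mono[OF walsh_poly_block_factor])
qed

text \<open>Write the factor as \<open>1 - e + e * r\<close> with the class indicator
  \<open>e\<close> and the sign digit \<open>r\<close>. The digits of \<open>e\<close> are absent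
  from \<open>n\<close>, so \<open>e\<close> only scales the old value by \<open>1 / 2 ^ K\<close>;
  the term with \<open>r\<close> has the digit of \<open>r\<close> as leading digit and is kept or
  killed as a whole.\<close>

lemma conj_partial_sum_block_step:
  assumes u: "walsh_poly_upto (p * (K + 1)) u"
    and n: "\<And>b. b < K \<Longrightarrow> \<not> bit n (p * (K + 1) + b)"
  shows "conj_partial_sum n (\<lambda>y. u y * block_factor K p c y) x =
    (1 - 1 / 2 ^ K) * conj_partial_sum n u x +
    (if bit n (p * (K + 1) + K) then u x * class_ind K p c x * block_sign K p x else 0)"
proof -
  let ?t = "p * (K + 1) + K" and ?e = "class_ind K p c"
  have u': "walsh_poly_upto ?t u"
    by (rule walsh_poly_upto_mono[OF u]) simp
  have ue: "walsh_poly_upto ?t (\<lambda>y. u y * ?e y)"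
    by (intro walsh_poly_upto_mult u' walsh_poly_class_ind)
  have ue': "walsh_poly_upto ?t (\<lambda>y. (-1) * (u y * ?e y))"
    by (intro walsh_poly_cmult ue)
  have uer: "walsh_poly_upto (Suc ?t) (\<lambda>y. u y * ?e y * rademacher ?t y)"
    by (intro walsh_poly_upto_mult walsh_poly_upto_rademacher walsh_poly_upto_mono[OF u']
         walsh_poly_upto_mono[OF walsh_poly_class_ind]) auto
  have "conj_partial_sum n (\<lambda>y. u y * block_factor K p c y) x =
    conj_partial_sum n (\<lambda>y. (u y + (-1) * (u y * ?e y)) + u y * ?e y * rademacher ?t y) x"
    by (rule arg_cong[of _ _ "\<lambda>f. conj_partial_sum n f x"])
       (auto simp: block_factor_def block_sign_def algebra_simps)
  also have "\<dots> = conj_partial_sum n u x - conj_partial_sum n (\<lambda>y. u y * ?e y) x +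
      conj_partial_sum n (\<lambda>y. u y * ?e y * rademacher ?t y) x"
    by (subst conj_partial_sum_add[OF walsh_poly_add[OF u' ue'] uer],
        subst conj_partial_sum_add[OF u' ue'], subst conj_partial_sum_cmult) simp
  also have "conj_partial_sum n (\<lambda>y. u y * ?e y) x = conj_partial_sum n u x / 2 ^ K"
    unfolding class_ind_def by (rule conj_partial_sum_mult_bits[OF u n])
  also have "conj_partial_sum n (\<lambda>y. u y * ?e y * rademacher ?t y) x =
      (if bit n ?t then u x * ?e x * rademacher ?t x else 0)"
    by (rule conj_partial_sum_rademacher[OF ue])
  finally show ?thesis by (simp add: block_sign_def algebra_simps)
qed

text \<open>Block \<open>p\<close> contributes once and is then damped by
  \<open>1 - 1 / 2 ^ K\<close> at each later block. The classes are those of the point of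
  evaluation, so there every block factor equals its sign digit, and the contribution of block
  \<open>p\<close> is a running product of signs.\<close>

lemma conj_partial_sum_blocks:
  assumes n: "\<And>p b. b < K \<Longrightarrow> \<not> bit n (p * (K + 1) + b)"
  shows "conj_partial_sum n (\<lambda>y. \<Prod>p<P. block_factor K p (class_of K p x) y) x =
    (\<Sum>p<P. (1 - 1 / 2 ^ K) ^ (P - 1 - p) *
      (if bit n (p * (K + 1) + K) then \<Prod>i\<le>p. block_sign K i x else 0))"
proof (induction P)
  case 0
  show ?case by (simp add: conj_partial_sum_const)
next
  case (Suc P)
  let ?q = "1 - 1 / 2 ^ K :: real"
  have h: "(\<Prod>p<P. block_factor K p (class_of K p x) x) = (\<Prod>p<P. block_sign K p x)"
    by (simp add: block_factor_def)
  have "conj_partial_sum n (\<lambda>y. \<Prod>p<Suc P. block_factor K p (class_of K p x) y) x =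
    ?q * conj_partial_sum n (\<lambda>y. \<Prod>p<P. block_factor K p (class_of K p x) y) x +
    (if bit n (P * (K + 1) + K) then (\<Prod>p<P. block_factor K p (class_of K p x) x) *
       class_ind K P (class_of K P x) x * block_sign K P x else 0)"
    by (subst conj_partial_sum_block_step[OF walsh_poly_prod_block_factor n, symmetric]) auto
  also have "(if bit n (P * (K + 1) + K) then (\<Prod>p<P. block_factor K p (class_of K p x) x) *
       class_ind K P (class_of K P x) x * block_sign K P x else 0) =
     (if bit n (P * (K + 1) + K) then \<Prod>i\<le>P. block_sign K i x else 0)"
    unfolding h by (simp flip: lessThan_Suc_atMost)
  also have "?q * conj_partial_sum n (\<lambda>y. \<Prod>p<P. block_factor K p (class_of K p x) y) x =
    (\<Sum>p<P. ?q ^ (Suc P - 1 - p) * (if bit n (p * (K + 1) + K) then \<Prod>i\<le>p. block_sign K i x else 0))"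
    unfolding Suc.IH sum_distrib_left mult.assoc[symmetric] power_Suc[symmetric]
    by (rule sum.cong) (auto simp: Suc_diff_Suc simp del: power_Suc)
  finally show ?case by simp
qed

lemma ex_nat_with_bits:
  assumes "finite A"
  shows "\<exists>n::nat. \<forall>j. bit n j \<longleftrightarrow> j \<in> A"
  using assms
proof (induction A rule: finite_induct)
  case empty
  show ?case by (rule exI[of _ 0]) simp
next
  case (insert a A)
  then obtain n :: nat where "\<forall>j. bit n j \<longleftrightarrow> j \<in> A" by blast
  then show ?case by (intro exI[of _ "or n (2 ^ a)"]) (auto simp: bit_simps)
qed

lemma ex_partial_sum_block_product:
  fixes x :: real
  assumes K: "J = 2 ^ k" "K = k + 1"
  shows "\<exists>Q n. Q \<subseteq> {..<J} \<and> n < 2 ^ (J * (K + 1)) \<and>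
    \<bar>walsh_partial_sum (\<lambda>y. (\<Prod>p<J. block_factor K p (class_of K p x) y) *
      (\<Prod>p\<in>Q. block_sign K p y)) n x\<bar> \<ge> J / 4"
proof -
  define s where "s p = (\<Prod>i\<le>p. block_sign K i x)" for p
  have s: "s p = 1 \<or> s p = -1" for p
  proof -
    have "\<bar>s p\<bar> = 1" by (simp add: s_def block_sign_def abs_prod)
    then show ?thesis by linarith
  qed
  define Qp where "Qp = {p. p < J \<and> s p = 1}"
  define Qm where "Qm = {p. p < J \<and> s p = -1}"
  have "{..<J} = Qp \<union> Qm" using s by (auto simp: Qp_def Qm_def)
  then have "J = card (Qp \<union> Qm)" by (metis card_lessThan)
  also have "\<dots> \<le> card Qp + card Qm" by (rule card_Un_le)
  finally have "J \<le> 2 * card Qp \<or> J \<le> 2 * card Qm" by linarith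
  \<comment> \<open>One of the two signs is taken by at least half of the running products; keeping
    only these blocks prevents cancellation.\<close>
  then obtain Q \<epsilon> where Q: "J \<le> 2 * card Q" "Q \<subseteq> {..<J}" "\<And>p. p \<in> Q \<Longrightarrow> s p = \<epsilon>" "\<bar>\<epsilon>\<bar> = (1::real)"
    unfolding Qp_def Qm_def by (elim disjE) (force+)
  have finQ: "finite Q" using Q(2) by (rule finite_subset) simp
  let ?T = "\<lambda>p. p * (K + 1) + K"
  from ex_nat_with_bits[of "?T ` Q"] finQ obtain n :: nat where n: "\<And>j. bit n j \<longleftrightarrow> j \<in> ?T ` Q"
    by auto
  have injT: "inj_on ?T A" for A
    by (intro inj_onI) (simp only: add_right_cancel mult_cancel2, simp)
  have T_less: "?T p < J * (K + 1)" if "p < J" for p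
  proof -
    have "?T p < Suc p * (K + 1)" by simp
    also have "\<dots> \<le> J * (K + 1)" using that by (intro mult_le_mono1) auto
    finally show ?thesis .
  qed
  have "take_bit (J * (K + 1)) n = n"
    using Q(2) T_less by (intro bit_eqI) (auto simp: bit_take_bit_iff n)
  then have nless: "n < 2 ^ (J * (K + 1))"
    by (simp add: take_bit_nat_eq_self_iff)
  have nb: "\<not> bit n (p * (K + 1) + b)" if "b < K" for p b
  proof
    assume "bit n (p * (K + 1) + b)"
    then obtain p' where "p * (K + 1) + b = p' * (K + 1) + K" by (auto simp: n)
    then have "(p * (K + 1) + b) mod (K + 1) = (p' * (K + 1) + K) mod (K + 1)" by simp
    then have "b mod (K + 1) = K mod (K + 1)" by (simp only: mod_mult_self3)
    then show False using that by simp
  qed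
  \<comment> \<open>The conjugated sum is \<open>walsh n\<close> times a partial sum of
    \<open>walsh n * h\<close>. Since \<open>walsh n\<close> is a product of sign digits,
    \<open>walsh n * h\<close> is a product of block factors and sign digits only.\<close>
  have wn: "walsh n y = (\<Prod>p\<in>Q. block_sign K p y)" for y
  proof -
    have "walsh n y = (\<Prod>j\<in>{..<J * (K + 1)} \<inter> {j. bit n j}. rademacher j y)"
      unfolding walsh_eq_prod[OF nless] by (subst prod.inter_restrict) (auto intro: prod.cong)
    also have "{..<J * (K + 1)} \<inter> {j. bit n j} = ?T ` Q"
      using T_less Q(2) by (auto simp: n)
    also have "(\<Prod>j\<in>?T ` Q. rademacher j y) = (\<Prod>p\<in>Q. block_sign K p y)"
      unfolding block_sign_def by (rule prod.reindex_cong[OF injT]) auto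
    finally show ?thesis .
  qed
  let ?h = "\<lambda>y. \<Prod>p<J. block_factor K p (class_of K p x) y"
  let ?q = "1 - 1 / 2 ^ K :: real"
  \<comment> \<open>\<open>K = k + 1\<close> makes \<open>J / 2 ^ K\<close> equal to 1/2, so
    Bernoulli's inequality leaves at least half of every contribution.\<close>
  have "1 + real J * (- 1 / 2 ^ K) \<le> (1 + (- 1 / 2 ^ K)) ^ J"
    by (rule Bernoulli_inequality) (simp add: field_simps)
  then have qJ: "1 / 2 \<le> ?q ^ J" using K by simp
  have q: "0 \<le> ?q" "?q \<le> 1" by (simp_all add: field_simps)
  have "conj_partial_sum n ?h x = (\<Sum>p<J. ?q ^ (J - 1 - p) * (if p \<in> Q then \<epsilon> else 0))"
  proof (subst conj_partial_sum_blocks[OF nb], simp, rule sum.cong)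
    fix p assume "p \<in> {..<J}"
    have "bit n (?T p) \<longleftrightarrow> p \<in> Q" unfolding n by (rule inj_image_mem_iff[OF injT])
    then show "?q ^ (J - 1 - p) * (if bit n (?T p) then \<Prod>i\<le>p. block_sign K i x else 0) =
        ?q ^ (J - 1 - p) * (if p \<in> Q then \<epsilon> else 0)"
      using Q(3)[of p] by (simp add: s_def)
  qed simp
  also have "\<dots> = \<epsilon> * (\<Sum>p\<in>{..<J} \<inter> Q. ?q ^ (J - 1 - p))"
    unfolding sum_distrib_left by (subst sum.inter_restrict) (auto intro!: sum.cong)
  also have "{..<J} \<inter> Q = Q" using Q(2) by auto
  finally have "\<bar>conj_partial_sum n ?h x\<bar> = \<bar>\<Sum>p\<in>Q. ?q ^ (J - 1 - p)\<bar>"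
    using Q(4) by (simp add: abs_mult)
  moreover have "(\<Sum>p\<in>Q. 1 / 2) \<le> (\<Sum>p\<in>Q. ?q ^ (J - 1 - p))"
  proof (rule sum_mono)
    fix p
    have "?q ^ J \<le> ?q ^ (J - 1 - p)" by (rule power_decreasing) (use q in auto)
    then show "1 / 2 \<le> ?q ^ (J - 1 - p)" using qJ by linarith
  qed
  moreover have "real J \<le> 2 * real (card Q)" using Q(1) by linarith
  ultimately have "J / 4 \<le> \<bar>conj_partial_sum n ?h x\<bar>" by simp
  also have "\<dots> = \<bar>walsh_partial_sum (\<lambda>y. ?h y * (\<Prod>p\<in>Q. block_sign K p y)) n x\<bar>"
    unfolding conj_partial_sum_def wn[symmetric] by (simp add: abs_mult mult.commute)
  finally show ?thesis using Q(2) nless by blast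
qed

text \<open>Each Riesz factor lies between 0 and 2, so the exponent of the bound is the number of
  factors: for each of \<open>2 ^ k\<close> blocks one sign digit and one block factor for each of
  the \<open>2 ^ (k + 1)\<close> classes. The logarithm of the bound is thus of order
  \<open>4 ^ k\<close>, the order of the square of the guaranteed size
  \<open>2 ^ k / 8\<close>.\<close>

theorem ex_large_partial_sums:
  fixes k :: nat
  shows "\<exists>L F. walsh_poly_upto L F \<and> (\<forall>x. 0 \<le> F x \<and> F x \<le> 2 ^ (2 ^ k * (2 ^ (k + 1) + 1))) \<and>
    (\<forall>x. walsh_partial_sum F 1 x = 1) \<and>
    (\<forall>x. \<exists>m\<le>2 ^ L. \<bar>walsh_partial_sum F m x\<bar> \<ge> 2 ^ k / 8)"
proof -
  define J :: nat where "J = 2 ^ k"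
  define K where "K = k + 1"
  define M where "M = J * (K + 1)"
  define I where "I = {..<J} \<times> insert None (Some ` Pow {..<K})"
  define N where "N = card I"
  have finI: "finite I" by (simp add: I_def)
  have "card (insert None (Some ` Pow {..<K})) = 2 ^ K + 1"
    by (subst card_insert_disjoint) (auto simp: card_image card_Pow)
  then have N: "N = 2 ^ k * (2 ^ (k + 1) + 1)"
    by (simp add: N_def I_def card_cartesian_product J_def K_def)
  obtain h where h: "bij_betw h {0..<N} I"
    using ex_bij_betw_nat_finite[OF finI] by (auto simp: N_def)
  define \<theta>' where "\<theta>' i = (case i of (p, None) \<Rightarrow> block_sign K p | (p, Some c) \<Rightarrow> block_factor K p c)" for i
  define \<theta> where "\<theta> b = \<theta>' (h b)" for b
  have \<theta>'_poly: "walsh_poly_upto M (\<theta>' i)" and \<theta>'_abs: "\<bar>\<theta>' i x\<bar> = 1" if "i \<in> I" for i x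
  proof -
    obtain p z where i: "i = (p, z)" "p < J" using \<open>i \<in> I\<close> by (auto simp: I_def)
    have "Suc p * (K + 1) \<le> M" unfolding M_def using i by (intro mult_le_mono1) auto
    from walsh_poly_upto_mono[OF walsh_poly_block_sign this] walsh_poly_upto_mono[OF walsh_poly_block_factor this]
    show "walsh_poly_upto M (\<theta>' i)"
      by (auto simp: i \<theta>'_def split: option.splits)
    show "\<bar>\<theta>' i x\<bar> = 1"
      by (auto simp: i \<theta>'_def abs_block_factor block_sign_def split: option.splits)
  qed
  have hI: "h b \<in> I" if "b < N" for b
    using bij_betwE[OF h] that by auto
  have \<theta>: "walsh_poly_upto M (\<theta> b)" "\<bar>\<theta> b x\<bar> = 1" if "b < N" for b x
    using \<theta>'_poly \<theta>'_abs hI[OF that] by (auto simp: \<theta>_def)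
  define F where "F = (\<lambda>y. \<Prod>b<N. 1 + rademacher (M + b) y * \<theta> b y)"
  have F_factor: "0 \<le> 1 + rademacher (M + b) y * \<theta> b y \<and> 1 + rademacher (M + b) y * \<theta> b y \<le> 2" if "b < N" for b y
    using \<theta>(2)[OF that, of y] rademacher_cases[of "M + b" y] by (auto simp: abs_if split: if_splits)
  have F_bounds: "0 \<le> F y \<and> F y \<le> 2 ^ N" for y
  proof
    show "0 \<le> F y" unfolding F_def using F_factor by (intro prod_nonneg) auto
    have "F y \<le> (\<Prod>b<N. 2)" unfolding F_def using F_factor by (intro prod_mono) auto
    then show "F y \<le> 2 ^ N" by simp
  qed
  have "\<exists>m\<le>2 ^ (M + N). \<bar>walsh_partial_sum F m x\<bar> \<ge> 2 ^ k / 8" for x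
  proof -
    obtain Q n where Q: "Q \<subseteq> {..<J}" "n < 2 ^ M"
      "\<bar>walsh_partial_sum (\<lambda>y. (\<Prod>p<J. block_factor K p (class_of K p x) y) *
        (\<Prod>p\<in>Q. block_sign K p y)) n x\<bar> \<ge> J / 4"
      using ex_partial_sum_block_product[OF J_def K_def, of x] unfolding M_def by blast
    \<comment> \<open>Here \<open>x\<close> selects which of the factors present in \<open>F\<close>
      form the product to be read off; \<open>F\<close> itself does not depend on
      \<open>x\<close>.\<close>
    define C where "C = (\<lambda>p. (p, Some (class_of K p x))) ` {..<J} \<union> (\<lambda>p. (p, None)) ` Q"
    have C: "C \<subseteq> I" using Q(1) by (auto simp: C_def I_def class_of_def)
    define B where "B = {b. b < N \<and> h b \<in> C}"
    have "bij_betw h B C"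
    proof -
      have "h ` B = C"
        using bij_betw_imp_surj_on[OF h] C by (force simp: B_def)
      then show ?thesis
        using bij_betw_imp_inj_on[OF h] by (auto simp: bij_betw_def B_def inj_on_def)
    qed
    then have "(\<Prod>b\<in>B. \<theta> b y) = (\<Prod>i\<in>C. \<theta>' i y)" for y
      unfolding \<theta>_def by (rule prod.reindex_bij_betw)
    also have "(\<Prod>i\<in>C. \<theta>' i y) = (\<Prod>p<J. block_factor K p (class_of K p x) y) * (\<Prod>p\<in>Q. block_sign K p y)" for y
      unfolding C_def using finite_subset[OF Q(1)]
      by (subst prod.union_disjoint) (auto simp: prod.reindex inj_on_def \<theta>'_def)
    finally have B_prod: "(\<Prod>b\<in>B. \<theta> b y) =
        (\<Prod>p<J. block_factor K p (class_of K p x) y) * (\<Prod>p\<in>Q. block_sign K p y)" for y .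
    have "B \<subseteq> {..<N}" by (auto simp: B_def)
    from ex_partial_sum_riesz_product[where \<theta> = \<theta>, OF \<theta>(1) walsh_poly_upto_const[of M 1] this]
    obtain m where m: "m + 2 ^ M \<le> 2 ^ (M + N)"
      "\<And>n. n \<le> 2 ^ M \<Longrightarrow> walsh_partial_sum F (m + n) x - walsh_partial_sum F m x =
         walsh m x * walsh_partial_sum (\<lambda>y. \<Prod>b\<in>B. \<theta> b y) n x"
      unfolding F_def by auto
    have "J / 4 \<le> \<bar>walsh_partial_sum F (m + n) x - walsh_partial_sum F m x\<bar>"
      using m(2)[of n] Q(2,3) by (simp add: abs_mult B_prod)
    \<comment> \<open>A difference of size \<open>J / 4\<close> forces one of the two partial sums
      to have size at least \<open>J / 8\<close>.\<close>
    then have "2 ^ k / 8 \<le> \<bar>walsh_partial_sum F (m + n) x\<bar> \<or> 2 ^ k / 8 \<le> \<bar>walsh_partial_sum F m x\<bar>"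
      using of_nat_power[of 2 k, where 'a = real] unfolding J_def of_nat_numeral by linarith
    moreover have "m + n \<le> 2 ^ (M + N)" "m \<le> 2 ^ (M + N)" using m(1) Q(2) by auto
    ultimately show ?thesis by blast
  qed
  moreover have "walsh_poly_upto (M + N) F"
    unfolding F_def by (rule walsh_poly_riesz_product[OF \<theta>(1)])
  moreover have "walsh_partial_sum F 1 x = 1" for x
    unfolding F_def by (rule walsh_coeff_riesz_product[OF \<theta>(1)])
  ultimately show ?thesis
    using F_bounds unfolding N by blast
qed

subsection \<open>Orlicz functions\<close>

lemma
  assumes "orlicz_function \<omega>"
  shows orlicz_zero: "\<omega> 0 = 0"
    and orlicz_convex: "convex_on {0..} \<omega>"
    and orlicz_continuous: "continuous_on {0..} \<omega>"
  using assms unfolding orlicz_function_def by auto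

lemma orlicz_scale:
  assumes "orlicz_function \<omega>" "0 \<le> u" "0 \<le> r" "r \<le> 1"
  shows "\<omega> (r * u) \<le> r * \<omega> u"
  using convex_onD[OF orlicz_convex[OF assms(1)], of r 0 u] assms by (simp add: orlicz_zero)

text \<open>Jensen's inequality: the weights sum to less than 1, and the missing mass sits at 0,
  where \<open>\<omega>\<close> vanishes. Splitting off the first term and halving the rest reduces
  it to convexity for two points.\<close>

lemma orlicz_dyadic_sum:
  assumes \<omega>: "orlicz_function \<omega>" and "\<And>l. 0 \<le> v l"
  shows "\<omega> (\<Sum>l<n. (1 / 2) ^ Suc l * v l) \<le> (\<Sum>l<n. (1 / 2) ^ Suc l * \<omega> (v l))"
  using assms(2)
proof (induction n arbitrary: v)
  case 0
  show ?case by (simp add: orlicz_zero[OF \<omega>])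
next
  case (Suc n)
  let ?w = "\<Sum>l<n. (1 / 2) ^ Suc l * v (Suc l)"
  have "0 \<le> ?w" using Suc.prems by (intro sum_nonneg) auto
  have "(\<Sum>l<Suc n. (1 / 2) ^ Suc l * v l) = (1 - 1 / 2) * v 0 + 1 / 2 * ?w"
    unfolding sum.lessThan_Suc_shift sum_distrib_left by (simp add: mult.assoc)
  also have "\<omega> \<dots> \<le> (1 - 1 / 2) * \<omega> (v 0) + 1 / 2 * \<omega> ?w"
    using convex_onD[OF orlicz_convex[OF \<omega>], of "1 / 2" "v 0" ?w] Suc.prems \<open>0 \<le> ?w\<close> by simp
  also have "\<omega> ?w \<le> (\<Sum>l<n. (1 / 2) ^ Suc l * \<omega> (v (Suc l)))"
    using Suc.prems by (intro Suc.IH) auto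
  also have "(1 - 1 / 2) * \<omega> (v 0) + 1 / 2 * \<dots> = (\<Sum>l<Suc n. (1 / 2) ^ Suc l * \<omega> (v l))"
    unfolding sum.lessThan_Suc_shift sum_distrib_left by (simp add: mult.assoc)
  finally show ?case by simp
qed

text \<open>The bound \<open>\<omega> (D * (c * F x)) \<le> F x\<close> together with mean 1 keeps
  the Orlicz integral at most 1, however large the partial sums are. Convexity reduces it to the
  maximal height \<open>H\<close>, and there the growth condition enters: \<open>c\<close> is of
  order \<open>1 / 2 ^ k\<close>, while the square root of \<open>ln H\<close> is of order
  \<open>2 ^ k\<close>.\<close>

lemma ex_orlicz_block:
  assumes \<omega>: "orlicz_function \<omega>" and small: "\<omega> \<in> o(\<lambda>t. t * sqrt (ln t))"
    and pos: "C > 0" "D > 0" "\<epsilon> > 0"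
  shows "\<exists>c L F R. 0 < c \<and> c \<le> \<epsilon> \<and> walsh_poly_upto L F \<and> (\<forall>x. 0 \<le> F x \<and> c * F x \<le> R) \<and>
    (\<forall>x. walsh_partial_sum F 1 x = 1) \<and> (\<forall>x. \<omega> (D * (c * F x)) \<le> F x) \<and>
    (\<forall>x. \<exists>m\<le>2 ^ L. C \<le> \<bar>c * walsh_partial_sum F m x\<bar>)"
proof -
  \<comment> \<open>With \<open>c = 8 * C / 2 ^ k\<close> the guaranteed partial sums
    \<open>2 ^ k / 8\<close> become \<open>C\<close>, and the largest argument of
    \<open>\<omega>\<close> becomes \<open>A * H / 2 ^ k\<close>.\<close>
  define A where "A = 8 * C * D"
  have A: "A > 0" using pos by (simp add: A_def)
  have "eventually (\<lambda>t. norm (\<omega> t) \<le> 1 / (2 * A) * norm (t * sqrt (ln t))) at_top"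
    using A by (intro landau_o.smallD[OF small]) simp
  then obtain t0 where t0: "\<And>t. t \<ge> t0 \<Longrightarrow> \<bar>\<omega> t\<bar> \<le> 1 / (2 * A) * \<bar>t * sqrt (ln t)\<bar>"
    by (auto simp: eventually_at_top_linorder)
  \<comment> \<open>The bound by \<open>A\<close> makes the argument \<open>A * H / 2 ^ k\<close> at
    most \<open>H\<close>, the bound by \<open>8 * C / \<epsilon>\<close> gives
    \<open>c \<le> \<epsilon>\<close>, and the bound by \<open>max t0 1 / A\<close>, since
    \<open>4 ^ k \<le> H\<close>, makes the argument at least \<open>t0\<close> and 1.\<close>
  obtain k where k: "2 ^ k > max (max A (8 * C / \<epsilon>)) (max 1 (max t0 1 / A))"
    using real_arch_pow[of 2 "max (max A (8 * C / \<epsilon>)) (max 1 (max t0 1 / A))"] by auto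
  define N where "N = (2::nat) ^ k * (2 ^ (k + 1) + 1)"
  define H :: real where "H = 2 ^ N"
  define c where "c = 8 * C / 2 ^ k"
  from ex_large_partial_sums[of k] obtain L F where
    F: "walsh_poly_upto L F" "\<And>x. 0 \<le> F x \<and> F x \<le> H" "\<And>x. walsh_partial_sum F 1 x = 1"
      "\<And>x. \<exists>m\<le>2 ^ L. \<bar>walsh_partial_sum F m x\<bar> \<ge> 2 ^ k / 8"
    unfolding N_def[symmetric] H_def[symmetric] by blast
  have H: "H > 0" by (simp add: H_def)
  have c: "0 < c" "c \<le> \<epsilon>"
    using pos k by (auto simp: c_def field_simps)
  have Dc: "D * (c * H) = A * H / 2 ^ k" by (simp add: c_def A_def)
  have "(4::real) ^ k \<le> H"
  proof -
    have "2 * k \<le> N"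
    proof -
      have "k \<le> 2 ^ k" "(2::nat) \<le> 2 ^ (k + 1) + 1" by auto
      then have "k * 2 \<le> N" unfolding N_def by (intro mult_le_mono)
      then show ?thesis by simp
    qed
    then have "(2::real) ^ (2 * k) \<le> 2 ^ N" by (intro power_increasing) auto
    then show ?thesis by (simp add: H_def power_mult)
  qed
  then have "2 ^ k \<le> H / 2 ^ k"
    by (simp add: field_simps flip: power_mult_distrib)
  then have tlow: "A * 2 ^ k \<le> A * H / 2 ^ k" using A by (simp add: field_simps)
  have "max t0 1 / A < 2 ^ k" using k by simp
  then have "max t0 1 < A * 2 ^ k" using A by (simp add: field_simps)
  with tlow have t: "t0 \<le> A * H / 2 ^ k" "1 \<le> A * H / 2 ^ k" by linarith+
  have tH: "A * H / 2 ^ k \<le> H" using k H by (simp add: field_simps)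
  have "ln (A * H / 2 ^ k) \<le> ln H" using tH A H by (intro ln_mono) (auto intro!: divide_pos_pos mult_pos_pos)
  also have "ln H = real N * ln 2" by (simp add: H_def ln_realpow)
  also have "\<dots> \<le> real N * 1" using ln_2_less_1 by (intro mult_left_mono) auto
  also have "\<dots> = 2 ^ k * (2 * 2 ^ k + 1)" by (simp add: N_def algebra_simps)
  also have "\<dots> \<le> 2 ^ k * (2 * 2 ^ k + 2 * 2 ^ k)"
    using one_le_power[of "2::real" k] by (intro mult_left_mono add_left_mono) linarith+
  also have "\<dots> = (2 * 2 ^ k)\<^sup>2" by (simp add: power2_eq_square)
  finally have "sqrt (ln (A * H / 2 ^ k)) \<le> 2 * 2 ^ k"
    by (intro real_le_lsqrt) auto
  then have "A * H / 2 ^ k * sqrt (ln (A * H / 2 ^ k)) \<le> A * H / 2 ^ k * (2 * 2 ^ k)"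
    using A H by (intro mult_left_mono) auto
  then have "\<bar>A * H / 2 ^ k * sqrt (ln (A * H / 2 ^ k))\<bar> \<le> 2 * A * H"
    using t ln_ge_zero[OF t(2)] A H by (simp add: abs_mult)
  then have "1 / (2 * A) * \<bar>A * H / 2 ^ k * sqrt (ln (A * H / 2 ^ k))\<bar> \<le> 1 / (2 * A) * (2 * A * H)"
    using A by (intro mult_left_mono) auto
  with t0[OF t(1)] have \<omega>H: "\<omega> (D * (c * H)) \<le> H"
    using A unfolding Dc by simp
  have "\<omega> (D * (c * F x)) \<le> F x" for x
  proof -
    have "D * (c * F x) = F x / H * (D * (c * H))" using H by simp
    also have "\<omega> \<dots> \<le> F x / H * \<omega> (D * (c * H))"
      using F(2)[of x] H c pos by (intro orlicz_scale[OF \<omega>]) auto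
    also have "\<dots> \<le> F x / H * H"
      using F(2)[of x] H by (intro mult_left_mono \<omega>H) auto
    finally show ?thesis using H by simp
  qed
  moreover have "\<exists>m\<le>2 ^ L. C \<le> \<bar>c * walsh_partial_sum F m x\<bar>" for x
  proof -
    from F(4)[of x] obtain m where m: "m \<le> 2 ^ L" "2 ^ k / 8 \<le> \<bar>walsh_partial_sum F m x\<bar>" by blast
    have "C = c * (2 ^ k / 8)" by (simp add: c_def)
    also have "\<dots> \<le> \<bar>c * walsh_partial_sum F m x\<bar>"
      using m c by (simp add: abs_mult)
    finally show ?thesis using m by blast
  qed
  moreover have "0 \<le> F x \<and> c * F x \<le> c * H" for x
    using F(2)[of x] c by simp
  ultimately show ?thesis using c F by blast
qed

text \<open>The frequencies of the dilate are multiples of \<open>2 ^ s\<close>, so its partial sums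
  change only when \<open>n\<close> passes such a multiple; \<open>m\<close> is
  \<open>n / 2 ^ s\<close> rounded up. A mean over at most \<open>2 ^ s\<close> consecutive partial
  sums can therefore coincide with a single one.\<close>

lemma walsh_poly_scale:
  assumes "walsh_poly_upto L F"
  shows "walsh_poly ((\<lambda>k. k * 2 ^ s) ` {..<2 ^ L}) (\<lambda>x. F (2 ^ s * x))"
    and "(\<And>k. k * 2 ^ s < n \<longleftrightarrow> k < m) \<Longrightarrow>
      walsh_partial_sum (\<lambda>x. F (2 ^ s * x)) n x = walsh_partial_sum F m (2 ^ s * x)"
proof -
  from assms obtain a where a: "F = (\<lambda>x. \<Sum>k<2^L. a k * walsh k x)"
    by (rule walsh_polyE)
  have inj: "inj_on (\<lambda>k. k * 2 ^ s) A" for A :: "nat set" by (auto simp: inj_on_def)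
  have eq: "(\<lambda>x. F (2 ^ s * x)) = (\<lambda>x. \<Sum>j\<in>(\<lambda>k. k * 2 ^ s) ` {..<2 ^ L}. a (j div 2 ^ s) * walsh j x)"
    unfolding a by (simp add: sum.reindex[OF inj] walsh_scale)
  show "walsh_poly ((\<lambda>k. k * 2 ^ s) ` {..<2 ^ L}) (\<lambda>x. F (2 ^ s * x))"
    unfolding eq walsh_poly_def by (intro conjI exI) auto
  assume n: "\<And>k. k * 2 ^ s < n \<longleftrightarrow> k < m"
  have int: "(\<lambda>k. k * 2 ^ s) ` {..<2 ^ L} \<inter> {..<n} = (\<lambda>k. k * 2 ^ s) ` ({..<2 ^ L} \<inter> {..<m})"
    using n by auto
  have "walsh_partial_sum (\<lambda>x. F (2 ^ s * x)) n x =
      (\<Sum>j\<in>(\<lambda>k. k * 2 ^ s) ` {..<2 ^ L} \<inter> {..<n}. a (j div 2 ^ s) * walsh j x)"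
    unfolding eq by (rule walsh_partial_sum_walsh_sum) simp
  also have "\<dots> = (\<Sum>k\<in>{..<2 ^ L} \<inter> {..<m}. a k * walsh k (2 ^ s * x))"
    unfolding int by (simp add: sum.reindex[OF inj] walsh_scale)
  also have "\<dots> = walsh_partial_sum F m (2 ^ s * x)"
    unfolding a by (rule walsh_partial_sum_walsh_sum[symmetric]) simp
  finally show "walsh_partial_sum (\<lambda>x. F (2 ^ s * x)) n x = walsh_partial_sum F m (2 ^ s * x)" .
qed

text \<open>A large ratio \<open>n / lam n\<close> leaves room for \<open>L\<close> dyadic scales
  between \<open>lam n\<close> and \<open>n\<close>. With \<open>2 ^ j\<close> the largest power of
  2 up to \<open>n\<close>, the choice is \<open>s = j - L\<close>; monotonicity carries the bound
  for \<open>lam n\<close> to all smaller indices.\<close>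

lemma ex_window:
  fixes lam :: "nat \<Rightarrow> nat"
  assumes bounds: "\<And>n. n \<ge> 1 \<Longrightarrow> 1 \<le> lam n \<and> lam n \<le> n"
    and nondec: "\<And>m n. 1 \<le> m \<Longrightarrow> m \<le> n \<Longrightarrow> lam m \<le> lam n"
    and unb: "\<not> bdd_above ((\<lambda>n. real n / real (lam n)) ` {1..})"
  shows "\<exists>s\<ge>E. \<forall>n. 1 \<le> n \<and> n \<le> 2 ^ (s + L) \<longrightarrow> lam n < 2 ^ s"
proof -
  \<comment> \<open>The extra factor 2 allows for \<open>n < 2 ^ (j + 1)\<close>, and
    \<open>2 ^ E\<close> forces \<open>s \<ge> E\<close> because
    \<open>lam n \<ge> 1\<close>.\<close>
  obtain n where n: "n \<ge> 1" "real n / real (lam n) > 2 ^ (L + 1 + E)"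
    using unb unfolding bdd_above_def by (auto simp: not_le)
  have lam: "lam n \<ge> 1" using bounds[OF n(1)] by simp
  then have "real n > real (2 ^ (L + 1 + E) * lam n)" using n(2) by (simp add: field_simps)
  then have n': "2 ^ (L + 1 + E) * lam n < n" by linarith
  obtain j where j: "2 ^ j \<le> n" "n < 2 ^ (j + 1)"
    using ex_power_ivl1[of 2 n] n(1) by auto
  have "(2::nat) ^ (L + 1 + E) \<le> 2 ^ (L + 1 + E) * lam n" using lam by simp
  also have "\<dots> < 2 ^ (j + 1)" using n' j(2) by linarith
  finally have "L + 1 + E < j + 1" by (rule power_less_imp_less_exp[rotated]) simp
  then have jL: "L + E \<le> j" by simp
  have "2 ^ (L + 1) * lam n \<le> 2 ^ (L + 1 + E) * lam n"
    by (intro mult_le_mono1 power_increasing) auto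
  also have "\<dots> < 2 ^ (j + 1)" using n' j(2) by linarith
  also have "\<dots> = 2 ^ (L + 1) * 2 ^ (j - L)" using jL by (simp flip: power_add)
  finally have "lam n < 2 ^ (j - L)" by simp
  moreover have "lam i \<le> lam n" if "1 \<le> i" "i \<le> 2 ^ (j - L + L)" for i
    using that jL j(1) by (intro nondec) auto
  ultimately show ?thesis
    using jL by (intro exI[of _ "j - L"]) (auto intro: le_less_trans)
qed

subsection \<open>Superposition of blocks\<close>

text \<open>Writing \<open>c l * u l x\<close> as \<open>(1 / 2) ^ Suc l\<close> times
  \<open>2 ^ Suc l * (c l * u l x)\<close>, Jensen's inequality bounds \<open>\<omega> (f x)\<close>
  almost everywhere by the sum of \<open>(1 / 2) ^ Suc l * u l x\<close>, whose integral is 1.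
  Partial sums are finite combinations of coefficients, and these come from termwise integration; so
  the second claim holds at every \<open>x\<close>, even where the series for \<open>f\<close>
  diverges.\<close>

lemma
  fixes u :: "nat \<Rightarrow> real \<Rightarrow> real"
  assumes \<omega>: "orlicz_function \<omega>"
    and u: "\<And>l. walsh_poly (I l) (u l)" "\<And>l x. 0 \<le> u l x" "\<And>l. walsh_coeff (u l) 0 = 1"
    and c: "\<And>l. 0 \<le> c l" "\<And>l. c l \<le> (1 / 2) ^ Suc l"
    and \<omega>u: "\<And>l x. \<omega> (2 ^ Suc l * (c l * u l x)) \<le> u l x"
  defines "f \<equiv> \<lambda>x. \<Sum>l. c l * (indicator {0..<1} x * u l x)"
  shows superposition_orlicz_class: "f \<in> orlicz_class \<omega>"
    and walsh_partial_sum_superposition: "(\<lambda>l. c l * walsh_partial_sum (u l) n x) sums walsh_partial_sum f n x"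
proof -
  let ?v = "\<lambda>l x. indicator {0..<1} x * u l x"
  have int: "integrable lebesgue (?v l)" for l
    using walsh_poly_integrable[OF u(1)[of l]] by (simp add: set_integrable_def)
  then have [measurable]: "?v l \<in> borel_measurable lebesgue" for l by auto
  have v0: "0 \<le> ?v l x" for l x using u(2) by simp
  have int1: "(\<integral>x. ?v l x \<partial>lebesgue) = 1" for l
    using u(3)[of l] by (simp add: walsh_coeff_def set_lebesgue_integral_def)
  have nn1: "(\<integral>\<^sup>+x. ennreal (r * ?v l x) \<partial>lebesgue) = ennreal r" if "0 \<le> r" for r l
    using that int[of l] v0 int1[of l] by (subst nn_integral_eq_integral) auto
  have half: "(\<lambda>l. (1 / 2 :: real) ^ Suc l) sums 1" by (rule power_half_series)
  have nnsum: "(\<integral>\<^sup>+x. (\<Sum>l. ennreal ((1 / 2) ^ Suc l * ?v l x)) \<partial>lebesgue) = 1"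
  proof -
    have "(\<integral>\<^sup>+x. (\<Sum>l. ennreal ((1 / 2) ^ Suc l * ?v l x)) \<partial>lebesgue) =
        (\<Sum>l. \<integral>\<^sup>+x. ennreal ((1 / 2) ^ Suc l * ?v l x) \<partial>lebesgue)"
      by (rule nn_integral_suminf) simp
    also have "\<dots> = (\<Sum>l. ennreal ((1 / 2) ^ Suc l))"
      by (subst nn1) simp_all
    also have "\<dots> = ennreal 1"
      using half by (subst suminf_ennreal_eq) auto
    finally show ?thesis by simp
  qed
  \<comment> \<open>The majorant has integral 1, hence is finite almost everywhere, and both series
    converge off a null set. Where the series for \<open>f\<close> diverges, \<open>f\<close> takes
    the unspecified value of \<open>suminf\<close>.\<close>
  have "AE x in lebesgue. (\<Sum>l. ennreal ((1 / 2) ^ Suc l * ?v l x)) \<noteq> \<infinity>"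
    by (rule nn_integral_PInf_AE) (simp_all only: nnsum, simp_all)
  then have sm: "AE x in lebesgue. summable (\<lambda>l. (1 / 2) ^ Suc l * ?v l x)"
  proof eventually_elim
    case (elim x)
    then show ?case using v0 by (intro summable_suminf_not_top) auto
  qed
  then have smc: "AE x in lebesgue. summable (\<lambda>l. c l * ?v l x)"
  proof eventually_elim
    case (elim x)
    show ?case
      by (rule summable_comparison_test[OF _ elim])
        (use c v0 in \<open>auto intro!: exI[of _ 0] mult_right_mono simp: abs_mult abs_of_nonneg[OF u(2)] simp del: power_Suc\<close>)
  qed
  have [measurable]: "f \<in> borel_measurable lebesgue" unfolding f_def by measurable
  have bound: "AE x in lebesgue. ennreal (\<omega> \<bar>f x\<bar>) * indicator {0..<1} x \<le>
      (\<Sum>l. ennreal ((1 / 2) ^ Suc l * ?v l x))"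
    using sm smc
  proof eventually_elim
    case (elim x)
    show ?case
    proof (cases "x \<in> {0..<1}")
      case True
      have fx: "(\<lambda>n. \<Sum>l<n. c l * ?v l x) \<longlonglongrightarrow> f x"
        unfolding f_def by (rule summable_LIMSEQ[OF elim(2)])
      have f0: "0 \<le> f x" unfolding f_def using elim(2) c v0 by (intro suminf_nonneg) auto
      have lim: "(\<lambda>n. \<omega> (\<Sum>l<n. c l * ?v l x)) \<longlonglongrightarrow> \<omega> (f x)"
        using fx f0 c v0
        by (intro continuous_on_tendsto_compose[OF orlicz_continuous[OF \<omega>]])
           (auto intro!: always_eventually sum_nonneg)
      have "\<omega> (\<Sum>l<n. c l * ?v l x) \<le> (\<Sum>l. (1 / 2) ^ Suc l * ?v l x)" for n
      proof -
        have "(\<Sum>l<n. c l * ?v l x) = (\<Sum>l<n. (1 / 2) ^ Suc l * (2 ^ Suc l * (c l * u l x)))"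
          using True by (intro sum.cong) (auto simp: power_one_over)
        also have "\<omega> \<dots> \<le> (\<Sum>l<n. (1 / 2) ^ Suc l * \<omega> (2 ^ Suc l * (c l * u l x)))"
          using c u(2) by (intro orlicz_dyadic_sum[OF \<omega>]) auto
        also have "\<dots> \<le> (\<Sum>l<n. (1 / 2) ^ Suc l * ?v l x)"
          using True \<omega>u by (intro sum_mono mult_left_mono) auto
        also have "\<dots> \<le> (\<Sum>l. (1 / 2) ^ Suc l * ?v l x)"
          using v0 by (intro sum_le_suminf elim(1)) auto
        finally show ?thesis .
      qed
      then have "\<omega> (f x) \<le> (\<Sum>l. (1 / 2) ^ Suc l * ?v l x)"
        by (intro LIMSEQ_le_const2[OF lim]) auto
      then have "ennreal (\<omega> (f x)) \<le> (\<Sum>l. ennreal ((1 / 2) ^ Suc l * ?v l x))"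
        using v0 by (subst suminf_ennreal2[OF _ elim(1)]) (auto intro: ennreal_leI)
      then show ?thesis using True f0 by simp
    qed simp
  qed
  have "(\<integral>\<^sup>+x\<in>{0..<1}. ennreal (\<omega> \<bar>f x\<bar>) \<partial>lebesgue) \<le> 1"
    using nn_integral_mono_AE[OF bound] unfolding nnsum .
  also have "\<dots> < \<infinity>" by simp
  finally show "f \<in> orlicz_class \<omega>"
    unfolding orlicz_class_def by (auto intro: measurable_restrict_space1)
  have coeff: "(\<lambda>l. c l * walsh_coeff (u l) k) sums walsh_coeff f k" for k
  proof -
    let ?g = "\<lambda>l x. c l * (?v l x * walsh k x)"
    have gi: "integrable lebesgue (?g l)" for l
      using set_integrable_mult_walsh[OF walsh_poly_integrable[OF u(1)[of l]], of k]
      by (intro integrable_mult_right) (simp add: set_integrable_def mult.assoc)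
    have ng: "norm (?g l x) = c l * ?v l x" for l x
      using v0[of x l] c(1)[of l] by (simp add: abs_mult abs_of_nonneg[OF u(2)])
    have "(\<lambda>l. \<integral>x. ?g l x \<partial>lebesgue) sums (\<integral>x. (\<Sum>l. ?g l x) \<partial>lebesgue)"
    proof (rule sums_integral[OF gi])
      show "AE x in lebesgue. summable (\<lambda>l. norm (?g l x))" unfolding ng by (rule smc)
      have "(\<integral>x. norm (?g l x) \<partial>lebesgue) = c l" for l unfolding ng using int1[of l] by simp
      moreover have "summable c"
        by (rule summable_comparison_test[OF _ sums_summable[OF half]])
          (use c in \<open>auto intro!: exI[of _ 0] simp del: power_Suc\<close>)
      ultimately show "summable (\<lambda>l. \<integral>x. norm (?g l x) \<partial>lebesgue)" by simp
    qed
    also have "(\<lambda>l. \<integral>x. ?g l x \<partial>lebesgue) = (\<lambda>l. c l * walsh_coeff (u l) k)"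
      by (simp add: walsh_coeff_def set_lebesgue_integral_def mult.assoc)
    also have "(\<integral>x. (\<Sum>l. ?g l x) \<partial>lebesgue) = (\<integral>x. indicator {0..<1} x * (f x * walsh k x) \<partial>lebesgue)"
    proof (rule integral_cong_AE)
      have [measurable]: "?g l \<in> borel_measurable lebesgue" for l
        by (rule borel_measurable_integrable[OF gi])
      have w: "(\<lambda>x. indicator {0..<1} x * walsh k x) \<in> borel_measurable lebesgue"
        using set_integrable_walsh[of k] by (auto simp: set_integrable_def)
      show "(\<lambda>x. \<Sum>l. ?g l x) \<in> borel_measurable lebesgue" by measurable
      have "(\<lambda>x. f x * (indicator {0..<1} x * walsh k x)) \<in> borel_measurable lebesgue"
        using w by measurable
      then show "(\<lambda>x. indicator {0..<1} x * (f x * walsh k x)) \<in> borel_measurable lebesgue"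
        by (simp add: mult.left_commute)
      show "AE x in lebesgue. (\<Sum>l. ?g l x) = indicator {0..<1} x * (f x * walsh k x)"
        using smc
      proof eventually_elim
        case (elim x)
        have "(\<Sum>l. ?g l x) = f x * walsh k x"
          unfolding f_def suminf_mult2[OF elim] by (simp add: mult.assoc)
        then show ?case by (cases "x \<in> {0..<1}") auto
      qed
    qed
    also have "\<dots> = walsh_coeff f k" by (simp add: walsh_coeff_def set_lebesgue_integral_def)
    finally show ?thesis .
  qed
  have "(\<lambda>l. \<Sum>k<n. c l * walsh_coeff (u l) k * walsh k x) sums (\<Sum>k<n. walsh_coeff f k * walsh k x)"
    by (intro sums_sum sums_mult2 coeff)
  then show "(\<lambda>l. c l * walsh_partial_sum (u l) n x) sums walsh_partial_sum f n x"
    by (simp add: walsh_partial_sum_def sum_distrib_left mult.assoc)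
qed


text \<open>Blocks are chosen inductively, with small amplitudes but partial sums that outgrow the
  sup norm of all earlier blocks together. In the frequency window of one block, the earlier ones
  are summed completely and the later ones are present only through their means.\<close>

theorem dlvp_mean_divergence:
  fixes lam :: "nat \<Rightarrow> nat"
  assumes bounds: "\<And>n. n \<ge> 1 \<Longrightarrow> 1 \<le> lam n \<and> lam n \<le> n"
    and nondec: "\<And>m n. 1 \<le> m \<Longrightarrow> m \<le> n \<Longrightarrow> lam m \<le> lam n"
    and unb: "\<not> bdd_above ((\<lambda>n. real n / real (lam n)) ` {1..})"
    and \<omega>: "orlicz_function \<omega>" and small: "\<omega> \<in> o(\<lambda>t. t * sqrt (ln t))"
  shows "\<exists>f\<in>orlicz_class \<omega>. \<forall>x. limsup (\<lambda>n. ereal \<bar>dlvp_mean lam n f x\<bar>) = \<infinity>"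
proof -
  \<comment> \<open>A state consists of the amplitude \<open>c\<close>, the degree exponent
    \<open>L\<close>, the polynomial \<open>F\<close>, the dilation exponent \<open>s\<close>, and a
    uniform bound \<open>R\<close> for the sum of all blocks chosen so far.\<close>
  define P where "P l = (\<lambda>(c, L, F, s, R). 0 < c \<and> c \<le> (1 / 2) ^ Suc l \<and> walsh_poly_upto L F \<and>
    (\<forall>x. 0 \<le> F x \<and> c * F x \<le> R) \<and> (\<forall>x. walsh_partial_sum F 1 x = 1) \<and>
    (\<forall>x. \<omega> (2 ^ Suc l * (c * F x)) \<le> F x) \<and> (\<forall>n. 1 \<le> n \<and> n \<le> 2 ^ (s + L) \<longrightarrow> lam n < 2 ^ s))"
    for l :: nat
  \<comment> \<open>Consecutive windows are separated. In \<open>real l + R + 2\<close> the term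
    \<open>R\<close> pays for the earlier blocks, and 2 covers the means of the later ones, which
    add up to at most 1.\<close>
  define Q where "Q l = (\<lambda>(c :: real, L :: nat, F :: real \<Rightarrow> real, s :: nat, R) (c', L', F', s' :: nat, R'). s + L + 1 \<le> s' \<and>
    (\<forall>x. R + c' * F' x \<le> R') \<and> (\<forall>x. \<exists>m\<le>2 ^ L'. real l + R + 2 \<le> \<bar>c' * walsh_partial_sum F' m x\<bar>))"
    for l :: nat
  have step: "\<exists>c L F s R. P l (c, L, F, s, R0 + R) \<and> E \<le> s \<and> (\<forall>x. c * F x \<le> R) \<and>
    (\<forall>x. \<exists>m\<le>2 ^ L. C \<le> \<bar>c * walsh_partial_sum F m x\<bar>)" if "0 < C" "0 \<le> R0" for l C R0 E
  proof -
    from ex_orlicz_block[OF \<omega> small \<open>0 < C\<close>, of "2 ^ Suc l" "(1 / 2) ^ Suc l"]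
    obtain c L F R where F: "0 < c" "c \<le> (1 / 2) ^ Suc l" "walsh_poly_upto L F"
      "\<And>x. 0 \<le> F x \<and> c * F x \<le> R" "\<And>x. walsh_partial_sum F 1 x = 1"
      "\<And>x. \<omega> (2 ^ Suc l * (c * F x)) \<le> F x"
      "\<And>x. \<exists>m\<le>2 ^ L. C \<le> \<bar>c * walsh_partial_sum F m x\<bar>"
      by auto
    from ex_window[OF bounds nondec unb, of E L] obtain s where s: "E \<le> s"
      "\<forall>n. 1 \<le> n \<and> n \<le> 2 ^ (s + L) \<longrightarrow> lam n < 2 ^ s"
      by blast
    have "c * F x \<le> R0 + R" for x using F(4)[of x] that(2) by linarith
    then have "P l (c, L, F, s, R0 + R)" unfolding P_def using F s by auto
    then show ?thesis using F s by blast
  qed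
  have "\<exists>st. \<forall>n. P n (st n) \<and> Q n (st n) (st (Suc n))"
  proof (rule dependent_nat_choice)
    from step[of 1 0 0 0] obtain c L F s R where "P 0 (c, L, F, s, 0 + R)" by auto
    then show "\<exists>x. P 0 x" by blast
    fix x n assume "P n x"
    obtain c L F s R where x: "x = (c, L, F, s, R)" by (cases x)
    have "0 \<le> c * F 0" "c * F 0 \<le> R" using \<open>P n x\<close> by (auto simp: P_def x)
    then have R: "0 \<le> R" by linarith
    from step[of "real n + R + 2" R "Suc n" "s + L + 1"] R
    obtain c' L' F' s' R' where "P (Suc n) (c', L', F', s', R + R')" "s + L + 1 \<le> s'" "\<And>x. c' * F' x \<le> R'"
      "\<And>x. \<exists>m\<le>2 ^ L'. real n + R + 2 \<le> \<bar>c' * walsh_partial_sum F' m x\<bar>"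
      by auto
    then have "P (Suc n) (c', L', F', s', R + R') \<and> Q n x (c', L', F', s', R + R')"
      unfolding Q_def x by auto
    then show "\<exists>y. P (Suc n) y \<and> Q n x y" by blast
  qed
  then obtain st where st: "\<And>n. P n (st n)" "\<And>n. Q n (st n) (st (Suc n))" by blast
  define c where "c l = fst (st l)" for l
  define L where "L l = fst (snd (st l))" for l
  define F where "F l = fst (snd (snd (st l)))" for l
  define s where "s l = fst (snd (snd (snd (st l))))" for l
  define R where "R l = snd (snd (snd (snd (st l))))" for l
  have st_eq: "st l = (c l, L l, F l, s l, R l)" for l
    by (simp add: c_def L_def F_def s_def R_def)
  have c: "0 < c l" "c l \<le> (1 / 2) ^ Suc l"
    and F: "walsh_poly_upto (L l) (F l)" "0 \<le> F l x" "c l * F l x \<le> R l"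
      "walsh_partial_sum (F l) 1 x = 1" "\<omega> (2 ^ Suc l * (c l * F l x)) \<le> F l x"
    and win: "\<And>n. 1 \<le> n \<Longrightarrow> n \<le> 2 ^ (s l + L l) \<Longrightarrow> lam n < 2 ^ s l" for l x
    using st(1)[of l] unfolding st_eq P_def by auto
  have s_step: "s l + L l + 1 \<le> s (Suc l)" and R_step: "R l + c (Suc l) * F (Suc l) x \<le> R (Suc l)"
    and big: "\<exists>m\<le>2 ^ L (Suc l). real l + R l + 2 \<le> \<bar>c (Suc l) * walsh_partial_sum (F (Suc l)) m x\<bar>" for l x
    using st(2)[of l] unfolding st_eq Q_def by auto
  have s_mono: "s l + L l + 1 \<le> s l'" if "l < l'" for l l'
    using that
  proof (induction l')
    case (Suc l')
    show ?case
    proof (cases "l = l'")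
      case False
      then show ?thesis using Suc s_step[of l'] by simp
    qed (use s_step in simp)
  qed simp
  have R_sum: "(\<Sum>i\<le>l. c i * F i (y i)) \<le> R l" for l y
  proof (induction l)
    case (Suc l)
    then show ?case using R_step[of l "y (Suc l)"] by simp
  qed (use F in simp)
  define u where "u l = (\<lambda>x. F l (2 ^ s l * x))" for l
  define f where "f = (\<lambda>x. \<Sum>l. c l * (indicator {0..<1} x * u l x))"
  have u_poly: "walsh_poly ((\<lambda>k. k * 2 ^ s l) ` {..<2 ^ L l}) (u l)" for l
    unfolding u_def by (rule walsh_poly_scale(1)[OF F(1)])
  have u_sum: "walsh_partial_sum (u l) n x = walsh_partial_sum (F l) m (2 ^ s l * x)"
    if "\<And>k. k * 2 ^ s l < n \<longleftrightarrow> k < m" for l n m x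
    unfolding u_def by (rule walsh_poly_scale(2)[OF F(1)]) (rule that)
  have u_small: "walsh_partial_sum (u l) n x = 1" if "1 \<le> n" "n \<le> 2 ^ s l" for l n x
  proof -
    have "k * 2 ^ s l < n \<longleftrightarrow> k < 1" for k
    proof (cases k)
      case (Suc j)
      then have "2 ^ s l \<le> k * 2 ^ s l" by simp
      then show ?thesis using Suc that by linarith
    qed (use that in simp)
    then show ?thesis using F(4) by (subst u_sum[of _ _ 1]) auto
  qed
  have u_large: "walsh_partial_sum (u l) n x = u l x" if "2 ^ (s l + L l) \<le> n" for l n x
  proof (rule walsh_partial_sum_eq_self[OF u_poly], rule subsetI)
    fix j :: nat assume "j \<in> (\<lambda>k. k * 2 ^ s l) ` {..<2 ^ L l}"
    then obtain k where "k < 2 ^ L l" "j = k * 2 ^ s l" by auto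
    then have "j < 2 ^ L l * 2 ^ s l" by simp
    then show "j \<in> {..<n}" using that by (simp add: power_add mult.commute)
  qed
  have "walsh_partial_sum (u l) 1 0 = walsh_coeff (u l) 0" for l
    by (simp add: walsh_partial_sum_def)
  then have u0: "walsh_coeff (u l) 0 = 1" for l
    using u_small[of 1 l 0] by simp
  have u_nonneg: "0 \<le> u l x" for l x unfolding u_def by (rule F)
  have \<omega>u: "\<omega> (2 ^ Suc l * (c l * u l x)) \<le> u l x" for l x unfolding u_def by (rule F)
  note superposition = superposition_orlicz_class[where c = c and u = u, OF \<omega> u_poly u_nonneg u0 less_imp_le[OF c(1)] c(2) \<omega>u]
    walsh_partial_sum_superposition[where c = c and u = u, OF \<omega> u_poly u_nonneg u0 less_imp_le[OF c(1)] c(2) \<omega>u]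
  have fin: "f \<in> orlicz_class \<omega>"
    and fsum: "\<And>n x. (\<lambda>l. c l * walsh_partial_sum (u l) n x) sums walsh_partial_sum f n x"
    unfolding f_def by (rule superposition)+
  have ex: "\<exists>n. 2 ^ s (Suc p) < n \<and> n \<le> 2 ^ (s (Suc p) + L (Suc p)) \<and> real p \<le> \<bar>dlvp_mean lam n f x\<bar>" for p x
  proof -
    let ?s = "s (Suc p)" and ?L = "L (Suc p)"
    obtain m where m: "m \<le> 2 ^ ?L"
      "real p + R p + 2 \<le> \<bar>c (Suc p) * walsh_partial_sum (F (Suc p)) m (2 ^ ?s * x)\<bar>"
      using big by blast
    have Rp: "0 \<le> R p"
      using F(2,3)[of p 0] c(1)[of p] by (meson less_imp_le mult_nonneg_nonneg order_trans)
    have c1: "c l \<le> 1" for l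
      using c(2)[of l] power_le_one[of "1 / 2 :: real" "Suc l"] by simp
    have "m \<noteq> 0"
    proof
      assume "m = 0"
      then show False using m(2) Rp by (simp add: walsh_partial_sum_def)
    qed
    moreover have "m \<noteq> 1"
    proof
      assume "m = 1"
      then have "real p + R p + 2 \<le> \<bar>c (Suc p)\<bar>" using m(2) F(4) by simp
      then show False using c1[of "Suc p"] c(1)[of "Suc p"] Rp by simp
    qed
    ultimately have m2: "2 \<le> m" by simp
    \<comment> \<open>Truncation is strict, so at \<open>n\<close> the block shows exactly its first
      \<open>m\<close> frequencies, and this stays so for the \<open>2 ^ ?s\<close> indices ending
      at \<open>n\<close>. Since \<open>m \<ge> 2\<close>, all of these lie above the frequencies of
      the earlier blocks.\<close>
    define n where "n = m * 2 ^ ?s"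
    have n: "2 ^ ?s < n" "n \<le> 2 ^ (?s + ?L)"
      using m2 m(1) by (auto simp: n_def power_add)
    have lam: "lam n < 2 ^ ?s" using n by (intro win) auto
    \<comment> \<open>The three cases are a completed block, the active block, and a later block
      that shows only its mean 1.\<close>
    define a where "a l = (if l \<le> p then c l * u l x else if l = Suc p then
      c (Suc p) * walsh_partial_sum (F (Suc p)) m (2 ^ ?s * x) else c l)" for l
    have S: "(\<lambda>l. c l * walsh_partial_sum (u l) k x) = a" if "k \<in> {n - lam n..n}" for k
    proof
      fix l
      have k: "n < k + 2 ^ ?s" "k \<le> n" using that lam by auto
      have k1: "2 ^ ?s < k"
      proof -
        have "2 * 2 ^ ?s \<le> n" unfolding n_def using m2 by (intro mult_le_mono1)
        then show ?thesis using k by simp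
      qed
      consider "l \<le> p" | "l = Suc p" | "Suc p < l" by linarith
      then show "c l * walsh_partial_sum (u l) k x = a l"
      proof cases
        case 1
        have "(2::nat) ^ (s l + L l) \<le> 2 ^ ?s"
          using s_mono[of l "Suc p"] 1 by (intro power_increasing) auto
        then have "2 ^ (s l + L l) \<le> k" using k1 by linarith
        then show ?thesis using 1 by (simp add: a_def u_large)
      next
        case 2
        have "j * 2 ^ ?s < k \<longleftrightarrow> j < m" for j
        proof
          assume "j * 2 ^ ?s < k"
          then have "j * 2 ^ ?s < m * 2 ^ ?s" using k n_def by linarith
          then show "j < m" by simp
        next
          assume "j < m"
          then have "Suc j * 2 ^ ?s \<le> m * 2 ^ ?s" by (intro mult_le_mono1) auto
          then show "j * 2 ^ ?s < k" using k n_def by simp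
        qed
        then have "walsh_partial_sum (u (Suc p)) k x = walsh_partial_sum (F (Suc p)) m (2 ^ ?s * x)"
          by (rule u_sum)
        then show ?thesis using 2 by (simp add: a_def)
      next
        case 3
        have "(2::nat) ^ (?s + ?L) \<le> 2 ^ s l"
          using s_mono[OF 3] by (intro power_increasing) auto
        then have "k \<le> 2 ^ s l" using k n by linarith
        then show ?thesis using 3 k1 u_small[of k l x] by (simp add: a_def)
      qed
    qed
    define v where "v = walsh_partial_sum f n x"
    have asum: "a sums v"
      using fsum[of n x] S[of n] by (simp add: v_def)
    have "walsh_partial_sum f k x = v" if "k \<in> {n - lam n..n}" for k
      using fsum[of k x] asum unfolding S[OF that] by (rule sums_unique2)
    then have "(\<Sum>k\<in>{n - lam n..n}. walsh_partial_sum f k x) = real (card {n - lam n..n}) * v"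
      by simp
    also have "card {n - lam n..n} = lam n + 1"
      using bounds[of n] n by simp
    finally have V: "dlvp_mean lam n f x = v"
      unfolding dlvp_mean_def by (simp add: add.commute)
    have low: "0 \<le> (\<Sum>l\<le>p. a l)" "(\<Sum>l\<le>p. a l) \<le> R p"
    proof -
      have eq: "(\<Sum>l\<le>p. a l) = (\<Sum>l\<le>p. c l * F l (2 ^ s l * x))"
        by (rule sum.cong) (auto simp: a_def u_def)
      show "0 \<le> (\<Sum>l\<le>p. a l)" unfolding eq using c(1) F(2) by (intro sum_nonneg) (simp add: less_imp_le)
      show "(\<Sum>l\<le>p. a l) \<le> R p" unfolding eq by (rule R_sum)
    qed
    have tail: "(\<lambda>l. a (l + Suc (Suc p))) sums (v - (\<Sum>l<Suc (Suc p). a l))"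
      by (rule sums_split_initial_segment[OF asum])
    have at: "a (l + Suc (Suc p)) = c (l + Suc (Suc p))" for l by (simp add: a_def)
    have "0 \<le> v - (\<Sum>l<Suc (Suc p). a l)"
      by (rule sums_le[OF _ sums_zero tail]) (simp only: at less_imp_le[OF c(1)])
    moreover have "v - (\<Sum>l<Suc (Suc p). a l) \<le> 1"
    proof (rule sums_le[OF _ tail power_half_series])
      fix l
      have "c (l + Suc (Suc p)) \<le> (1 / 2) ^ Suc (l + Suc (Suc p))" by (rule c)
      also have "\<dots> \<le> (1 / 2) ^ Suc l" by (intro power_decreasing) auto
      finally show "a (l + Suc (Suc p)) \<le> (1 / 2) ^ Suc l" unfolding at .
    qed
    moreover have "(\<Sum>l<Suc (Suc p). a l) = (\<Sum>l\<le>p. a l) + a (Suc p)"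
      by (simp add: lessThan_Suc_atMost)
    moreover have "real p + R p + 2 \<le> \<bar>a (Suc p)\<bar>"
      using m(2) by (simp add: a_def)
    ultimately have "real p \<le> \<bar>v\<bar>" using low by linarith
    then show ?thesis using n V by blast
  qed
  have "limsup (\<lambda>n. ereal \<bar>dlvp_mean lam n f x\<bar>) = \<infinity>" for x
  proof -
    have "\<forall>p. \<exists>n. 2 ^ s (Suc p) < n \<and> n \<le> 2 ^ (s (Suc p) + L (Suc p)) \<and> real p \<le> \<bar>dlvp_mean lam n f x\<bar>"
      using ex by blast
    then obtain n where n: "\<And>p. 2 ^ s (Suc p) < n p" "\<And>p. n p \<le> 2 ^ (s (Suc p) + L (Suc p))"
      "\<And>p. real p \<le> \<bar>dlvp_mean lam (n p) f x\<bar>"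
      unfolding choice_iff by blast
    have "n p < n (Suc p)" for p
    proof -
      have "n p \<le> 2 ^ (s (Suc p) + L (Suc p))" by (rule n)
      also have "\<dots> \<le> 2 ^ s (Suc (Suc p))"
        using s_step[of "Suc p"] by (intro power_increasing) auto
      also have "\<dots> < n (Suc p)" by (rule n)
      finally show ?thesis .
    qed
    then have sm: "strict_mono n" by (simp add: strict_mono_Suc_iff)
    have "filterlim (\<lambda>p. \<bar>dlvp_mean lam (n p) f x\<bar>) at_top sequentially"
      by (rule filterlim_at_top_mono[OF filterlim_real_sequentially]) (simp add: n)
    then have "(\<lambda>p. ereal \<bar>dlvp_mean lam (n p) f x\<bar>) \<longlonglongrightarrow> \<infinity>"
      by (simp add: tendsto_PInfty_eq_at_top)
    then have "limsup ((\<lambda>n. ereal \<bar>dlvp_mean lam n f x\<bar>) \<circ> n) = \<infinity>"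
      by (intro lim_imp_Limsup) (auto simp: o_def)
    then show ?thesis using limsup_subseq_mono[OF sm, of "\<lambda>n. ereal \<bar>dlvp_mean lam n f x\<bar>"] by simp
  qed
  then show ?thesis using fin by blast
qed

subsection \<open>A discrete maximal inequality\<close>

text \<open>
  A number X < 2^M stands for the dyadic interval [X / 2^M, (X + 1) / 2^M). Its binary digit at
  position k corresponds to the Rademacher function of index M - 1 - k, so X div 2^d is the
  interval of rank M - d containing it.
\<close>
definition davg :: "nat \<Rightarrow> (nat \<Rightarrow> real) \<Rightarrow> nat \<Rightarrow> nat \<Rightarrow> real" where
  "davg M g d X = (\<Sum>Y | Y < 2 ^ M \<and> Y div 2 ^ d = X div 2 ^ d. g Y) / 2 ^ d"

text \<open>Digit \<open>k = M - 1 - j\<close> belongs to \<open>rademacher j\<close>. With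
  \<open>a = M - d\<close> the weight \<open>1 / 2 ^ (k + 1 - d)\<close> is
  \<open>2 ^ j / 2 ^ a\<close>; the factor \<open>2 ^ j\<close> is the weight of
  \<open>omit_kernel a j\<close> in the Fejer kernel of order \<open>2 ^ a\<close>.\<close>

definition shifted_avg :: "nat \<Rightarrow> (nat \<Rightarrow> real) \<Rightarrow> nat \<Rightarrow> nat \<Rightarrow> real" where
  "shifted_avg M g d X = davg M g d X + (\<Sum>k=d..<M. davg M g d (xor X (2 ^ k)) / 2 ^ (k + 1 - d))"

lemma davg_cong: "X div 2 ^ d = Y div 2 ^ d \<Longrightarrow> davg M g d X = davg M g d Y"
  by (simp add: davg_def)

lemma div_power2_mono:
  fixes X Y :: nat
  assumes "X div 2 ^ d = Y div 2 ^ d" "d \<le> e"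
  shows "X div 2 ^ e = Y div 2 ^ e"
proof -
  have "Z div 2 ^ e = Z div 2 ^ d div 2 ^ (e - d)" for Z :: nat
  proof -
    have "(2::nat) ^ e = 2 ^ d * 2 ^ (e - d)" using assms(2) by (simp flip: power_add)
    then show ?thesis by (simp add: div_mult2_eq)
  qed
  then show ?thesis using assms(1) by simp
qed

lemma xor_power2_div:
  fixes X :: nat
  assumes "k < e"
  shows "xor X (2 ^ k) div 2 ^ e = X div 2 ^ e"
proof -
  have "drop_bit e (2 ^ k :: nat) = 0"
    using assms by (simp add: drop_bit_eq_div)
  then show ?thesis
    by (simp add: drop_bit_xor flip: drop_bit_eq_div)
qed

context
  fixes M :: nat and g :: "nat \<Rightarrow> real"
  assumes g: "\<And>X. 0 \<le> g X"
begin

lemma davg_nonneg: "0 \<le> davg M g d X"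
  unfolding davg_def by (intro divide_nonneg_nonneg sum_nonneg g) auto

lemma davg_le_double: "davg M g d X \<le> 2 * davg M g (Suc d) X"
proof -
  have "(\<Sum>Y | Y < 2 ^ M \<and> Y div 2 ^ d = X div 2 ^ d. g Y) \<le>
      (\<Sum>Y | Y < 2 ^ M \<and> Y div 2 ^ Suc d = X div 2 ^ Suc d. g Y)"
  proof (rule sum_mono2[OF _ _ g])
    show "{Y. Y < 2 ^ M \<and> Y div 2 ^ d = X div 2 ^ d} \<subseteq> {Y. Y < 2 ^ M \<and> Y div 2 ^ Suc d = X div 2 ^ Suc d}"
      by (intro Collect_mono impI conjI) (auto intro!: div_power2_mono[where d = d and e = "Suc d"] simp del: power_Suc)
  qed simp
  then show ?thesis by (simp add: davg_def field_simps)
qed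

text \<open>After exchanging the sums, each \<open>g Y\<close> is distributed with weight
  \<open>1 / 2 ^ d\<close> over at most \<open>2 ^ d\<close> points, those of its own cell of level
  \<open>d\<close>.\<close>

lemma sum_davg_le:
  assumes A: "A \<subseteq> {..<2 ^ M}"
    and inv: "\<And>X Y. X \<in> A \<Longrightarrow> Y < 2 ^ M \<Longrightarrow> Y div 2 ^ d = X div 2 ^ d \<Longrightarrow> Y \<in> A"
  shows "(\<Sum>X\<in>A. davg M g d X) \<le> (\<Sum>X\<in>A. g X)"
proof -
  have finA: "finite A" using A by (rule finite_subset) simp
  have card_le: "card {X \<in> A. X div 2 ^ d = c} \<le> 2 ^ d" for c
  proof -
    have "{X \<in> A. X div 2 ^ d = c} \<subseteq> {c * 2 ^ d..<c * 2 ^ d + 2 ^ d}"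
    proof
      fix X assume "X \<in> {X \<in> A. X div 2 ^ d = c}"
      then have "X div 2 ^ d = c" by simp
      then show "X \<in> {c * 2 ^ d..<c * 2 ^ d + 2 ^ d}"
        using div_mult_mod_eq[of X "2 ^ d"] mod_less_divisor[of "2 ^ d" X] by (auto simp del: mod_less_divisor)
    qed
    then have "card {X \<in> A. X div 2 ^ d = c} \<le> card {c * 2 ^ d..<c * 2 ^ d + 2 ^ d}"
      by (intro card_mono) auto
    then show ?thesis by simp
  qed
  have "(\<Sum>X\<in>A. davg M g d X) = (\<Sum>X\<in>A. \<Sum>Y\<in>A. if Y div 2 ^ d = X div 2 ^ d then g Y / 2 ^ d else 0)"
  proof (rule sum.cong[OF refl])
    fix X assume "X \<in> A"
    then have "{Y. Y < 2 ^ M \<and> Y div 2 ^ d = X div 2 ^ d} = A \<inter> {Y. Y div 2 ^ d = X div 2 ^ d}"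
      using A inv by auto
    then show "davg M g d X = (\<Sum>Y\<in>A. if Y div 2 ^ d = X div 2 ^ d then g Y / 2 ^ d else 0)"
      using sum.inter_restrict[OF finA, of "\<lambda>Y. g Y / 2 ^ d" "{Y. Y div 2 ^ d = X div 2 ^ d}"]
      by (simp add: davg_def sum_divide_distrib)
  qed
  also have "\<dots> = (\<Sum>Y\<in>A. \<Sum>X\<in>A. if X div 2 ^ d = Y div 2 ^ d then g Y / 2 ^ d else 0)"
    by (subst sum.swap) (simp add: eq_commute)
  also have "\<dots> = (\<Sum>Y\<in>A. real (card {X \<in> A. X div 2 ^ d = Y div 2 ^ d}) * (g Y / 2 ^ d))"
    using finA by (simp flip: sum.inter_filter)
  also have "\<dots> \<le> (\<Sum>Y\<in>A. 2 ^ d * (g Y / 2 ^ d))"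
  proof (intro sum_mono mult_right_mono)
    show "real (card {X \<in> A. X div 2 ^ d = Y div 2 ^ d}) \<le> 2 ^ d" for Y
      using card_le[of "Y div 2 ^ d"] by (metis of_nat_le_iff of_nat_numeral of_nat_power)
  qed (simp add: g)
  finally show ?thesis by simp
qed

section \<open>Stopping levels and the weak type estimate at height \<open>\<alpha>\<close>\<close>

context
  fixes \<alpha> :: real
  assumes \<alpha>: "\<alpha> > 0"
begin

definition large_set :: "nat set" where
  "large_set = {X. X < 2 ^ M \<and> (\<exists>d\<le>M. davg M g d X > \<alpha>)}"

text \<open>Cells grow with the level, so the maximum picks the maximal dyadic cell containing
  \<open>X\<close> on which the average exceeds \<open>\<alpha>\<close>, as in a Calderon-Zygmund
  decomposition.\<close>

definition stop_level :: "nat \<Rightarrow> nat" where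
  "stop_level X = Max {d. d \<le> M \<and> davg M g d X > \<alpha>}"

lemma stop_level:
  assumes "X \<in> large_set"
  shows "stop_level X \<le> M" "davg M g (stop_level X) X > \<alpha>"
proof -
  have "stop_level X \<in> {d. d \<le> M \<and> davg M g d X > \<alpha>}"
    unfolding stop_level_def by (rule Max_in) (use assms in \<open>auto simp: large_set_def\<close>)
  then show "stop_level X \<le> M" "davg M g (stop_level X) X > \<alpha>" by auto
qed

lemma stop_level_ge: "d \<le> M \<Longrightarrow> davg M g d X > \<alpha> \<Longrightarrow> d \<le> stop_level X"
  unfolding stop_level_def by (rule Max_ge) auto

text \<open>Averages at levels \<open>d\<close> and above are constant on cells of level
  \<open>d\<close>, and they alone decide a stopping level that is at least \<open>d\<close>. Hence
  the sets defined by such stopping levels are unions of cells, as \<open>sum_davg_le\<close>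
  requires.\<close>

lemma stop_level_cell:
  assumes X: "X \<in> large_set" and d: "d \<le> stop_level X"
    and Y: "Y < 2 ^ M" "Y div 2 ^ d = X div 2 ^ d"
  shows "Y \<in> large_set" "stop_level Y = stop_level X"
proof -
  have eq: "davg M g e Y = davg M g e X" if "d \<le> e" for e
    using div_power2_mono[OF Y(2) that] by (rule davg_cong)
  have Yt: "davg M g (stop_level X) Y > \<alpha>" using stop_level[OF X] eq[OF d] by simp
  then show YL: "Y \<in> large_set" using stop_level(1)[OF X] Y by (auto simp: large_set_def)
  have 1: "stop_level X \<le> stop_level Y" using stop_level(1)[OF X] Yt by (rule stop_level_ge)
  then have "davg M g (stop_level Y) X > \<alpha>" using stop_level(2)[OF YL] eq d by simp
  with stop_level(1)[OF YL] have "stop_level Y \<le> stop_level X" by (rule stop_level_ge)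
  with 1 show "stop_level Y = stop_level X" by simp
qed

text \<open>The points with stopping level \<open>t\<close> form a union of cells of level
  \<open>t\<close> with averages above \<open>\<alpha>\<close>; summing over \<open>t\<close> gives
  the classical weak type estimate for the dyadic maximal function.\<close>

lemma card_large_set: "\<alpha> * card large_set \<le> (\<Sum>X\<in>large_set. g X)"
proof -
  have fin: "finite large_set" by (rule finite_subset[of _ "{..<2 ^ M}"]) (auto simp: large_set_def)
  have im: "stop_level ` large_set \<subseteq> {..M}" using stop_level(1) by auto
  have "(\<Sum>X\<in>large_set. \<alpha>) = (\<Sum>t\<le>M. \<Sum>X\<in>{X \<in> large_set. stop_level X = t}. \<alpha>)"
    by (rule sum.group[OF fin _ im, symmetric]) simp
  also have "\<dots> \<le> (\<Sum>t\<le>M. \<Sum>X\<in>{X \<in> large_set. stop_level X = t}. davg M g t X)"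
    by (intro sum_mono) (use stop_level(2) in \<open>auto intro: less_imp_le\<close>)
  also have "\<dots> \<le> (\<Sum>t\<le>M. \<Sum>X\<in>{X \<in> large_set. stop_level X = t}. g X)"
  proof (rule sum_mono)
    fix t assume "t \<in> {..M}"
    show "(\<Sum>X\<in>{X \<in> large_set. stop_level X = t}. davg M g t X) \<le> (\<Sum>X\<in>{X \<in> large_set. stop_level X = t}. g X)"
    proof (rule sum_davg_le)
      show "{X \<in> large_set. stop_level X = t} \<subseteq> {..<2 ^ M}" by (auto simp: large_set_def)
      fix X Y assume "X \<in> {X \<in> large_set. stop_level X = t}" "Y < 2 ^ M" "Y div 2 ^ t = X div 2 ^ t"
      then show "Y \<in> {X \<in> large_set. stop_level X = t}"
        using stop_level_cell[of X t Y] by simp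
    qed
  qed
  also have "\<dots> = (\<Sum>X\<in>large_set. g X)"
    by (rule sum.group[OF fin _ im]) simp
  finally show ?thesis by (simp add: mult.commute)
qed

text \<open>
  Flipping digit k of a point outside the large set leaves all averages at levels above k
  unchanged, hence can produce an average above 2 alpha at level d only inside this set.
\<close>
definition late_stop :: "nat \<Rightarrow> nat \<Rightarrow> nat set" where
  "late_stop d k = {Y \<in> large_set. d < stop_level Y \<and> stop_level Y \<le> k}"

text \<open>Summing over all levels \<open>d\<close> gives one function that dominates the excess at
  every level at once, so that a maximum over \<open>d\<close> is replaced by a sum that can be
  estimated in L1 norm.\<close>

definition bad_part :: "nat \<Rightarrow> real" where
  "bad_part X = (\<Sum>d<M. \<Sum>k=d..<M. (if xor X (2 ^ k) \<in> late_stop d k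
    then davg M g d (xor X (2 ^ k)) else 0) / 2 ^ (k + 1 - d))"

text \<open>Of the constant 3, one unit is the average at \<open>X\<close> itself, and two come from
  the translates with averages at most \<open>2 * \<alpha>\<close>, whose weights add up to at most
  1. Any heavier translate lies in \<open>late_stop d k\<close> and is counted in
  \<open>bad_part\<close>.\<close>

lemma shifted_avg_le:
  assumes X: "X < 2 ^ M" "X \<notin> large_set" and d: "d \<le> M"
  shows "shifted_avg M g d X \<le> 3 * \<alpha> + bad_part X"
proof -
  let ?b = "\<lambda>d k. (if xor X (2 ^ k) \<in> late_stop d k then davg M g d (xor X (2 ^ k)) else 0) / 2 ^ (k + 1 - d)"
  have small: "davg M g e X \<le> \<alpha>" if "e \<le> M" for e
    using X that by (auto simp: large_set_def not_less)
  have shifted: "davg M g d (xor X (2 ^ k)) / 2 ^ (k + 1 - d) \<le> 2 * \<alpha> * (1 / 2) ^ (k + 1 - d) + ?b d k"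
    if k: "k \<in> {d..<M}" for k
  proof (cases "davg M g d (xor X (2 ^ k)) \<le> 2 * \<alpha>")
    case True
    have "0 \<le> ?b d k" using davg_nonneg by simp
    moreover have "davg M g d (xor X (2 ^ k)) / 2 ^ (k + 1 - d) \<le> 2 * \<alpha> / 2 ^ (k + 1 - d)"
      by (intro divide_right_mono True) simp
    moreover have "2 * \<alpha> * (1 / 2) ^ (k + 1 - d) = 2 * \<alpha> / 2 ^ (k + 1 - d)"
      by (simp only: power_one_over) simp
    ultimately show ?thesis by linarith
  next
    case False
    let ?Y = "xor X (2 ^ k)"
    have Y: "?Y < 2 ^ M" using X(1) k by (intro xor_less_power2) auto
    \<comment> \<open>Doubling passes from \<open>2 * \<alpha>\<close> at level \<open>d\<close> to
      \<open>\<alpha>\<close> at the next coarser level, so the stopping level is strictly above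
      \<open>d\<close>; strictness keeps the later sum of weights at most 1.\<close>
    have "davg M g (Suc d) ?Y > \<alpha>" using False davg_le_double[of d ?Y] by simp
    moreover have "Suc d \<le> M" using k by simp
    ultimately have YL: "?Y \<in> large_set" and dY: "d < stop_level ?Y"
      using Y stop_level_ge[of "Suc d" ?Y] by (auto simp: large_set_def)
    have "stop_level ?Y \<le> k"
    proof (rule ccontr)
      assume "\<not> stop_level ?Y \<le> k"
      then have "davg M g (stop_level ?Y) ?Y = davg M g (stop_level ?Y) X"
        by (intro davg_cong xor_power2_div) simp
      then show False using stop_level[OF YL] small by fastforce
    qed
    then have "?Y \<in> late_stop d k" using YL dY by (simp add: late_stop_def)
    then show ?thesis using \<alpha> by simp
  qed
  have geo: "(\<Sum>k=d..<M. (1 / 2 :: real) ^ (k + 1 - d)) \<le> 1"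
  proof -
    have "(\<Sum>k=d..<M. (1 / 2 :: real) ^ (k + 1 - d)) = (\<Sum>i<M - d. (1 / 2) ^ Suc i)"
      by (rule sum.reindex_bij_witness[of _ "\<lambda>i. i + d" "\<lambda>k. k - d"]) (auto simp: Suc_diff_le)
    also have "\<dots> \<le> (\<Sum>i. (1 / 2) ^ Suc i)"
      using power_half_series by (intro sum_le_suminf) (auto simp: sums_iff)
    also have "\<dots> = 1" using power_half_series by (simp add: sums_iff)
    finally show ?thesis .
  qed
  have "(\<Sum>k=d..<M. ?b d k) \<le> bad_part X"
  proof (cases "d < M")
    case True
    have "(\<Sum>k=d..<M. ?b d k) = (\<Sum>e\<in>{d}. \<Sum>k=e..<M. ?b e k)" by simp
    also have "\<dots> \<le> (\<Sum>e<M. \<Sum>k=e..<M. ?b e k)"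
      using True davg_nonneg by (intro sum_mono2 sum_nonneg) auto
    finally show ?thesis unfolding bad_part_def .
  next
    case False
    then show ?thesis unfolding bad_part_def
      using davg_nonneg by (auto intro!: sum_nonneg)
  qed
  moreover have "(\<Sum>k=d..<M. davg M g d (xor X (2 ^ k)) / 2 ^ (k + 1 - d)) \<le>
      2 * \<alpha> * (\<Sum>k=d..<M. (1 / 2) ^ (k + 1 - d)) + (\<Sum>k=d..<M. ?b d k)"
    unfolding sum_distrib_left sum.distrib[symmetric] by (rule sum_mono) (rule shifted)
  moreover have "2 * \<alpha> * (\<Sum>k=d..<M. (1 / 2) ^ (k + 1 - d)) \<le> 2 * \<alpha> * 1"
    by (intro mult_left_mono geo) (use \<alpha> in simp)
  ultimately show ?thesis
    unfolding shifted_avg_def using small[OF d] by linarith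
qed

text \<open>Flipping a digit permutes the points, and \<open>late_stop d k\<close> is a union of
  cells of level \<open>d\<close>, so averages can be replaced by \<open>g\<close> itself. A point
  with stopping level \<open>t\<close> then has as total weight the sum of
  \<open>2 ^ d / 2 ^ (k + 1)\<close> over \<open>d < t\<close> and \<open>t \<le> k < M\<close>,
  which is at most \<open>2 ^ t * (1 / 2 ^ t)\<close>.\<close>

lemma sum_bad_part: "(\<Sum>X<2 ^ M. bad_part X) \<le> (\<Sum>X<2 ^ M. g X)"
proof -
  have fin: "finite large_set" by (rule finite_subset[of _ "{..<2 ^ M}"]) (auto simp: large_set_def)
  have sub: "late_stop d k \<subseteq> {..<2 ^ M}" for d k by (auto simp: late_stop_def large_set_def)
  have shift: "(\<Sum>X<2 ^ M. \<phi> (xor X (2 ^ k))) = (\<Sum>X<2 ^ M. \<phi> X)" if "k < M" for \<phi> :: "nat \<Rightarrow> real" and k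
    using that by (intro sum.reindex_bij_witness[of _ "\<lambda>X. xor X (2 ^ k)" "\<lambda>X. xor X (2 ^ k)"])
      (auto simp: xor_less_power2 xor.assoc)
  have "(\<Sum>X<2 ^ M. bad_part X) = (\<Sum>d<M. \<Sum>k=d..<M. (\<Sum>X<2 ^ M. if xor X (2 ^ k) \<in> late_stop d k
    then davg M g d (xor X (2 ^ k)) else 0) / 2 ^ (k + 1 - d))"
    unfolding bad_part_def sum_divide_distrib
    by (subst sum.swap, rule sum.cong[OF refl], rule sum.swap)
  also have "\<dots> = (\<Sum>d<M. \<Sum>k=d..<M. (\<Sum>X\<in>late_stop d k. davg M g d X) / 2 ^ (k + 1 - d))"
  proof (intro sum.cong refl)
    fix d k assume "k \<in> {d..<M}"
    then have "(\<Sum>X<2 ^ M. if xor X (2 ^ k) \<in> late_stop d k then davg M g d (xor X (2 ^ k)) else 0) =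
        (\<Sum>X<2 ^ M. if X \<in> late_stop d k then davg M g d X else 0)"
      by (intro shift) simp
    also have "\<dots> = (\<Sum>X\<in>{..<2 ^ M} \<inter> late_stop d k. davg M g d X)"
      by (rule sum.inter_restrict[symmetric]) simp
    also have "{..<2 ^ M} \<inter> late_stop d k = late_stop d k" using sub by auto
    finally show "(\<Sum>X<2 ^ M. if xor X (2 ^ k) \<in> late_stop d k then davg M g d (xor X (2 ^ k)) else 0) / 2 ^ (k + 1 - d) =
        (\<Sum>X\<in>late_stop d k. davg M g d X) / 2 ^ (k + 1 - d)" by simp
  qed
  also have "\<dots> \<le> (\<Sum>d<M. \<Sum>k=d..<M. (\<Sum>X\<in>late_stop d k. g X) / 2 ^ (k + 1 - d))"
  proof (rule sum_mono, rule sum_mono, rule divide_right_mono)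
    fix d k
    show "(\<Sum>X\<in>late_stop d k. davg M g d X) \<le> (\<Sum>X\<in>late_stop d k. g X)"
    proof (rule sum_davg_le[OF sub])
      fix X Y assume "X \<in> late_stop d k" "Y < 2 ^ M" "Y div 2 ^ d = X div 2 ^ d"
      then show "Y \<in> late_stop d k"
        using stop_level_cell[of X d Y] by (simp add: late_stop_def)
    qed
  qed simp
  also have "\<dots> = (\<Sum>d<M. \<Sum>k=d..<M. \<Sum>X\<in>large_set. g X * (if d < stop_level X \<and> stop_level X \<le> k then 1 / 2 ^ (k + 1 - d) else 0))"
  proof (intro sum.cong refl)
    fix d k
    have "(\<Sum>X\<in>late_stop d k. g X) / 2 ^ (k + 1 - d) =
        (\<Sum>X\<in>large_set. if d < stop_level X \<and> stop_level X \<le> k then g X / 2 ^ (k + 1 - d) else 0)"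
      unfolding late_stop_def sum_divide_distrib by (rule sum.inter_filter[OF fin])
    also have "\<dots> = (\<Sum>X\<in>large_set. g X * (if d < stop_level X \<and> stop_level X \<le> k then 1 / 2 ^ (k + 1 - d) else 0))"
      by (intro sum.cong refl) simp
    finally show "(\<Sum>X\<in>late_stop d k. g X) / 2 ^ (k + 1 - d) =
        (\<Sum>X\<in>large_set. g X * (if d < stop_level X \<and> stop_level X \<le> k then 1 / 2 ^ (k + 1 - d) else 0))" .
  qed
  also have "\<dots> = (\<Sum>X\<in>large_set. g X * (\<Sum>d<M. \<Sum>k=d..<M. if d < stop_level X \<and> stop_level X \<le> k then 1 / 2 ^ (k + 1 - d) else 0))"
    unfolding sum_distrib_left
    by (rule trans[OF sum.cong[OF refl sum.swap] sum.swap])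
  also have "\<dots> \<le> (\<Sum>X\<in>large_set. g X * 1)"
  proof (intro sum_mono mult_left_mono g)
    fix X assume X: "X \<in> large_set"
    define t where "t = stop_level X"
    have tM: "t \<le> M" unfolding t_def by (rule stop_level(1)[OF X])
    have "(\<Sum>d<M. \<Sum>k=d..<M. if d < t \<and> t \<le> k then 1 / 2 ^ (k + 1 - d) else 0 :: real) =
        (\<Sum>d<M. if d < t then 2 ^ d * (\<Sum>k=t..<M. 1 / 2 ^ (k + 1)) else 0)"
    proof (intro sum.cong refl)
      fix d assume "d \<in> {..<M}"
      show "(\<Sum>k=d..<M. if d < t \<and> t \<le> k then 1 / 2 ^ (k + 1 - d) else 0 :: real) =
          (if d < t then 2 ^ d * (\<Sum>k=t..<M. 1 / 2 ^ (k + 1)) else 0)"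
      proof (cases "d < t")
        case True
        have "(\<Sum>k=d..<M. if d < t \<and> t \<le> k then 1 / 2 ^ (k + 1 - d) else 0 :: real) =
          (\<Sum>k=t..<M. 1 / 2 ^ (k + 1 - d))"
          using True by (intro sum.mono_neutral_cong_right) auto
        also have "\<dots> = (\<Sum>k=t..<M. 2 ^ d * (1 / 2 ^ (k + 1)))"
          using True by (intro sum.cong refl) (simp add: power_diff)
        finally show ?thesis using True by (simp add: sum_distrib_left)
      qed simp
    qed
    also have "\<dots> = (\<Sum>d<t. 2 ^ d * (\<Sum>k=t..<M. 1 / 2 ^ (k + 1)))"
      using tM by (intro sum.mono_neutral_cong_right) auto
    also have "\<dots> = (\<Sum>d<t. 2 ^ d) * (\<Sum>k=t..<M. 1 / 2 ^ (k + 1) :: real)"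
      by (rule sum_distrib_right[symmetric])
    also have "(\<Sum>k=t..<M. 1 / 2 ^ (k + 1) :: real) = 1 / 2 ^ t - 1 / 2 ^ M"
      using tM
    proof (induction M rule: dec_induct)
      case (step n)
      have "1 / 2 ^ n = 2 * (1 / 2 ^ (n + 1) :: real)" by simp
      with step show ?case by (simp del: power_Suc)
    qed simp
    also have "(\<Sum>d<t. 2 ^ d) = (2 ^ t - 1 :: real)"
      by (induction t) auto
    also have "(2 ^ t - 1) * (1 / 2 ^ t - 1 / 2 ^ M) \<le> (2 ^ t :: real) * (1 / 2 ^ t)"
      using tM by (intro mult_mono) (auto simp: field_simps)
    finally show "(\<Sum>d<M. \<Sum>k=d..<M. if d < stop_level X \<and> stop_level X \<le> k then 1 / 2 ^ (k + 1 - d) else 0) \<le> (1 :: real)"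
      by (simp add: t_def)
  qed
  also have "\<dots> \<le> (\<Sum>X<2 ^ M. g X)"
    using g by (simp, intro sum_mono2) (auto simp: large_set_def)
  finally show ?thesis .
qed

lemma bad_part_nonneg: "0 \<le> bad_part X"
  unfolding bad_part_def by (intro sum_nonneg divide_nonneg_nonneg) (auto simp: davg_nonneg)

text \<open>An excess over \<open>4 * \<alpha>\<close> means that the point is in
  \<open>large_set\<close> or that \<open>bad_part\<close> exceeds \<open>\<alpha>\<close>; each of
  the two alternatives costs one sum of \<open>g\<close>.\<close>

theorem weak_type_shifted_avg:
  "\<alpha> * card {X. X < 2 ^ M \<and> (\<exists>d\<le>M. shifted_avg M g d X > 4 * \<alpha>)} \<le> 2 * (\<Sum>X<2 ^ M. g X)"
proof -
  define B where "B = {X. X < 2 ^ M \<and> bad_part X > \<alpha>}"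
  have fin: "finite large_set" "finite B"
    by (rule finite_subset[of _ "{..<2 ^ M}"]; auto simp: large_set_def B_def)+
  have "{X. X < 2 ^ M \<and> (\<exists>d\<le>M. shifted_avg M g d X > 4 * \<alpha>)} \<subseteq> large_set \<union> B"
    using shifted_avg_le by (fastforce simp: B_def)
  then have "card {X. X < 2 ^ M \<and> (\<exists>d\<le>M. shifted_avg M g d X > 4 * \<alpha>)} \<le> card (large_set \<union> B)"
    using fin by (intro card_mono) auto
  also have "\<dots> \<le> card large_set + card B" by (rule card_Un_le)
  finally have "\<alpha> * card {X. X < 2 ^ M \<and> (\<exists>d\<le>M. shifted_avg M g d X > 4 * \<alpha>)} \<le> \<alpha> * (card large_set + card B)"
    using \<alpha> by (intro mult_left_mono) auto
  moreover have "\<alpha> * card large_set \<le> (\<Sum>X<2 ^ M. g X)"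
    using card_large_set sum_mono2[of "{..<2 ^ M}" large_set g] g by (force simp: large_set_def)
  moreover have "\<alpha> * card B \<le> (\<Sum>X<2 ^ M. g X)"
  proof -
    have "\<alpha> * card B = (\<Sum>X\<in>B. \<alpha>)" by simp
    also have "\<dots> \<le> (\<Sum>X\<in>B. bad_part X)" by (intro sum_mono) (auto simp: B_def)
    also have "\<dots> \<le> (\<Sum>X<2 ^ M. bad_part X)"
      by (intro sum_mono2) (auto simp: B_def bad_part_nonneg)
    also note sum_bad_part
    finally show ?thesis .
  qed
  ultimately show ?thesis by (simp add: distrib_left)
qed

end

end

subsection \<open>The Fejer kernel\<close>

definition fejer_kernel :: "nat \<Rightarrow> real \<Rightarrow> real \<Rightarrow> real" where
  "fejer_kernel n x y = (\<Sum>k<n. \<Sum>i<k. walsh i x * walsh i y)"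

text \<open>This is the Dirichlet kernel of order \<open>2 ^ a\<close> without the factor of digit
  \<open>j\<close>. For \<open>j < a\<close>, as a function of \<open>y\<close> on the unit
  interval, it lives on the dyadic interval of rank \<open>a\<close> around \<open>x\<close> and on
  the translate of that interval in digit \<open>j\<close>.\<close>

definition omit_kernel :: "nat \<Rightarrow> nat \<Rightarrow> real \<Rightarrow> real \<Rightarrow> real" where
  "omit_kernel a j x y = (\<Prod>i\<in>{..<a} - {j}. 1 + rademacher i x * rademacher i y)"

lemma sum_lessThan_add: "(\<Sum>i<m + k. f i) = (\<Sum>i<m. f i) + (\<Sum>i<k. f (m + i))"
  for f :: "nat \<Rightarrow> real"
  by (induction k) auto

lemma dirichlet_add:
  assumes "k \<le> 2 ^ t"
  shows "(\<Sum>i<2 ^ t + k. walsh i x * walsh i y) =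
    (\<Sum>i<2 ^ t. walsh i x * walsh i y) + rademacher t x * rademacher t y * (\<Sum>i<k. walsh i x * walsh i y)"
proof -
  have "(\<Sum>i<k. walsh (2 ^ t + i) x * walsh (2 ^ t + i) y) =
      (\<Sum>i<k. rademacher t x * rademacher t y * (walsh i x * walsh i y))"
    using assms by (intro sum.cong refl) (simp add: walsh_power2_add)
  then show ?thesis by (simp add: sum_lessThan_add sum_distrib_left)
qed

lemma dirichlet_power2:
  "(\<Sum>i<2 ^ t. walsh i x * walsh i y) = (\<Prod>i<t. 1 + rademacher i x * rademacher i y)"
proof (induction t)
  case (Suc t)
  have "(\<Sum>i<2 ^ Suc t. walsh i x * walsh i y) = (\<Sum>i<2 ^ t + 2 ^ t. walsh i x * walsh i y)"
    by (simp add: mult_2)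
  then show ?case using Suc by (subst (asm) dirichlet_add) (auto simp: algebra_simps)
qed simp

lemma fejer_kernel_add:
  assumes "k \<le> 2 ^ t"
  shows "fejer_kernel (2 ^ t + k) x y = fejer_kernel (2 ^ t) x y +
    k * (\<Prod>i<t. 1 + rademacher i x * rademacher i y) + rademacher t x * rademacher t y * fejer_kernel k x y"
proof -
  have "(\<Sum>j<k. \<Sum>i<2 ^ t + j. walsh i x * walsh i y) =
    (\<Sum>j<k. (\<Prod>i<t. 1 + rademacher i x * rademacher i y) +
      rademacher t x * rademacher t y * (\<Sum>i<j. walsh i x * walsh i y))"
    using assms by (intro sum.cong refl) (simp add: dirichlet_add dirichlet_power2)
  then show ?thesis
    by (simp add: fejer_kernel_def sum_lessThan_add sum.distrib sum_distrib_left)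
qed

text \<open>Passing from \<open>t\<close> to \<open>t + 1\<close> multiplies the old kernel by the
  factor of digit \<open>t\<close>, which every \<open>omit_kernel\<close> with \<open>j < t\<close>
  acquires as well; the new Dirichlet term is the one with \<open>j = t\<close>.\<close>

lemma fejer_kernel_power2: "fejer_kernel (2 ^ t) x y = (\<Sum>j<t. 2 ^ j * omit_kernel t j x y)"
proof (induction t)
  case 0
  show ?case by (simp add: fejer_kernel_def)
next
  case (Suc t)
  let ?e = "rademacher t x * rademacher t y"
  have o: "omit_kernel (Suc t) j x y = (1 + ?e) * omit_kernel t j x y" if "j < t" for j
  proof -
    have "{..<Suc t} - {j} = insert t ({..<t} - {j})" using that by auto
    then show ?thesis by (simp add: omit_kernel_def)
  qed
  have o': "omit_kernel (Suc t) t x y = (\<Prod>i<t. 1 + rademacher i x * rademacher i y)"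
    unfolding omit_kernel_def by (rule prod.cong) auto
  have "fejer_kernel (2 ^ Suc t) x y = fejer_kernel (2 ^ t + 2 ^ t) x y" by (simp add: mult_2)
  also have "\<dots> = (1 + ?e) * fejer_kernel (2 ^ t) x y + 2 ^ t * omit_kernel (Suc t) t x y"
    by (subst fejer_kernel_add) (auto simp: o' algebra_simps)
  also have "(1 + ?e) * fejer_kernel (2 ^ t) x y = (\<Sum>j<t. 2 ^ j * omit_kernel (Suc t) j x y)"
    unfolding Suc.IH sum_distrib_left by (intro sum.cong refl) (simp add: o algebra_simps)
  finally show ?case by simp
qed

lemma sign_factor: "1 + rademacher i x * rademacher i y = (if rademacher i x = rademacher i y then 2 else 0)"
  using rademacher_cases[of i x] rademacher_cases[of i y] by auto

lemma omit_kernel_nonneg: "0 \<le> omit_kernel a j x y"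
  unfolding omit_kernel_def by (intro prod_nonneg) (simp add: sign_factor)

lemma bit_power2_add:
  fixes k :: nat
  assumes "k < 2 ^ t" "a \<le> t"
  shows "bit (2 ^ t + k) a \<longleftrightarrow> a = t \<or> bit k a"
proof -
  have "\<not> bit k t" using assms(1) by (metis bit_take_bit_iff less_irrefl take_bit_nat_eq_self)
  then show ?thesis
    by (auto simp: bit_xor_iff bit_exp_iff simp flip: xor_power2_eq_add[OF assms(1)])
qed

text \<open>For \<open>n = 2 ^ t + k\<close> the remainder \<open>fejer_kernel k\<close> is
  multiplied by a sign only, and the Dirichlet term has weight \<open>k < 2 ^ t\<close>. So each
  binary digit \<open>a\<close> of \<open>n\<close> is charged once with terms of order
  \<open>2 ^ a\<close>, and the charges add up to the order of \<open>n\<close>.\<close>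

lemma abs_fejer_kernel_le:
  assumes "n < 2 ^ t"
  shows "\<bar>fejer_kernel n x y\<bar> \<le> (\<Sum>a<t. if bit n a then
    2 ^ a * (\<Prod>i<a. 1 + rademacher i x * rademacher i y) + fejer_kernel (2 ^ a) x y else 0)"
  using assms
proof (induction t arbitrary: n)
  case 0
  then show ?case by (simp add: fejer_kernel_def)
next
  case (Suc t)
  let ?P = "\<lambda>a. \<Prod>i<a. 1 + rademacher i x * rademacher i y"
  show ?case
  proof (cases "n < 2 ^ t")
    case True
    then have "\<not> bit n t" by (metis bit_take_bit_iff less_irrefl take_bit_nat_eq_self)
    then show ?thesis using Suc.IH[OF True] by simp
  next
    case False
    define k where "k = n - 2 ^ t"
    have k: "k < 2 ^ t" "n = 2 ^ t + k" using False Suc.prems by (auto simp: k_def)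
    have b: "bit n a \<longleftrightarrow> bit k a" if "a < t" for a
      using bit_power2_add[OF k(1), of a] that k(2) by simp
    have bt: "bit n t" using bit_power2_add[OF k(1), of t] k(2) by simp
    have P: "0 \<le> ?P t" by (intro prod_nonneg) (simp add: sign_factor)
    have K: "0 \<le> fejer_kernel (2 ^ t) x y"
      unfolding fejer_kernel_power2 by (intro sum_nonneg mult_nonneg_nonneg omit_kernel_nonneg) auto
    have "\<bar>fejer_kernel n x y\<bar> \<le> fejer_kernel (2 ^ t) x y + k * ?P t + \<bar>fejer_kernel k x y\<bar>"
    proof -
      have "\<bar>fejer_kernel n x y\<bar> \<le> \<bar>fejer_kernel (2 ^ t) x y + k * ?P t\<bar> +
          \<bar>rademacher t x * rademacher t y * fejer_kernel k x y\<bar>"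
        unfolding k(2) using k(1) by (subst fejer_kernel_add) auto
      also have "\<bar>rademacher t x * rademacher t y * fejer_kernel k x y\<bar> = \<bar>fejer_kernel k x y\<bar>"
        by (simp add: abs_mult)
      finally show ?thesis using P K by simp
    qed
    also have "real k * ?P t \<le> 2 ^ t * ?P t"
      using k(1) P by (intro mult_right_mono) (metis less_imp_le of_nat_le_iff of_nat_numeral of_nat_power)+
    also have "\<bar>fejer_kernel k x y\<bar> \<le> (\<Sum>a<t. if bit k a then 2 ^ a * ?P a + fejer_kernel (2 ^ a) x y else 0)"
      by (rule Suc.IH[OF k(1)])
    also have "\<dots> = (\<Sum>a<t. if bit n a then 2 ^ a * ?P a + fejer_kernel (2 ^ a) x y else 0)"
      by (intro sum.cong refl) (simp add: b)
    finally show ?thesis using bt by simp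
  qed
qed

lemma sum_bits:
  fixes n :: nat
  assumes "n < 2 ^ t"
  shows "(\<Sum>a<t. if bit n a then 2 ^ a else 0) = n"
  using assms
proof (induction t arbitrary: n)
  case (Suc t)
  show ?case
  proof (cases "n < 2 ^ t")
    case True
    then have "\<not> bit n t" by (metis bit_take_bit_iff less_irrefl take_bit_nat_eq_self)
    then show ?thesis using Suc.IH[OF True] by simp
  next
    case False
    define k where "k = n - 2 ^ t"
    have k: "k < 2 ^ t" "n = 2 ^ t + k" using False Suc.prems by (auto simp: k_def)
    have "(\<Sum>a<t. if bit n a then 2 ^ a else 0) = (\<Sum>a<t. if bit k a then 2 ^ a else (0 :: nat))"
      using bit_power2_add[OF k(1)] k(2) by (intro sum.cong refl) auto
    then show ?thesis using Suc.IH[OF k(1)] bit_power2_add[OF k(1), of t] k(2) by simp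
  qed
qed simp

subsection \<open>Weak type estimate for the Fejer means\<close>

lemma rademacher_bit:
  assumes "i < M"
  shows "rademacher i x = (if bit (dyadic_index M x) (M - 1 - i) then -1 else 1)"
  by (simp add: rademacher_dyadic_index[OF assms] bit_iff_odd)

lemma not_bit_of_less:
  fixes X :: nat
  assumes "X < 2 ^ M" "M \<le> p"
  shows "\<not> bit X p"
  using assms by (metis bit_take_bit_iff not_less take_bit_nat_eq_self)

lemma div_power2_eq_iff:
  fixes X Y :: nat
  assumes "X < 2 ^ M" "Y < 2 ^ M" "a \<le> M"
  shows "Y div 2 ^ (M - a) = X div 2 ^ (M - a) \<longleftrightarrow> (\<forall>i<a. bit X (M - 1 - i) = bit Y (M - 1 - i))"
proof
  assume eq: "Y div 2 ^ (M - a) = X div 2 ^ (M - a)"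
  show "\<forall>i<a. bit X (M - 1 - i) = bit Y (M - 1 - i)"
  proof (intro allI impI)
    fix i assume i: "i < a"
    have "bit Z (M - 1 - i) = bit (drop_bit (M - a) Z) (a - 1 - i)" for Z :: nat
      using i assms(3) by (simp add: bit_drop_bit_eq)
    then show "bit X (M - 1 - i) = bit Y (M - 1 - i)"
      using eq by (simp add: drop_bit_eq_div)
  qed
next
  assume b: "\<forall>i<a. bit X (M - 1 - i) = bit Y (M - 1 - i)"
  have "drop_bit (M - a) Y = drop_bit (M - a) X"
  proof (rule bit_eqI)
    fix n
    show "bit (drop_bit (M - a) Y) n \<longleftrightarrow> bit (drop_bit (M - a) X) n"
    proof (cases "M - a + n < M")
      case True
      then have "M - a + n = M - 1 - (M - 1 - (M - a + n))" "M - 1 - (M - a + n) < a"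
        using assms(3) by auto
      then have "bit X (M - a + n) = bit Y (M - a + n)" using b by metis
      then show ?thesis by (simp add: bit_drop_bit_eq)
    next
      case False
      then show ?thesis using not_bit_of_less[OF assms(1)] not_bit_of_less[OF assms(2)]
        by (simp add: bit_drop_bit_eq)
    qed
  qed
  then show "Y div 2 ^ (M - a) = X div 2 ^ (M - a)" by (simp add: drop_bit_eq_div)
qed

context
  fixes x y :: real and M X Y :: nat
  assumes X: "X = dyadic_index M x" "X < 2 ^ M" and Y: "Y = dyadic_index M y" "Y < 2 ^ M"
begin

lemma rademacher_eq_iff: "i < M \<Longrightarrow> rademacher i x = rademacher i y \<longleftrightarrow> bit X (M - 1 - i) = bit Y (M - 1 - i)"
  by (auto simp: rademacher_bit[of i M] X(1) Y(1))

lemma prod_sign_factor: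
  assumes a: "a \<le> M"
  shows "(\<Prod>i<a. 1 + rademacher i x * rademacher i y) =
    (if Y div 2 ^ (M - a) = X div 2 ^ (M - a) then 2 ^ a else 0)"
proof (cases "\<forall>i<a. rademacher i x = rademacher i y")
  case True
  then show ?thesis
    using a by (simp add: sign_factor div_power2_eq_iff[OF X(2) Y(2) a] rademacher_eq_iff)
next
  case False
  then show ?thesis
    using a unfolding sign_factor div_power2_eq_iff[OF X(2) Y(2) a]
    by (auto simp: rademacher_eq_iff prod_zero_iff)
qed

text \<open>There are \<open>a - 1\<close> factors left, each at most 2, so twice the kernel is at
  most \<open>2 ^ a\<close>. Agreement in all digits but \<open>j\<close> places \<open>Y\<close> in
  one of the two cells.\<close>

lemma omit_kernel_le:
  assumes a: "a \<le> M" and j: "j < a"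
  shows "2 * omit_kernel a j x y \<le> (if Y div 2 ^ (M - a) = X div 2 ^ (M - a) then 2 ^ a else 0) +
    (if Y div 2 ^ (M - a) = xor X (2 ^ (M - 1 - j)) div 2 ^ (M - a) then 2 ^ a else 0)"
proof (cases "\<forall>i\<in>{..<a} - {j}. rademacher i x = rademacher i y")
  case True
  let ?X = "xor X (2 ^ (M - 1 - j))"
  have X': "?X < 2 ^ M" using X(2) a j by (intro xor_less_power2) auto
  have bX: "bit ?X (M - 1 - i) \<longleftrightarrow> (if i = j then \<not> bit X (M - 1 - i) else bit X (M - 1 - i))" if "i < a" for i
    using that a j by (auto simp: bit_xor_iff bit_exp_iff)
  have e: "bit X (M - 1 - i) = bit Y (M - 1 - i)" if "i < a" "i \<noteq> j" for i
    using True that a by (simp add: rademacher_eq_iff)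
  have "Y div 2 ^ (M - a) = X div 2 ^ (M - a) \<or> Y div 2 ^ (M - a) = ?X div 2 ^ (M - a)"
  proof (cases "bit X (M - 1 - j) = bit Y (M - 1 - j)")
    case True
    then show ?thesis unfolding div_power2_eq_iff[OF X(2) Y(2) a] using e by metis
  next
    case False
    then show ?thesis unfolding div_power2_eq_iff[OF X' Y(2) a] using e bX by metis
  qed
  moreover have "omit_kernel a j x y \<le> (\<Prod>i\<in>{..<a} - {j}. 2)"
    unfolding omit_kernel_def by (intro prod_mono) (simp add: sign_factor)
  moreover have "(\<Prod>i\<in>{..<a} - {j}. 2 :: real) = 2 ^ (a - 1)"
    using j by simp
  moreover have "(2 :: real) ^ a = 2 * 2 ^ (a - 1)"
    using j by (simp flip: power_Suc)
  ultimately have le: "2 * omit_kernel a j x y \<le> 2 ^ a"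
    and cases: "Y div 2 ^ (M - a) = X div 2 ^ (M - a) \<or> Y div 2 ^ (M - a) = ?X div 2 ^ (M - a)"
    by auto
  have nonneg: "0 \<le> (if P then 2 ^ a else 0 :: real)" for P by simp
  from cases show ?thesis
  proof
    assume "Y div 2 ^ (M - a) = X div 2 ^ (M - a)"
    then show ?thesis using add_mono[OF le nonneg] by simp
  next
    assume "Y div 2 ^ (M - a) = ?X div 2 ^ (M - a)"
    then show ?thesis using add_mono[OF nonneg le] by simp
  qed
next
  case False
  then have "omit_kernel a j x y = 0"
    unfolding omit_kernel_def sign_factor by (auto simp: prod_zero_iff)
  then show ?thesis by simp
qed

end

lemma sum_walsh_partial_sum_eq:
  assumes f: "set_integrable lebesgue {0..<1} f" and n: "n \<le> 2 ^ M"
  shows "(\<Sum>k<n. walsh_partial_sum f k x) =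
    (\<Sum>Y<2 ^ M. (LINT x:dyadic_cell M Y|lebesgue. f x) * fejer_kernel n x (real Y / 2 ^ M))"
proof -
  let ?F = "\<lambda>Y. LINT x:dyadic_cell M Y|lebesgue. f x"
  have "walsh_partial_sum f k x = (\<Sum>Y<2 ^ M. ?F Y * (\<Sum>i<k. walsh i x * walsh i (real Y / 2 ^ M)))"
    if "k < n" for k
  proof -
    have "walsh_partial_sum f k x = (\<Sum>i<k. (\<Sum>Y<2 ^ M. walsh i (real Y / 2 ^ M) * ?F Y) * walsh i x)"
      unfolding walsh_partial_sum_def using that n by (intro sum.cong refl) (subst walsh_coeff_dyadic[OF f], auto)
    also have "\<dots> = (\<Sum>Y<2 ^ M. ?F Y * (\<Sum>i<k. walsh i x * walsh i (real Y / 2 ^ M)))"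
      unfolding sum_distrib_left sum_distrib_right by (subst sum.swap) (simp add: mult_ac)
    finally show ?thesis .
  qed
  then have "(\<Sum>k<n. walsh_partial_sum f k x) =
      (\<Sum>k<n. \<Sum>Y<2 ^ M. ?F Y * (\<Sum>i<k. walsh i x * walsh i (real Y / 2 ^ M)))"
    by simp
  also have "\<dots> = (\<Sum>Y<2 ^ M. ?F Y * fejer_kernel n x (real Y / 2 ^ M))"
    unfolding fejer_kernel_def sum_distrib_left by (rule sum.swap)
  finally show ?thesis .
qed

definition cell_mass :: "(real \<Rightarrow> real) \<Rightarrow> nat \<Rightarrow> nat \<Rightarrow> real" where
  "cell_mass f M Y = (LINT x:dyadic_cell M Y|lebesgue. \<bar>f x\<bar>)"

lemma cell_mass_nonneg: "0 \<le> cell_mass f M Y"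
  unfolding cell_mass_def set_lebesgue_integral_def by (intro integral_nonneg_AE) auto

lemma sum_cell_mass:
  assumes "set_integrable lebesgue {0..<1} f"
  shows "(\<Sum>Y<2 ^ M. cell_mass f M Y) = (LINT x:{0..<1}|lebesgue. \<bar>f x\<bar>)"
  using set_integral_mult_dyadic[OF set_integrable_abs[OF assms], of "\<lambda>_. 1" M]
  by (simp add: cell_mass_def)

text \<open>For each digit \<open>a\<close> of \<open>n\<close>, the Dirichlet part and the Fejer
  part are both at most \<open>2 ^ a * 2 ^ M\<close> times the shifted average at level
  \<open>M - a\<close>. The factor \<open>2 ^ M\<close> converts cell masses into averages of the
  function.\<close>

lemma abs_sum_walsh_partial_sum_le:
  assumes f: "set_integrable lebesgue {0..<1} f" and n: "n < 2 ^ M" and x: "x < 1"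
  shows "\<bar>\<Sum>k<n. walsh_partial_sum f k x\<bar> \<le>
    2 * 2 ^ M * (\<Sum>a<M. if bit n a then 2 ^ a * shifted_avg M (cell_mass f M) (M - a) (dyadic_index M x) else 0)"
proof -
  define X where "X = dyadic_index M x"
  have X: "X < 2 ^ M" unfolding X_def by (rule dyadic_index_less[OF x])
  let ?g = "cell_mass f M"
  let ?y = "\<lambda>Y. real Y / 2 ^ M"
  let ?P = "\<lambda>a Y. \<Prod>i<a. 1 + rademacher i x * rademacher i (?y Y)"
  have g: "0 \<le> ?g Y" for Y by (rule cell_mass_nonneg)
  have Fg: "\<bar>LINT x:dyadic_cell M Y|lebesgue. f x\<bar> \<le> ?g Y" for Y
    unfolding cell_mass_def set_lebesgue_integral_def
    using integral_abs_bound[of lebesgue "\<lambda>x. indicator (dyadic_cell M Y) x *\<^sub>R f x"]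
    by (simp add: abs_mult)
  have cell: "(\<Sum>Y<2 ^ M. ?g Y * (if Y div 2 ^ d = Z div 2 ^ d then c else 0)) = c * 2 ^ d * davg M ?g d Z" for c d Z
  proof -
    have "(\<Sum>Y<2 ^ M. ?g Y * (if Y div 2 ^ d = Z div 2 ^ d then c else 0)) =
        (\<Sum>Y<2 ^ M. if Y div 2 ^ d = Z div 2 ^ d then c * ?g Y else 0)"
      by (intro sum.cong refl) simp
    also have "\<dots> = (\<Sum>Y\<in>{Y\<in>{..<2 ^ M}. Y div 2 ^ d = Z div 2 ^ d}. c * ?g Y)"
      by (rule sum.inter_filter[symmetric]) simp
    also have "\<dots> = c * 2 ^ d * davg M ?g d Z"
      by (simp add: davg_def flip: sum_distrib_left)
    finally show ?thesis .
  qed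
  have P: "(\<Sum>Y<2 ^ M. ?g Y * ?P a Y) = 2 ^ M * davg M ?g (M - a) X" if "a \<le> M" for a
  proof -
    have "(\<Sum>Y<2 ^ M. ?g Y * ?P a Y) = (\<Sum>Y<2 ^ M. ?g Y * (if Y div 2 ^ (M - a) = X div 2 ^ (M - a) then 2 ^ a else 0))"
      using prod_sign_factor[OF X_def X, of _ "?y _"] that by (intro sum.cong refl) simp
    also have "\<dots> = 2 ^ M * davg M ?g (M - a) X"
      unfolding cell using that by (simp flip: power_add)
    finally show ?thesis .
  qed
  have K: "2 * (\<Sum>Y<2 ^ M. ?g Y * fejer_kernel (2 ^ a) x (?y Y)) \<le>
      2 * 2 ^ M * 2 ^ a * shifted_avg M ?g (M - a) X" if a: "a \<le> M" for a
  proof -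
    let ?d = "M - a"
    have "2 * (\<Sum>Y<2 ^ M. ?g Y * fejer_kernel (2 ^ a) x (?y Y)) =
        (\<Sum>j<a. 2 ^ j * (\<Sum>Y<2 ^ M. ?g Y * (2 * omit_kernel a j x (?y Y))))"
      unfolding fejer_kernel_power2 sum_distrib_left
      by (subst sum.swap) (simp add: mult_ac)
    also have "\<dots> \<le> (\<Sum>j<a. 2 ^ j * (\<Sum>Y<2 ^ M. ?g Y * (
        (if Y div 2 ^ ?d = X div 2 ^ ?d then 2 ^ a else 0) +
        (if Y div 2 ^ ?d = xor X (2 ^ (M - 1 - j)) div 2 ^ ?d then 2 ^ a else 0))))"
      by (intro sum_mono mult_left_mono omit_kernel_le[OF X_def X _ _ a] g) auto
    also have "\<dots> = (\<Sum>j<a. 2 ^ j * (2 ^ M * davg M ?g ?d X + 2 ^ M * davg M ?g ?d (xor X (2 ^ (M - 1 - j)))))"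
      unfolding distrib_left sum.distrib cell using a by (simp flip: power_add)
    also have "\<dots> = 2 ^ M * (davg M ?g ?d X * (\<Sum>j<a. 2 ^ j) + (\<Sum>j<a. 2 ^ j * davg M ?g ?d (xor X (2 ^ (M - 1 - j)))))"
      unfolding distrib_left sum.distrib sum_distrib_left by (simp add: mult_ac)
    also have "(\<Sum>j<a. 2 ^ j * davg M ?g ?d (xor X (2 ^ (M - 1 - j)))) =
        2 ^ a * (\<Sum>k=?d..<M. davg M ?g ?d (xor X (2 ^ k)) / 2 ^ (k + 1 - ?d))"
      unfolding sum_distrib_left
    proof (rule sum.reindex_bij_witness[of _ "\<lambda>k. M - 1 - k" "\<lambda>j. M - 1 - j"])
      fix j assume "j \<in> {..<a}"
      then have j: "j < a" by simp
      then have "M - 1 - j + 1 - ?d = a - j" using a by simp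
      moreover have "(2 :: real) ^ a = 2 ^ j * 2 ^ (a - j)" using j by (simp flip: power_add)
      ultimately show "2 ^ a * (davg M ?g ?d (xor X (2 ^ (M - 1 - j))) / 2 ^ (M - 1 - j + 1 - ?d)) =
          2 ^ j * davg M ?g ?d (xor X (2 ^ (M - 1 - j)))" by simp
    qed (use a in auto)
    also have "davg M ?g ?d X * (\<Sum>j<a. 2 ^ j) \<le> davg M ?g ?d X * 2 ^ a"
    proof (intro mult_left_mono davg_nonneg g)
      show "(\<Sum>j<a. 2 ^ j) \<le> (2 ^ a :: real)" by (induction a) auto
    qed
    finally have "2 * (\<Sum>Y<2 ^ M. ?g Y * fejer_kernel (2 ^ a) x (?y Y)) \<le> 2 ^ M * 2 ^ a * shifted_avg M ?g ?d X"
      by (simp add: shifted_avg_def algebra_simps)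
    also have "\<dots> \<le> 2 * (2 ^ M * 2 ^ a * shifted_avg M ?g ?d X)"
      unfolding shifted_avg_def using davg_nonneg[of ?g M, OF g]
      by (auto intro!: mult_nonneg_nonneg add_nonneg_nonneg sum_nonneg)
    finally show ?thesis by simp
  qed
  have "\<bar>\<Sum>k<n. walsh_partial_sum f k x\<bar> \<le> (\<Sum>Y<2 ^ M. ?g Y * \<bar>fejer_kernel n x (?y Y)\<bar>)"
    unfolding sum_walsh_partial_sum_eq[OF f less_imp_le[OF n]]
    by (intro order_trans[OF sum_abs] sum_mono) (auto simp: abs_mult intro!: mult_right_mono Fg)
  also have "\<dots> \<le> (\<Sum>Y<2 ^ M. ?g Y * (\<Sum>a<M. if bit n a then 2 ^ a * ?P a Y + fejer_kernel (2 ^ a) x (?y Y) else 0))"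
    by (intro sum_mono mult_left_mono abs_fejer_kernel_le n g)
  also have "\<dots> = (\<Sum>a<M. if bit n a then 2 ^ a * (\<Sum>Y<2 ^ M. ?g Y * ?P a Y) + (\<Sum>Y<2 ^ M. ?g Y * fejer_kernel (2 ^ a) x (?y Y)) else 0)"
    unfolding sum_distrib_left
    by (subst sum.swap) (intro sum.cong refl, auto simp: sum.distrib distrib_left mult_ac)
  also have "\<dots> \<le> (\<Sum>a<M. 2 * 2 ^ M * (if bit n a then 2 ^ a * shifted_avg M ?g (M - a) X else 0))"
  proof (rule sum_mono)
    fix a assume "a \<in> {..<M}"
    then have a: "a \<le> M" by simp
    have "davg M ?g (M - a) X \<le> shifted_avg M ?g (M - a) X"
      unfolding shifted_avg_def using davg_nonneg[of ?g M, OF g] by (auto intro!: sum_nonneg)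
    then have p: "2 ^ a * (\<Sum>Y<2 ^ M. ?g Y * ?P a Y) \<le> 2 ^ a * (2 ^ M * shifted_avg M ?g (M - a) X)"
      unfolding P[OF a] by (intro mult_left_mono) auto
    have k: "(\<Sum>Y<2 ^ M. ?g Y * fejer_kernel (2 ^ a) x (?y Y)) \<le> 2 ^ a * (2 ^ M * shifted_avg M ?g (M - a) X)"
      using K[OF a] by (simp add: mult_ac)
    have eq: "2 * 2 ^ M * (2 ^ a * shifted_avg M ?g (M - a) X) =
        2 ^ a * (2 ^ M * shifted_avg M ?g (M - a) X) + 2 ^ a * (2 ^ M * shifted_avg M ?g (M - a) X)"
      by simp
    show "(if bit n a then 2 ^ a * (\<Sum>Y<2 ^ M. ?g Y * ?P a Y) + (\<Sum>Y<2 ^ M. ?g Y * fejer_kernel (2 ^ a) x (?y Y)) else 0) \<le>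
        2 * 2 ^ M * (if bit n a then 2 ^ a * shifted_avg M ?g (M - a) X else 0)"
    proof (cases "bit n a")
      case True
      show ?thesis by (simp only: True if_True eq add_mono[OF p k])
    qed simp
  qed
  finally show ?thesis unfolding X_def sum_distrib_left .
qed

lemma walsh_partial_sum_dyadic_index:
  assumes "k \<le> 2 ^ M"
  shows "walsh_partial_sum f k x = walsh_partial_sum f k (real (dyadic_index M x) / 2 ^ M)"
  unfolding walsh_partial_sum_def
  using assms by (intro sum.cong refl) (subst walsh_dyadic_index[of _ M x], auto)

text \<open>After division by \<open>n\<close>, this is the set where the maximal function of the
  Fejer means exceeds \<open>l\<close>.\<close>

definition fejer_large :: "(real \<Rightarrow> real) \<Rightarrow> real \<Rightarrow> real set" where
  "fejer_large f l = {x \<in> {0..<1}. \<exists>n\<ge>1. \<bar>\<Sum>k<n. walsh_partial_sum f k x\<bar> > l * n}"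

text \<open>For indices below \<open>2 ^ M\<close> the exceptional set is a union of cells of rank
  \<open>M\<close>, to which the discrete estimate applies with a bound independent of
  \<open>M\<close>; these sets increase to \<open>fejer_large f l\<close>.\<close>

lemma weak_type_fejer:
  assumes f: "set_integrable lebesgue {0..<1} f" and l: "l > 0"
  shows "fejer_large f l \<in> sets lebesgue" (is ?S)
    and "emeasure lebesgue (fejer_large f l) \<le> ennreal (16 * (LINT x:{0..<1}|lebesgue. \<bar>f x\<bar>) / l)" (is ?T)
proof -
  let ?A = "\<lambda>n x. \<bar>\<Sum>k<n. walsh_partial_sum f k x\<bar> > l * real n"
  define I where "I M = {X. X < 2 ^ M \<and> (\<exists>n. 1 \<le> n \<and> n < 2 ^ M \<and> ?A n (real X / 2 ^ M))}" for M
  define B where "B M = {x \<in> {0..<1}. \<exists>n. 1 \<le> n \<and> n < 2 ^ M \<and> ?A n x}" for M :: nat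
  have fin: "finite (I M)" for M by (rule finite_subset[of _ "{..<2 ^ M}"]) (auto simp: I_def)
  have BI: "B M = (\<Union>X\<in>I M. dyadic_cell M X)" for M
  proof -
    have A: "?A n x \<longleftrightarrow> ?A n (real (dyadic_index M x) / 2 ^ M)" if "n < 2 ^ M" for n x
    proof -
      have "(\<Sum>k<n. walsh_partial_sum f k x) = (\<Sum>k<n. walsh_partial_sum f k (real (dyadic_index M x) / 2 ^ M))"
        using that by (intro sum.cong refl walsh_partial_sum_dyadic_index) auto
      then show ?thesis by simp
    qed
    show ?thesis
    proof (intro set_eqI iffI)
      fix x assume "x \<in> B M"
      then have "x \<in> {0..<1}" "dyadic_index M x \<in> I M"
        using A by (auto simp: B_def I_def dyadic_index_less)
      then show "x \<in> (\<Union>X\<in>I M. dyadic_cell M X)"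
        by (auto intro!: bexI[of _ "dyadic_index M x"] simp: dyadic_cell_iff)
    next
      fix x assume "x \<in> (\<Union>X\<in>I M. dyadic_cell M X)"
      then obtain X where X: "X \<in> I M" "x \<in> dyadic_cell M X" by blast
      then have x: "x \<in> {0..<1}" using dyadic_cell_subset[of X M] by (auto simp: I_def)
      then have "dyadic_index M x = X" using X(2) by (simp add: dyadic_cell_iff)
      then show "x \<in> B M" using X(1) x A by (auto simp: B_def I_def)
    qed
  qed
  have meas: "B M \<in> sets lebesgue" for M unfolding BI using fin by (intro sets.finite_UN) auto
  have le: "emeasure lebesgue (B M) \<le> ennreal (16 * (LINT x:{0..<1}|lebesgue. \<bar>f x\<bar>) / l)" for M
  proof -
    \<comment> \<open>Chosen so that shifted averages of at most \<open>4 * \<alpha>\<close> yield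
      \<open>2 * 2 ^ M * (n * (4 * \<alpha>)) = l * n\<close>, the powers of 2 in \<open>n\<close>
      adding up to \<open>n\<close>.\<close>
    define \<alpha> where "\<alpha> = l / (8 * 2 ^ M)"
    have \<alpha>: "\<alpha> > 0" using l by (simp add: \<alpha>_def)
    let ?J = "{X. X < 2 ^ M \<and> (\<exists>d\<le>M. shifted_avg M (cell_mass f M) d X > 4 * \<alpha>)}"
    have "I M \<subseteq> ?J"
    proof
      fix X assume "X \<in> I M"
      then obtain n where n: "X < 2 ^ M" "1 \<le> n" "n < 2 ^ M" "?A n (real X / 2 ^ M)"
        by (auto simp: I_def)
      show "X \<in> ?J"
      proof (rule ccontr)
        assume "X \<notin> ?J"
        then have le: "shifted_avg M (cell_mass f M) d X \<le> 4 * \<alpha>" if "d \<le> M" for d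
          using n(1) that by (auto simp: not_less)
        have "real X / 2 ^ M < 1" using n(1) by simp
        from abs_sum_walsh_partial_sum_le[OF f n(3) this]
        have "\<bar>\<Sum>k<n. walsh_partial_sum f k (real X / 2 ^ M)\<bar> \<le>
            2 * 2 ^ M * (\<Sum>a<M. if bit n a then 2 ^ a * shifted_avg M (cell_mass f M) (M - a) X else 0)"
          unfolding dyadic_index_of_nat .
        also have "\<dots> \<le> 2 * 2 ^ M * (\<Sum>a<M. (if bit n a then 2 ^ a else 0) * (4 * \<alpha>))"
          by (intro mult_left_mono sum_mono) (auto intro!: mult_left_mono le)
        also have "(\<Sum>a<M. (if bit n a then 2 ^ a else 0) * (4 * \<alpha>)) = real (\<Sum>a<M. if bit n a then 2 ^ a else 0) * (4 * \<alpha>)"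
          by (simp add: sum_distrib_right if_distrib cong: if_cong)
        also have "(\<Sum>a<M. if bit n a then 2 ^ a else 0) = n" by (rule sum_bits[OF n(3)])
        also have "2 * 2 ^ M * (real n * (4 * \<alpha>)) = l * n" by (simp add: \<alpha>_def)
        finally show False using n(4) by simp
      qed
    qed
    then have "card (I M) \<le> card ?J"
      by (rule card_mono[rotated]) (rule finite_subset[of _ "{..<2 ^ M}"], auto)
    then have "\<alpha> * card (I M) \<le> \<alpha> * card ?J" using \<alpha> by (intro mult_left_mono) auto
    also have "\<dots> \<le> 2 * (\<Sum>X<2 ^ M. cell_mass f M X)"
      by (rule weak_type_shifted_avg[OF cell_mass_nonneg \<alpha>])
    finally have c: "real (card (I M)) / 2 ^ M \<le> 16 * (LINT x:{0..<1}|lebesgue. \<bar>f x\<bar>) / l"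
      unfolding sum_cell_mass[OF f] using l by (simp add: \<alpha>_def field_simps)
    have "emeasure lebesgue (B M) \<le> (\<Sum>X\<in>I M. emeasure lebesgue (dyadic_cell M X))"
      unfolding BI using fin by (intro emeasure_subadditive_finite) auto
    also have "\<dots> = (\<Sum>X\<in>I M. ennreal (1 / 2 ^ M))"
    proof (intro sum.cong refl)
      fix X
      have "emeasure lebesgue (dyadic_cell M X) \<noteq> \<infinity>"
        unfolding dyadic_cell_def by (simp add: divide_right_mono)
      then show "emeasure lebesgue (dyadic_cell M X) = ennreal (1 / 2 ^ M)"
        by (simp add: emeasure_eq_ennreal_measure)
    qed
    also have "\<dots> = ennreal (real (card (I M)) / 2 ^ M)"
      by (simp add: sum_ennreal del: sum_constant) simp
    also have "\<dots> \<le> ennreal (16 * (LINT x:{0..<1}|lebesgue. \<bar>f x\<bar>) / l)"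
      by (rule ennreal_leI[OF c])
    finally show ?thesis .
  qed
  have inc: "incseq B"
    unfolding incseq_def
  proof (intro allI impI subsetI)
    fix m n x assume "m \<le> n" "x \<in> B m"
    moreover from \<open>m \<le> n\<close> have "(2::nat) ^ m \<le> 2 ^ n" by simp
    ultimately show "x \<in> B n" unfolding B_def by (blast intro: less_le_trans)
  qed
  have U: "fejer_large f l = (\<Union>M. B M)"
  proof (intro set_eqI iffI)
    fix x assume "x \<in> fejer_large f l"
    then obtain n where "x \<in> {0..<1}" "n \<ge> 1" "?A n x" by (auto simp: fejer_large_def)
    then have "x \<in> B n" unfolding B_def using less_exp[of n] by blast
    then show "x \<in> (\<Union>M. B M)" by blast
  next
    fix x assume "x \<in> (\<Union>M. B M)"
    then show "x \<in> fejer_large f l" unfolding fejer_large_def B_def by blast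
  qed
  have range: "range B \<subseteq> sets lebesgue" using meas by blast
  show ?S unfolding U using range by (rule sets.countable_UN)
  show ?T
    unfolding U SUP_emeasure_incseq[OF range inc, symmetric] by (rule SUP_least) (rule le)
qed

subsection \<open>Density of Walsh polynomials\<close>

text \<open>The Dirichlet kernel of order \<open>2 ^ M\<close> centred at \<open>X / 2 ^ M\<close>
  is \<open>2 ^ M\<close> times the indicator of the cell of \<open>X\<close>, so step functions are
  Walsh polynomials on the unit interval.\<close>

lemma ex_walsh_poly_dyadic:
  "\<exists>p. walsh_poly_upto M p \<and> (\<forall>x\<in>{0..<1}. p x = \<phi> (dyadic_index M x))"
proof -
  define p where "p x = (\<Sum>X<2 ^ M. (\<phi> X / 2 ^ M) *
    (\<Prod>i<M. 1 + rademacher i (real X / 2 ^ M) * rademacher i x))" for x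
  have "walsh_poly_upto M p"
    unfolding p_def
    by (intro walsh_poly_sum walsh_poly_cmult walsh_poly_upto_prod walsh_poly_add walsh_poly_upto_const
        walsh_poly_upto_rademacher) auto
  moreover have "p x = \<phi> (dyadic_index M x)" if "x \<in> {0..<1}" for x
  proof -
    have ix: "dyadic_index M x < 2 ^ M" using that by (intro dyadic_index_less) auto
    have "p x = (\<Sum>X<2 ^ M. if X = dyadic_index M x then \<phi> X else 0)"
      unfolding p_def
    proof (rule sum.cong[OF refl])
      fix X :: nat assume "X \<in> {..<2 ^ M}"
      then have "(\<Prod>i<M. 1 + rademacher i (real X / 2 ^ M) * rademacher i x) =
          (if dyadic_index M x = X then 2 ^ M else 0)"
        using prod_sign_factor[of X M "real X / 2 ^ M" "dyadic_index M x" x M] ix by simp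
      then show "(\<phi> X / 2 ^ M) * (\<Prod>i<M. 1 + rademacher i (real X / 2 ^ M) * rademacher i x) =
          (if X = dyadic_index M x then \<phi> X else 0)"
        by auto
    qed
    then show ?thesis using ix by simp
  qed
  ultimately show ?thesis by blast
qed

abbreviation unit_measure :: "real measure" where
  "unit_measure \<equiv> restrict_space lebesgue {0..<1}"

lemma integrable_unit_measure: "integrable unit_measure f \<longleftrightarrow> set_integrable lebesgue {0..<1} f"
  for f :: "real \<Rightarrow> real"
  by (simp add: set_integrable_def integrable_restrict_space)

lemma integral_unit_measure: "(\<integral>x. f x \<partial>unit_measure) = (LINT x:{0..<1}|lebesgue. f x)"
  for f :: "real \<Rightarrow> real"
  by (simp add: set_lebesgue_integral_def integral_restrict_space)

lemma space_unit_measure: "space unit_measure = {0..<1}"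
  by (simp add: space_restrict_space)

lemma walsh_poly_integrable': "walsh_poly I p \<Longrightarrow> integrable unit_measure p"
  by (simp add: integrable_unit_measure walsh_poly_integrable)

definition walsh_approximable :: "(real \<Rightarrow> real) \<Rightarrow> bool" where
  "walsh_approximable f \<longleftrightarrow>
    (\<forall>e>0. \<exists>L p. walsh_poly_upto L p \<and> (\<integral>x. \<bar>f x - p x\<bar> \<partial>unit_measure) < e)"

lemma walsh_approximable_closed:
  assumes f: "integrable unit_measure f"
    and ex: "\<And>e. e > 0 \<Longrightarrow> \<exists>g. integrable unit_measure g \<and> walsh_approximable g \<and> (\<integral>x. \<bar>f x - g x\<bar> \<partial>unit_measure) < e"
  shows "walsh_approximable f"
  unfolding walsh_approximable_def
proof (intro allI impI)
  fix e :: real assume e: "e > 0"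
  then obtain g where g: "integrable unit_measure g" "walsh_approximable g"
    "(\<integral>x. \<bar>f x - g x\<bar> \<partial>unit_measure) < e / 2"
    using ex[of "e / 2"] by auto
  then obtain L p where p: "walsh_poly_upto L p" "(\<integral>x. \<bar>g x - p x\<bar> \<partial>unit_measure) < e / 2"
    using e unfolding walsh_approximable_def by (meson half_gt_zero)
  have ip: "integrable unit_measure p" by (rule walsh_poly_integrable'[OF p(1)])
  have "(\<integral>x. \<bar>f x - p x\<bar> \<partial>unit_measure) \<le> (\<integral>x. \<bar>f x - g x\<bar> + \<bar>g x - p x\<bar> \<partial>unit_measure)"
    using f g ip by (intro integral_mono) auto
  also have "\<dots> = (\<integral>x. \<bar>f x - g x\<bar> \<partial>unit_measure) + (\<integral>x. \<bar>g x - p x\<bar> \<partial>unit_measure)"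
    using f g ip by (intro Bochner_Integration.integral_add) auto
  also have "\<dots> < e" using g p by simp
  finally show "\<exists>L p. walsh_poly_upto L p \<and> (\<integral>x. \<bar>f x - p x\<bar> \<partial>unit_measure) < e"
    using p(1) by blast
qed

lemma walsh_approximable_poly: "walsh_poly_upto L p \<Longrightarrow> walsh_approximable p"
  unfolding walsh_approximable_def by (intro allI impI exI[of _ L] exI[of _ p]) simp

lemma walsh_approximable_tendsto:
  assumes f: "integrable unit_measure f" and w: "integrable unit_measure w"
    and s: "\<And>i. integrable unit_measure (s i)" "\<And>i. walsh_approximable (s i)"
    and lim: "\<And>x. x \<in> {0..<1} \<Longrightarrow> (\<lambda>i. s i x) \<longlonglongrightarrow> f x"
    and bound: "\<And>i x. x \<in> {0..<1} \<Longrightarrow> \<bar>s i x\<bar> \<le> w x"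
  shows "walsh_approximable f"
proof (rule walsh_approximable_closed[OF f])
  fix e :: real assume e: "e > 0"
  have "(\<lambda>i. \<integral>x. \<bar>f x - s i x\<bar> \<partial>unit_measure) \<longlonglongrightarrow> (\<integral>x. 0 \<partial>unit_measure)"
  proof (rule integral_dominated_convergence)
    show "(\<lambda>x. 0) \<in> borel_measurable unit_measure" by simp
    show "(\<lambda>x. \<bar>f x - s i x\<bar>) \<in> borel_measurable unit_measure" for i
      using f s(1)[of i] by measurable
    show "integrable unit_measure (\<lambda>x. \<bar>f x\<bar> + w x)" using f w by simp
    show "AE x in unit_measure. (\<lambda>i. \<bar>f x - s i x\<bar>) \<longlonglongrightarrow> 0"
    proof (rule AE_I2)
      fix x assume "x \<in> space unit_measure"
      then have "(\<lambda>i. \<bar>f x - s i x\<bar>) \<longlonglongrightarrow> \<bar>f x - f x\<bar>"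
        unfolding space_unit_measure by (intro tendsto_intros lim)
      then show "(\<lambda>i. \<bar>f x - s i x\<bar>) \<longlonglongrightarrow> 0" by simp
    qed
    show "AE x in unit_measure. norm \<bar>f x - s i x\<bar> \<le> \<bar>f x\<bar> + w x" for i
    proof (rule AE_I2)
      fix x assume "x \<in> space unit_measure"
      then show "norm \<bar>f x - s i x\<bar> \<le> \<bar>f x\<bar> + w x"
        using bound[of x i] unfolding space_unit_measure by simp
    qed
  qed
  then have "eventually (\<lambda>i. (\<integral>x. \<bar>f x - s i x\<bar> \<partial>unit_measure) < e) sequentially"
    using e by (intro order_tendstoD) simp_all
  then obtain i where "(\<integral>x. \<bar>f x - s i x\<bar> \<partial>unit_measure) < e"
    by (auto simp: eventually_sequentially)
  then show "\<exists>g. integrable unit_measure g \<and> walsh_approximable g \<and> (\<integral>x. \<bar>f x - g x\<bar> \<partial>unit_measure) < e"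
    using s by blast
qed

lemma integrable_unit_const: "integrable unit_measure (\<lambda>x. c :: real)"
  by (simp add: integrable_unit_measure set_integrable_unit_const)

lemma integrable_unit_open:
  fixes T :: "real set"
  assumes T: "open T"
  shows "integrable unit_measure (\<lambda>x. c * indicator T x :: real)"
proof -
  have "T \<in> sets lebesgue" using T by (intro sets_completionI_sets) simp
  then have "{0..<1} \<inter> T \<in> lmeasurable"
    by (intro bounded_set_imp_lmeasurable) (auto intro: bounded_subset[OF bounded_Ico])
  then have "integrable lebesgue (\<lambda>x. c * indicator ({0..<1} \<inter> T) x)"
    unfolding fmeasurable_def by (intro integrable_mult_right integrable_real_indicator) auto
  then show ?thesis
    by (simp add: integrable_unit_measure set_integrable_def indicator_inter_arith mult_ac)
qed

text \<open>The approximants are \<open>c\<close> times the indicator of the union of the cells of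
  rank \<open>m\<close> inside \<open>T\<close>; a point of \<open>T\<close> has a ball inside
  \<open>T\<close> and so belongs to this union for all large \<open>m\<close>.\<close>

lemma walsh_approximable_open:
  fixes T :: "real set"
  assumes T: "open T"
  shows "walsh_approximable (\<lambda>x. c * indicator T x)"
proof -
  have "\<exists>p. walsh_poly_upto m p \<and> (\<forall>x\<in>{0..<1}. p x = (if dyadic_cell m (dyadic_index m x) \<subseteq> T then c else 0))" for m
    by (rule ex_walsh_poly_dyadic)
  then obtain p where p: "\<And>m. walsh_poly_upto m (p m)"
    "\<And>m x. x \<in> {0..<1} \<Longrightarrow> p m x = (if dyadic_cell m (dyadic_index m x) \<subseteq> T then c else 0)"
    by metis
  show ?thesis
  proof (rule walsh_approximable_tendsto[where s = p and w = "\<lambda>_. \<bar>c\<bar>"])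
    show "integrable unit_measure (\<lambda>x. c * indicator T x)" by (rule integrable_unit_open[OF T])
    show "integrable unit_measure (\<lambda>_. \<bar>c\<bar>)" by (rule integrable_unit_const)
    show "integrable unit_measure (p i)" "walsh_approximable (p i)" for i
      using p(1)[of i] by (rule walsh_poly_integrable', rule walsh_approximable_poly)
    show "\<bar>p i x\<bar> \<le> \<bar>c\<bar>" if "x \<in> {0..<1}" for i x using p(2)[OF that] by simp
    show "(\<lambda>i. p i x) \<longlonglongrightarrow> c * indicator T x" if x: "x \<in> {0..<1}" for x
    proof (cases "x \<in> T")
      case False
      then have "p i x = 0" for i
        using p(2)[OF x, of i] x dyadic_cell_iff[of x i "dyadic_index i x"] by auto
      then show ?thesis using False by simp
    next
      case True
      then obtain e where e: "e > 0" "ball x e \<subseteq> T" using T by (meson openE)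
      obtain m where m: "(1 / 2) ^ m < e" using real_arch_pow_inv[of e "1 / 2"] e(1) by auto
      have "p i x = c" if "i \<ge> m" for i
      proof -
        have "dyadic_cell i (dyadic_index i x) \<subseteq> ball x e"
        proof
          fix y assume y: "y \<in> dyadic_cell i (dyadic_index i x)"
          have "x \<in> dyadic_cell i (dyadic_index i x)" using x dyadic_cell_iff[of x i] by simp
          with y have "\<bar>x - y\<bar> < 1 / 2 ^ i"
            unfolding dyadic_cell_def by (auto simp: add_divide_distrib abs_less_iff)
          also have "\<dots> \<le> (1 / 2) ^ m"
            using power_decreasing[OF that, of "1 / 2 :: real"] by (simp add: power_one_over)
          finally show "y \<in> ball x e" using m by (simp add: dist_real_def)
        qed
        then show ?thesis using p(2)[OF x, of i] e(2) by auto
      qed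
      then have "eventually (\<lambda>i. p i x = c) sequentially"
        by (auto simp: eventually_sequentially)
      then show ?thesis using True by (simp add: tendsto_eventually)
    qed
  qed
qed

text \<open>Outer regularity replaces a measurable set by an open one at small cost in measure; sums
  and dominated limits preserve approximability.\<close>

lemma walsh_poly_dense:
  assumes "integrable unit_measure f"
  shows "walsh_approximable f"
  using assms
proof (induction rule: integrable_induct)
  case (base A c)
  have A: "A \<in> sets lebesgue" "A \<subseteq> {0..<1}"
    using base(1) by (auto simp: sets_restrict_space_iff)
  have ind: "integrable unit_measure (\<lambda>x. c * indicator A x)"
    using base by (intro integrable_mult_right) auto
  have "walsh_approximable (\<lambda>x. c * indicator A x)"
  proof (rule walsh_approximable_closed[OF ind])
    fix e :: real assume e: "e > 0"
    \<comment> \<open>Adding 1 covers \<open>c = 0\<close> and makes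
      \<open>\<bar>c\<bar> * e'\<close> strictly less than \<open>e\<close>.\<close>
    define e' where "e' = e / (\<bar>c\<bar> + 1)"
    have e': "e' > 0" using e by (simp add: e'_def)
    obtain T where T: "open T" "A \<subseteq> T" "T - A \<in> lmeasurable" "emeasure lebesgue (T - A) < ennreal e'"
      using sets_lebesgue_outer_open[OF A(1) e'] by blast
    have "measure lebesgue (T - A) < e'"
      using T(4) e' by (simp add: emeasure_eq_measure2[OF T(3)] ennreal_less_iff)
    have TA: "integrable lebesgue (indicator (T - A) :: real \<Rightarrow> real)"
      using T(3) unfolding fmeasurable_def by (intro integrable_real_indicator) auto
    have iT: "integrable unit_measure (\<lambda>x. c * indicator T x)" by (rule integrable_unit_open[OF T(1)])
    have "(\<integral>x. \<bar>c * indicator A x - c * indicator T x\<bar> \<partial>unit_measure) =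
        (\<integral>x. indicator {0..<1} x * (\<bar>c\<bar> * indicator (T - A) x) \<partial>lebesgue)"
      unfolding integral_unit_measure set_lebesgue_integral_def
    proof (intro Bochner_Integration.integral_cong refl)
      fix x
      show "indicator {0..<1} x *\<^sub>R \<bar>c * indicator A x - c * indicator T x\<bar> =
          indicator {0..<1} x * (\<bar>c\<bar> * indicator (T - A) x)"
        using T(2) by (cases "x \<in> A"; cases "x \<in> T") auto
    qed
    also have "\<dots> \<le> (\<integral>x. \<bar>c\<bar> * indicator (T - A) x \<partial>lebesgue)"
    proof (rule integral_mono)
      show "integrable lebesgue (\<lambda>x. \<bar>c\<bar> * indicator (T - A) x)" using TA by simp
      then show "integrable lebesgue (\<lambda>x. indicator {0..<1} x * (\<bar>c\<bar> * indicator (T - A) x))"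
        using integrable_mult_indicator[of "{0..<1}" lebesgue "\<lambda>x. \<bar>c\<bar> * indicator (T - A) x"] by simp
    qed (auto simp: indicator_def)
    also have "\<dots> = \<bar>c\<bar> * measure lebesgue (T - A)" by simp
    also have "\<dots> \<le> \<bar>c\<bar> * e'"
      using \<open>measure lebesgue (T - A) < e'\<close> by (intro mult_left_mono) auto
    also have "\<dots> < e" using e by (simp add: e'_def field_simps)
    finally show "\<exists>g. integrable unit_measure g \<and> walsh_approximable g \<and>
        (\<integral>x. \<bar>c * indicator A x - g x\<bar> \<partial>unit_measure) < e"
      using iT walsh_approximable_open[OF T(1)] by blast
  qed
  then show ?case by (simp add: mult.commute)
next
  case (add f g)
  show ?case unfolding walsh_approximable_def
  proof (intro allI impI)
    fix e :: real assume "e > 0"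
    then have e: "e / 2 > 0" by simp
    obtain L p where p: "walsh_poly_upto L p" "(\<integral>x. \<bar>f x - p x\<bar> \<partial>unit_measure) < e / 2"
      using add e unfolding walsh_approximable_def by blast
    obtain K q where q: "walsh_poly_upto K q" "(\<integral>x. \<bar>g x - q x\<bar> \<partial>unit_measure) < e / 2"
      using add e unfolding walsh_approximable_def by blast
    have i: "integrable unit_measure p" "integrable unit_measure q"
      using p q walsh_poly_integrable' by auto
    have pq: "walsh_poly_upto (max L K) (\<lambda>x. p x + q x)"
      by (intro walsh_poly_add walsh_poly_upto_mono[OF p(1)] walsh_poly_upto_mono[OF q(1)]) auto
    have "(\<integral>x. \<bar>f x + g x - (p x + q x)\<bar> \<partial>unit_measure) \<le> (\<integral>x. \<bar>f x - p x\<bar> + \<bar>g x - q x\<bar> \<partial>unit_measure)"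
      using add i by (intro integral_mono) auto
    also have "\<dots> = (\<integral>x. \<bar>f x - p x\<bar> \<partial>unit_measure) + (\<integral>x. \<bar>g x - q x\<bar> \<partial>unit_measure)"
      using add i by (intro Bochner_Integration.integral_add) auto
    also have "\<dots> < e" using p q by simp
    finally show "\<exists>L p. walsh_poly_upto L p \<and> (\<integral>x. \<bar>f x + g x - p x\<bar> \<partial>unit_measure) < e"
      using pq by blast
  qed
next
  case (lim f s)
  show ?case
  proof (rule walsh_approximable_tendsto[where s = s and w = "\<lambda>x. 2 * \<bar>f x\<bar>"])
    show "integrable unit_measure (\<lambda>x. 2 * \<bar>f x\<bar>)" using lim by simp
  qed (use lim in \<open>auto simp: space_unit_measure\<close>)
qed

subsection \<open>Almost everywhere convergence\<close>

lemma walsh_partial_sum_diff: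
  assumes "set_integrable lebesgue {0..<1} f" "set_integrable lebesgue {0..<1} g"
  shows "walsh_partial_sum (\<lambda>x. f x - g x) n x = walsh_partial_sum f n x - walsh_partial_sum g n x"
  using walsh_partial_sum_add[OF assms(1) set_integrable_mult_right[OF assms(2)], of "-1"]
    walsh_partial_sum_cmult[of "-1" g] by simp

lemma fejer_mean_walsh_poly:
  assumes "walsh_poly_upto L p"
  shows "(\<lambda>n. (\<Sum>k<n. walsh_partial_sum p k x) / n) \<longlonglongrightarrow> p x"
proof -
  define c where "c = (\<Sum>k<2 ^ L. walsh_partial_sum p k x) - 2 ^ L * p x"
  have "(\<Sum>k<n. walsh_partial_sum p k x) / n = c / n + p x" if n: "n \<ge> 2 ^ L" for n
  proof -
    have "n > 0" using n by (metis gr0I le_zero_eq power_not_zero zero_neq_numeral)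
    have "(\<Sum>k<n. walsh_partial_sum p k x) = (\<Sum>k<2 ^ L. walsh_partial_sum p k x) + (\<Sum>k=2 ^ L..<n. walsh_partial_sum p k x)"
      using n by (metis atLeast0LessThan sum.atLeastLessThan_concat zero_le)
    also have "(\<Sum>k=2 ^ L..<n. walsh_partial_sum p k x) = (\<Sum>k=2 ^ L..<n. p x)"
      by (intro sum.cong refl walsh_partial_sum_eq_self[OF assms]) auto
    finally have "(\<Sum>k<n. walsh_partial_sum p k x) = c + n * p x"
      using n by (simp add: c_def of_nat_diff algebra_simps)
    then show ?thesis using \<open>n > 0\<close> by (simp add: field_simps)
  qed
  then have "eventually (\<lambda>n. c / real n + p x = (\<Sum>k<n. walsh_partial_sum p k x) / n) sequentially"
    by (intro eventually_sequentiallyI[of "2 ^ L"]) simp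
  moreover have "(\<lambda>n. c / real n + p x) \<longlonglongrightarrow> 0 + p x"
    by (intro tendsto_intros lim_const_over_n)
  ultimately show ?thesis by (simp add: Lim_transform_eventually)
qed

text \<open>The polynomials approximate within \<open>(1 / 4) ^ i\<close>, and exceptional sets are
  taken at height \<open>(1 / 2) ^ i\<close>; the weak type and Markov estimates then give summable
  measures of order \<open>(1 / 2) ^ i\<close>. By Borel-Cantelli almost every \<open>x\<close>
  leaves them for good, and there both \<open>f\<close> and its Fejer means are within
  \<open>(1 / 2) ^ i\<close> of those of the polynomial.\<close>

theorem fejer_mean_converges_AE:
  assumes f: "set_integrable lebesgue {0..<1} f"
  shows "AE x in lebesgue. x \<in> {0..<1} \<longrightarrow> (\<lambda>n. (\<Sum>k<n. walsh_partial_sum f k x) / n) \<longlonglongrightarrow> f x"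
proof -
  have "\<exists>L p. walsh_poly_upto L p \<and> (LINT x:{0..<1}|lebesgue. \<bar>f x - p x\<bar>) < (1 / 4) ^ i" for i :: nat
    using walsh_poly_dense[of f] f
    unfolding walsh_approximable_def integrable_unit_measure integral_unit_measure by simp
  then obtain L p where p: "\<And>i::nat. walsh_poly_upto (L i) (p i)"
    "\<And>i. (LINT x:{0..<1}|lebesgue. \<bar>f x - p i x\<bar>) < (1 / 4) ^ i"
    by metis
  define h where "h i x = f x - p i x" for i x
  have h: "set_integrable lebesgue {0..<1} (h i)" for i
    unfolding h_def using walsh_poly_integrable[OF p(1)[of i]] f by (intro set_integral_diff)
  have hs: "(LINT x:{0..<1}|lebesgue. \<bar>h i x\<bar>) < (1 / 4) ^ i" for i
    unfolding h_def by (rule p)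
  have quarter: "(1 / 4 :: real) ^ i = (1 / 2) ^ i * (1 / 2) ^ i" for i :: nat
    by (simp flip: power_mult_distrib)
  define B where "B i = fejer_large (h i) ((1 / 2) ^ i)" for i
  define C where "C i = {x \<in> space lebesgue. indicator {0..<1} x * \<bar>h i x\<bar> \<ge> (1 / 2) ^ i}" for i
  have hi: "integrable lebesgue (\<lambda>x. indicator {0..<1} x * \<bar>h i x\<bar>)" for i
    using set_integrable_abs[OF h[of i]] by (simp add: set_integrable_def)
  have B: "B i \<in> sets lebesgue" "emeasure lebesgue (B i) \<le> ennreal (16 * (1 / 2) ^ i)" for i
  proof -
    show "B i \<in> sets lebesgue" unfolding B_def by (rule weak_type_fejer(1)[OF h]) simp
    have "emeasure lebesgue (B i) \<le> ennreal (16 * (LINT x:{0..<1}|lebesgue. \<bar>h i x\<bar>) / (1 / 2) ^ i)"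
      unfolding B_def by (rule weak_type_fejer(2)[OF h]) simp
    also have "\<dots> \<le> ennreal (16 * (1 / 4) ^ i / (1 / 2) ^ i)"
      using hs[of i] by (intro ennreal_leI divide_right_mono) auto
    also have "16 * (1 / 4) ^ i / (1 / 2) ^ i = (16 * (1 / 2) ^ i :: real)"
      by (simp add: quarter)
    finally show "emeasure lebesgue (B i) \<le> ennreal (16 * (1 / 2) ^ i)" .
  qed
  have C: "C i \<in> sets lebesgue" "emeasure lebesgue (C i) \<le> ennreal ((1 / 2) ^ i)" for i
  proof -
    have [measurable]: "(\<lambda>x. indicator {0..<1} x * \<bar>h i x\<bar>) \<in> borel_measurable lebesgue"
      using hi[of i] by auto
    show "C i \<in> sets lebesgue" unfolding C_def by measurable
    have "emeasure lebesgue (C i) \<le> ennreal (1 / (1 / 2) ^ i * (\<integral>x. indicator {0..<1} x * \<bar>h i x\<bar> \<partial>lebesgue))"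
      unfolding C_def by (rule integral_Markov_inequality[OF hi]) auto
    also have "(\<integral>x. indicator {0..<1} x * \<bar>h i x\<bar> \<partial>lebesgue) = (LINT x:{0..<1}|lebesgue. \<bar>h i x\<bar>)"
      by (simp add: set_lebesgue_integral_def)
    also have "ennreal (1 / (1 / 2) ^ i * (LINT x:{0..<1}|lebesgue. \<bar>h i x\<bar>)) \<le> ennreal (1 / (1 / 2) ^ i * (1 / 4) ^ i)"
      using hs[of i] by (intro ennreal_leI mult_left_mono) auto
    also have "1 / (1 / 2) ^ i * (1 / 4) ^ i = ((1 / 2) ^ i :: real)"
      by (simp add: quarter)
    finally show "emeasure lebesgue (C i) \<le> ennreal ((1 / 2) ^ i)" .
  qed
  have BC: "emeasure lebesgue (B i \<union> C i) \<le> ennreal (17 * (1 / 2) ^ i)" for i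
  proof -
    have "emeasure lebesgue (B i \<union> C i) \<le> ennreal (16 * (1 / 2) ^ i) + ennreal ((1 / 2) ^ i)"
      using emeasure_subadditive[OF B(1) C(1)] B(2) C(2) by (meson add_mono order_trans)
    then show ?thesis by (simp flip: ennreal_plus)
  qed
  have "AE x in lebesgue. eventually (\<lambda>i. x \<in> space lebesgue - (B i \<union> C i)) sequentially"
  proof (rule borel_cantelli_AE1)
    show "B i \<union> C i \<in> sets lebesgue" for i using B C by auto
    show "emeasure lebesgue (B i \<union> C i) < \<infinity>" for i
      using BC[of i] by (rule le_less_trans) simp
    show "summable (\<lambda>i. measure lebesgue (B i \<union> C i))"
    proof (rule summable_comparison_test')
      show "summable (\<lambda>i. 17 * (1 / 2 :: real) ^ i)"
        by (intro summable_mult summable_geometric) simp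
      fix i :: nat
      have "measure lebesgue (B i \<union> C i) \<le> 17 * (1 / 2) ^ i"
        using BC[of i] unfolding measure_def by (intro enn2real_leI) auto
      then show "norm (measure lebesgue (B i \<union> C i)) \<le> 17 * (1 / 2) ^ i" by simp
    qed
  qed
  then show ?thesis
  proof eventually_elim
    case (elim x)
    show ?case
    proof
      assume x: "x \<in> {0..<1}"
      show "(\<lambda>n. (\<Sum>k<n. walsh_partial_sum f k x) / n) \<longlonglongrightarrow> f x"
      proof (rule LIMSEQ_I)
        fix r :: real assume r: "r > 0"
        obtain N where N: "\<And>i. i \<ge> N \<Longrightarrow> x \<notin> B i \<and> x \<notin> C i"
          using elim unfolding eventually_sequentially by auto
        obtain N' where N': "(1 / 2) ^ N' < r / 3" using real_arch_pow_inv[of "r / 3" "1 / 2"] r by auto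
        define i where "i = max N N'"
        have small: "(1 / 2 :: real) ^ i < r / 3"
proof -
          have "(1 / 2 :: real) ^ i \<le> (1 / 2) ^ N'"
            by (intro power_decreasing) (auto simp: i_def)
          then show ?thesis using N' by linarith
        qed
        have xi: "x \<notin> B i" "x \<notin> C i" using N[of i] by (auto simp: i_def)
        have 1: "\<bar>f x - p i x\<bar> < (1 / 2) ^ i"
          using xi(2) x by (auto simp: C_def h_def)
        have 2: "\<bar>(\<Sum>k<n. walsh_partial_sum f k x) / n - (\<Sum>k<n. walsh_partial_sum (p i) k x) / n\<bar> \<le> (1 / 2) ^ i"
          if "n \<ge> 1" for n
        proof -
          have "\<bar>\<Sum>k<n. walsh_partial_sum (h i) k x\<bar> \<le> (1 / 2) ^ i * n"
            using xi(1) x that by (force simp: B_def fejer_large_def not_less)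
          moreover have "walsh_partial_sum (h i) k x = walsh_partial_sum f k x - walsh_partial_sum (p i) k x" for k
            unfolding h_def by (rule walsh_partial_sum_diff[OF f walsh_poly_integrable[OF p(1)]])
          ultimately have "\<bar>(\<Sum>k<n. walsh_partial_sum f k x) - (\<Sum>k<n. walsh_partial_sum (p i) k x)\<bar> \<le> (1 / 2) ^ i * n"
            by (simp add: sum_subtractf)
          then have "\<bar>((\<Sum>k<n. walsh_partial_sum f k x) - (\<Sum>k<n. walsh_partial_sum (p i) k x)) / n\<bar> \<le> (1 / 2) ^ i"
            using that by (simp add: field_simps)
          then show ?thesis by (simp add: diff_divide_distrib)
        qed
        obtain n0 where n0: "\<And>n. n \<ge> n0 \<Longrightarrow> \<bar>(\<Sum>k<n. walsh_partial_sum (p i) k x) / n - p i x\<bar> < r / 3"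
          using LIMSEQ_D[OF fejer_mean_walsh_poly[OF p(1)[of i]], of "r / 3" x] r by auto
        show "\<exists>no. \<forall>n\<ge>no. norm ((\<Sum>k<n. walsh_partial_sum f k x) / n - f x) < r"
        proof (intro exI[of _ "max 1 n0"] allI impI)
          fix n assume "n \<ge> max 1 n0"
          then show "norm ((\<Sum>k<n. walsh_partial_sum f k x) / n - f x) < r"
            using 1 2[of n] n0[of n] small unfolding real_norm_def by linarith
        qed
      qed
    qed
  qed
qed

text \<open>The sum over the window is a difference of two sums starting at 0, whose errors are o(n)
  and are divided by \<open>lam n + 1\<close>. As \<open>n\<close> is eventually at most a multiple
  of \<open>lam n\<close>, they remain negligible.\<close>

theorem dlvp_mean_converges:
  fixes lam :: "nat \<Rightarrow> nat"
  assumes bounds: "\<And>n. n \<ge> 1 \<Longrightarrow> 1 \<le> lam n \<and> lam n \<le> n"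
    and bigo: "(\<lambda>n. real n) \<in> O(\<lambda>n. real (lam n))"
    and lim: "(\<lambda>n. (\<Sum>k<n. walsh_partial_sum f k x) / n) \<longlonglongrightarrow> y"
  shows "(\<lambda>n. dlvp_mean lam n f x) \<longlonglongrightarrow> y"
proof (rule LIMSEQ_I)
  fix r :: real assume r: "r > 0"
  define e where "e n = (\<Sum>k<n. walsh_partial_sum f k x) - n * y" for n
  obtain C where C: "C > 0" "eventually (\<lambda>n. norm (real n) \<le> C * norm (real (lam n))) sequentially"
    using bigo by (elim landau_o.bigE) auto
  \<comment> \<open>The final error is \<open>d * (2 * C + 1) + 2 * K / l\<close>. This
    \<open>d\<close> makes the first term less than \<open>r / 2\<close>; the second is made at most
    \<open>r / 2\<close> by taking \<open>n\<close>, and with it \<open>l\<close>, large.\<close>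
  define d where "d = r / (2 * (3 * C + 1))"
  have d: "d > 0" using r C by (simp add: d_def)
  obtain n0 where n0: "\<And>n. n \<ge> n0 \<Longrightarrow> \<bar>(\<Sum>k<n. walsh_partial_sum f k x) / n - y\<bar> < d"
    using LIMSEQ_D[OF lim d] by auto
  define K where "K = (\<Sum>n<n0. \<bar>e n\<bar>)"
  have e: "\<bar>e n\<bar> \<le> d * n + K" for n
  proof (cases "n < n0")
    case True
    then have "\<bar>e n\<bar> \<le> K" unfolding K_def by (intro member_le_sum) auto
    then show ?thesis using d by (simp add: add_increasing)
  next
    case False
    have K: "0 \<le> K" unfolding K_def by (intro sum_nonneg) auto
    show ?thesis
    proof (cases "n = 0")
      case True
      then show ?thesis using K by (simp add: e_def)
    next
      case n: False
      have "e n = ((\<Sum>k<n. walsh_partial_sum f k x) / n - y) * n"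
        using n by (simp add: e_def field_simps)
      then have "\<bar>e n\<bar> = \<bar>(\<Sum>k<n. walsh_partial_sum f k x) / n - y\<bar> * n" by (simp add: abs_mult)
      also have "\<dots> \<le> d * n" using n0[of n] False by (intro mult_right_mono) auto
      finally show ?thesis using K by simp
    qed
  qed
  obtain n1 where n1: "\<And>n. n \<ge> n1 \<Longrightarrow> real n \<le> C * real (lam n)"
    using C(2) by (auto simp: eventually_sequentially)
  obtain n2 :: nat where n2: "2 * K * C * 2 / r < n2" using reals_Archimedean2 by blast
  show "\<exists>no. \<forall>n\<ge>no. norm (dlvp_mean lam n f x - y) < r"
  proof (intro exI[of _ "max (max 1 n1) n2"] allI impI)
    fix n assume "n \<ge> max (max 1 n1) n2"
    then have n: "n \<ge> 1" "n \<ge> n1" "n \<ge> n2" by auto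
    have lam: "1 \<le> lam n" "lam n \<le> n" using bounds[OF n(1)] by auto
    define l where "l = real (lam n) + 1"
    have l: "l > 0" "real n \<le> C * l" "real n + 1 \<le> (C + 1) * l"
    proof -
      have "real n \<le> C * real (lam n)" by (rule n1[OF n(2)])
      then show "l > 0" "real n \<le> C * l" "real n + 1 \<le> (C + 1) * l"
        using C(1) by (simp_all add: l_def algebra_simps)
    qed
    \<comment> \<open>The window includes the index \<open>n\<close>, so the upper error is taken at
      \<open>Suc n\<close>.\<close>
    have "(\<Sum>k<Suc n. walsh_partial_sum f k x) = (\<Sum>k<n - lam n. walsh_partial_sum f k x) +
        (\<Sum>k=n - lam n..<Suc n. walsh_partial_sum f k x)"
      by (metis atLeast0LessThan sum.atLeastLessThan_concat zero_le le_SucI diff_le_self)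
    then have "(\<Sum>k\<in>{n - lam n..n}. walsh_partial_sum f k x) = e (Suc n) - e (n - lam n) + l * y"
      using lam by (simp add: e_def l_def atLeastLessThanSuc_atLeastAtMost of_nat_diff algebra_simps)
    then have "dlvp_mean lam n f x - y = (e (Suc n) - e (n - lam n)) / l"
      using l(1) unfolding dlvp_mean_def l_def[symmetric] by (simp add: field_simps)
    then have "\<bar>dlvp_mean lam n f x - y\<bar> = \<bar>e (Suc n) - e (n - lam n)\<bar> / l"
      using l(1) by simp
    also have "\<bar>e (Suc n) - e (n - lam n)\<bar> \<le> (d * Suc n + K) + (d * n + K)"
    proof -
      have "d * real (n - lam n) \<le> d * n" using d by (intro mult_left_mono) auto
      then show ?thesis using e[of "Suc n"] e[of "n - lam n"] by linarith
    qed
    also have "(d * Suc n + K) + (d * n + K) = d * (real n + 1) + d * n + 2 * K" by (simp add: algebra_simps)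
    also have "\<dots> \<le> d * ((C + 1) * l) + d * (C * l) + 2 * K"
      using l d by (intro add_mono mult_left_mono) auto
    finally have "\<bar>dlvp_mean lam n f x - y\<bar> \<le> (d * ((C + 1) * l) + d * (C * l) + 2 * K) / l"
      using l(1) by (simp add: divide_right_mono)
    also have "\<dots> = d * (2 * C + 1) + 2 * K / l"
      using l(1) by (simp add: field_simps)
    also have "d * (2 * C + 1) < r / 2"
    proof -
      have "d * (2 * C + 1) < d * (3 * C + 1)" using d C by (intro mult_strict_left_mono) auto
      also have "\<dots> = r / 2" using C(1) unfolding d_def by (simp add: field_simps)
      finally show ?thesis .
    qed
    also have "2 * K / l \<le> r / 2"
    proof -
      have "2 * K * C * 2 / r < C * l" using n2 n(3) l(2) by linarith
      then have "(4 * K) * C < (r * l) * C" using r by (simp add: field_simps)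
      then have "4 * K < r * l" using C(1) by simp
      then show ?thesis using l(1) by (simp add: field_simps)
    qed
    finally show "norm (dlvp_mean lam n f x - y) < r" by simp
  qed
qed

theorem theorem1p1:
  fixes lam :: "nat \<Rightarrow> nat"
  assumes bounds: "\<And>n. n \<ge> 1 \<Longrightarrow> 1 \<le> lam n \<and> lam n \<le> n"
    and nondec: "\<And>m n. 1 \<le> m \<Longrightarrow> m \<le> n \<Longrightarrow> lam m \<le> lam n"
  shows
    "((\<lambda>n. real n) \<in> O(\<lambda>n. real (lam n)) \<longrightarrow>
       (\<forall>f. set_integrable lebesgue {0..<1::real} f \<longrightarrow>
          (AE x in lebesgue. x \<in> {0..<1} \<longrightarrow>
             (\<lambda>n. dlvp_mean lam n f x) \<longlonglongrightarrow> f x)))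
     \<and>
     (\<forall>\<omega>. orlicz_function \<omega> \<longrightarrow>
        \<omega> \<in> o(\<lambda>t. t * sqrt (ln t)) \<longrightarrow>
        \<not> bdd_above ((\<lambda>n. real n / real (lam n)) ` {1..}) \<longrightarrow>
        (\<exists>f \<in> orlicz_class \<omega>. \<forall>x \<in> {0..<1}.
            limsup (\<lambda>n. ereal \<bar>dlvp_mean lam n f x\<bar>) = \<infinity>))"
proof (intro conjI impI allI)
  fix f :: "real \<Rightarrow> real"
  assume O: "(\<lambda>n. real n) \<in> O(\<lambda>n. real (lam n))" and f: "set_integrable lebesgue {0..<1} f"
  from fejer_mean_converges_AE[OF f]
  show "AE x in lebesgue. x \<in> {0..<1} \<longrightarrow> (\<lambda>n. dlvp_mean lam n f x) \<longlonglongrightarrow> f x"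
    by eventually_elim (blast intro: dlvp_mean_converges[OF bounds O])
next
  fix \<omega> assume "orlicz_function \<omega>" "\<omega> \<in> o(\<lambda>t. t * sqrt (ln t))"
    "\<not> bdd_above ((\<lambda>n. real n / real (lam n)) ` {1..})"
  then have "\<exists>f\<in>orlicz_class \<omega>. \<forall>x. limsup (\<lambda>n. ereal \<bar>dlvp_mean lam n f x\<bar>) = \<infinity>"
    by (intro dlvp_mean_divergence bounds nondec)
  then show "\<exists>f \<in> orlicz_class \<omega>. \<forall>x \<in> {0..<1}. limsup (\<lambda>n. ereal \<bar>dlvp_mean lam n f x\<bar>) = \<infinity>"
    by blast
qed

end
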